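(* Let $(M,c)$ be a flat conformal manifold of dimension $n\geqslant3$ and let $x_0\in M$. Let $\Psi_{ijk}$ be a totally symmetric, trace-free tensor at $x_0$ satisfying $$\big(g^{ab}(\Psi_{bij}\Psi_{kla}-\Psi_{bik}\Psi_{jla})\big)_\circ=0$$ (for $g\in c$ at $x_0$; the condition does not depend on the choice of $g\in c$). Then $\Psi_{ijk}$ can be extended to a totally symmetric and trace-free tensor field $S_{ijk}(x)$ in a neighbourhood of $x_0$, $S_{ijk}(x_0)=\Psi_{ijk}$, such that there exists $g\in c$ for which $$\nabla_lS_{ijk}=\tfrac1{18}\Pi_{ijk}\Big(S_{il}{}^aS_{jka}+\tfrac4{n-2}S_j{}^{ab}S_{kab}\,g_{il}\Big)$$ holds, where $\nabla$ is the Levi-Civita connection of $g$.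
   Context: $c=[g]$ is a conformal class of pseudo-Riemannian metrics; $(M,c)$ is flat if $c$ locally contains flat metrics. $\circ$ denotes the totally trace-free part. Indices are raised with $g$. $\Pi_{ijk}X_{ijkl}$ means: sum over all $6$ permutations of $i,j,k$ (no normalisation), then take the part that is trace-free with respect to the indices $i,j,k$ (for each fixed $l$). The metric $g\in c$ is required on the neighbourhood of $x_0$. *)

theory Defs
  imports "HOL-Analysis.Analysis"
begin

section \<open>Smooth manifolds\<close>

text \<open>Differentiability of order \<open>k\<close>, and smoothness, on an open subset of a normed space.\<close>

primrec C_k_on :: "nat \<Rightarrow> ('a::real_normed_vector \<Rightarrow> 'b::real_normed_vector) \<Rightarrow> 'a set \<Rightarrow> bool" where
  "C_k_on 0 f S \<longleftrightarrow> continuous_on S f"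
| "C_k_on (Suc k) f S \<longleftrightarrow> (\<forall>x\<in>S. f differentiable (at x)) \<and>
     (\<forall>v. C_k_on k (\<lambda>x. frechet_derivative f (at x) v) S)"

definition smooth_on :: "('a::real_normed_vector \<Rightarrow> 'b::real_normed_vector) \<Rightarrow> 'a set \<Rightarrow> bool" where
  "smooth_on f S \<longleftrightarrow> (\<forall>k. C_k_on k f S)"

text \<open>A chart is its domain together with its coordinate map.\<close>

type_synonym ('m, 'n) chart = "'m set \<times> ('m \<Rightarrow> real ^ 'n)"

abbreviation dom_chart :: "('m, 'n) chart \<Rightarrow> 'm set" where
  "dom_chart \<phi> \<equiv> fst \<phi>"

abbreviation coord :: "('m, 'n) chart \<Rightarrow> 'm \<Rightarrow> real ^ 'n" where
  "coord \<phi> \<equiv> snd \<phi>"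

definition chart_inv :: "('m, 'n) chart \<Rightarrow> real ^ 'n \<Rightarrow> 'm" where
  "chart_inv \<phi> = inv_into (dom_chart \<phi>) (coord \<phi>)"

text \<open>The manifold is the whole type \<open>'m\<close>, which will be Hausdorff and second countable;
  its dimension is \<open>CARD('n)\<close>. The atlas need not be maximal.\<close>

definition smooth_atlas :: "('m::topological_space, 'n::finite) chart set \<Rightarrow> bool" where
  "smooth_atlas A \<longleftrightarrow>
     (\<Union>\<phi>\<in>A. dom_chart \<phi>) = UNIV \<and>
     (\<forall>\<phi>\<in>A. open (dom_chart \<phi>) \<and> open (coord \<phi> ` dom_chart \<phi>) \<and>
        homeomorphism (dom_chart \<phi>) (coord \<phi> ` dom_chart \<phi>) (coord \<phi>) (chart_inv \<phi>)) \<and>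
     (\<forall>\<phi>\<in>A. \<forall>\<phi>'\<in>A.
        smooth_on (coord \<phi>' \<circ> chart_inv \<phi>) (coord \<phi> ` (dom_chart \<phi> \<inter> dom_chart \<phi>')))"

definition smooth_in_chart ::
  "('m, 'n::finite) chart \<Rightarrow> 'm set \<Rightarrow> ('m \<Rightarrow> 'b::real_normed_vector) \<Rightarrow> bool" where
  "smooth_in_chart \<phi> U f \<longleftrightarrow> smooth_on (f \<circ> chart_inv \<phi>) (coord \<phi> ` (dom_chart \<phi> \<inter> U))"

text \<open>\<open>pd \<phi> l f p\<close> is the partial derivative of \<open>f\<close> at \<open>p\<close> along the \<open>l\<close>-th coordinate of \<open>\<phi>\<close>.\<close>

definition pd :: "('m, 'n::finite) chart \<Rightarrow> 'n \<Rightarrow> ('m \<Rightarrow> real) \<Rightarrow> 'm \<Rightarrow> real" where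
  "pd \<phi> l f p = frechet_derivative (f \<circ> chart_inv \<phi>) (at (coord \<phi> p)) (axis l 1)"


section \<open>Covariant tensors\<close>

text \<open>A tensor is the assignment of its components to every chart of the atlas, subject to the
  transformation law. Values at charts outside the atlas, or at points outside the domain of
  the chart, carry no meaning. \<open>jacobian \<phi> \<phi>' p a i\<close> is the derivative of the \<open>a\<close>-th coordinate
  of \<open>\<phi>\<close> along the \<open>i\<close>-th coordinate of \<open>\<phi>'\<close>.\<close>

type_synonym 'n comp3 = "'n \<Rightarrow> 'n \<Rightarrow> 'n \<Rightarrow> real"
type_synonym 'n comp4 = "'n \<Rightarrow> 'n \<Rightarrow> 'n \<Rightarrow> 'n \<Rightarrow> real"
type_synonym ('m, 'n) tensor3 = "('m, 'n) chart \<Rightarrow> 'n comp3"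
type_synonym ('m, 'n) tensor_field3 = "('m, 'n) chart \<Rightarrow> 'm \<Rightarrow> 'n comp3"
type_synonym ('m, 'n) metric_field = "('m, 'n) chart \<Rightarrow> 'm \<Rightarrow> real ^ 'n ^ 'n"

definition jacobian ::
  "('m, 'n::finite) chart \<Rightarrow> ('m, 'n) chart \<Rightarrow> 'm \<Rightarrow> 'n \<Rightarrow> 'n \<Rightarrow> real" where
  "jacobian \<phi> \<phi>' p a i = pd \<phi>' i (\<lambda>q. coord \<phi> q $ a) p"

definition is_tensor3_at ::
  "('m, 'n::finite) chart set \<Rightarrow> 'm \<Rightarrow> ('m, 'n) tensor3 \<Rightarrow> bool" where
  "is_tensor3_at A p T \<longleftrightarrow>
     (\<forall>\<phi>\<in>A. \<forall>\<phi>'\<in>A. p \<in> dom_chart \<phi> \<inter> dom_chart \<phi>' \<longrightarrow>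
       (\<forall>i j k. T \<phi>' i j k =
         (\<Sum>a\<in>UNIV. \<Sum>b\<in>UNIV. \<Sum>c\<in>UNIV.
            jacobian \<phi> \<phi>' p a i * jacobian \<phi> \<phi>' p b j * jacobian \<phi> \<phi>' p c k * T \<phi> a b c)))"

definition is_tensor_field3 ::
  "('m, 'n::finite) chart set \<Rightarrow> 'm set \<Rightarrow> ('m, 'n) tensor_field3 \<Rightarrow> bool" where
  "is_tensor_field3 A U S \<longleftrightarrow>
     (\<forall>p\<in>U. is_tensor3_at A p (\<lambda>\<phi>. S \<phi> p)) \<and>
     (\<forall>\<phi>\<in>A. \<forall>i j k. smooth_in_chart \<phi> U (\<lambda>p. S \<phi> p i j k))"


section \<open>Metrics and conformal classes\<close>

definition is_metric ::
  "('m, 'n::finite) chart set \<Rightarrow> 'm set \<Rightarrow> ('m, 'n) metric_field \<Rightarrow> bool" where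
  "is_metric A U g \<longleftrightarrow>
     (\<forall>\<phi>\<in>A. smooth_in_chart \<phi> U (g \<phi>)) \<and>
     (\<forall>\<phi>\<in>A. \<forall>p\<in>U \<inter> dom_chart \<phi>. transpose (g \<phi> p) = g \<phi> p \<and> invertible (g \<phi> p)) \<and>
     (\<forall>\<phi>\<in>A. \<forall>\<phi>'\<in>A. \<forall>p\<in>U \<inter> dom_chart \<phi> \<inter> dom_chart \<phi>'. \<forall>i j.
        g \<phi>' p $ i $ j =
          (\<Sum>a\<in>UNIV. \<Sum>b\<in>UNIV. jacobian \<phi> \<phi>' p a i * jacobian \<phi> \<phi>' p b j * g \<phi> p $ a $ b))"

text \<open>\<open>g' = \<Omega> g\<close> on \<open>U\<close> with a positive smooth function \<open>\<Omega>\<close>.\<close>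

definition conformal_on ::
  "('m, 'n::finite) chart set \<Rightarrow> 'm set \<Rightarrow> ('m, 'n) metric_field \<Rightarrow> ('m, 'n) metric_field \<Rightarrow> bool" where
  "conformal_on A U g g' \<longleftrightarrow>
     (\<exists>\<Omega>::'m \<Rightarrow> real. (\<forall>\<phi>\<in>A. smooth_in_chart \<phi> U \<Omega>) \<and> (\<forall>p\<in>U. \<Omega> p > 0) \<and>
        (\<forall>\<phi>\<in>A. \<forall>p\<in>U \<inter> dom_chart \<phi>. g' \<phi> p = \<Omega> p *\<^sub>R g \<phi> p))"

definition conformal_class ::
  "('m, 'n::finite) chart set \<Rightarrow> ('m, 'n) metric_field set \<Rightarrow> bool" where
  "conformal_class A c \<longleftrightarrow>
     (\<exists>g. is_metric A UNIV g \<and> c = {g'. is_metric A UNIV g' \<and> conformal_on A UNIV g g'})"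

text \<open>\<open>g\<close> is a metric on the open set \<open>U\<close> belonging to the restriction of \<open>c\<close> to \<open>U\<close>.\<close>

definition local_member ::
  "('m, 'n::finite) chart set \<Rightarrow> ('m, 'n) metric_field set \<Rightarrow> 'm set \<Rightarrow> ('m, 'n) metric_field \<Rightarrow> bool" where
  "local_member A c U g \<longleftrightarrow> is_metric A U g \<and> (\<exists>h\<in>c. conformal_on A U h g)"

abbreviation ginv :: "real ^ 'n ^ 'n \<Rightarrow> 'n::finite \<Rightarrow> 'n \<Rightarrow> real" where
  "ginv G a b \<equiv> matrix_inv G $ a $ b"

text \<open>\<open>christoffel g \<phi> p k i j\<close> is \<open>\<Gamma>\<^sup>k\<^sub>i\<^sub>j\<close>, for the Levi-Civita connection of \<open>g\<close>.\<close>

definition christoffel ::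
  "('m, 'n::finite) metric_field \<Rightarrow> ('m, 'n) chart \<Rightarrow> 'm \<Rightarrow> 'n \<Rightarrow> 'n \<Rightarrow> 'n \<Rightarrow> real" where
  "christoffel g \<phi> p k i j = (1/2) * (\<Sum>l\<in>UNIV. ginv (g \<phi> p) k l *
      (pd \<phi> i (\<lambda>q. g \<phi> q $ j $ l) p + pd \<phi> j (\<lambda>q. g \<phi> q $ i $ l) p
       - pd \<phi> l (\<lambda>q. g \<phi> q $ i $ j) p))"

text \<open>\<open>riemann g \<phi> p r s m v\<close> is \<open>R\<^sup>r\<^sub>s\<^sub>m\<^sub>v\<close>, where
  \<open>R(\<partial>\<^sub>m, \<partial>\<^sub>v) \<partial>\<^sub>s = R\<^sup>r\<^sub>s\<^sub>m\<^sub>v \<partial>\<^sub>r\<close>.\<close>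

definition riemann ::
  "('m, 'n::finite) metric_field \<Rightarrow> ('m, 'n) chart \<Rightarrow> 'm \<Rightarrow> 'n comp4" where
  "riemann g \<phi> p r s m v =
     pd \<phi> m (\<lambda>q. christoffel g \<phi> q r v s) p - pd \<phi> v (\<lambda>q. christoffel g \<phi> q r m s) p
     + (\<Sum>t\<in>UNIV. christoffel g \<phi> p r m t * christoffel g \<phi> p t v s
                 - christoffel g \<phi> p r v t * christoffel g \<phi> p t m s)"

definition flat_metric ::
  "('m, 'n::finite) chart set \<Rightarrow> 'm set \<Rightarrow> ('m, 'n) metric_field \<Rightarrow> bool" where
  "flat_metric A U g \<longleftrightarrow>
     is_metric A U g \<and> (\<forall>\<phi>\<in>A. \<forall>p\<in>U \<inter> dom_chart \<phi>. \<forall>r s m v. riemann g \<phi> p r s m v = 0)"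

definition conformally_flat ::
  "('m::topological_space, 'n::finite) chart set \<Rightarrow> ('m, 'n) metric_field set \<Rightarrow> bool" where
  "conformally_flat A c \<longleftrightarrow>
     (\<forall>p. \<exists>U g. open U \<and> p \<in> U \<and> local_member A c U g \<and> flat_metric A U g)"

text \<open>\<open>cov_deriv3 g S \<phi> p l i j k\<close> is \<open>\<nabla>\<^sub>l S\<^sub>i\<^sub>j\<^sub>k\<close>.\<close>

definition cov_deriv3 ::
  "('m, 'n::finite) metric_field \<Rightarrow> ('m, 'n) tensor_field3 \<Rightarrow> ('m, 'n) chart \<Rightarrow> 'm \<Rightarrow> 'n comp4" where
  "cov_deriv3 g S \<phi> p l i j k =
     pd \<phi> l (\<lambda>q. S \<phi> q i j k) p
     - (\<Sum>m\<in>UNIV. christoffel g \<phi> p m l i * S \<phi> p m j k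
                 + christoffel g \<phi> p m l j * S \<phi> p i m k
                 + christoffel g \<phi> p m l k * S \<phi> p i j m)"


section \<open>Index symmetries and trace-free parts\<close>

text \<open>In this section \<open>G\<close> is the component matrix of a metric at a point.\<close>

definition totally_symmetric :: "'n comp3 \<Rightarrow> bool" where
  "totally_symmetric T \<longleftrightarrow> (\<forall>i j k. T i j k = T j i k \<and> T i j k = T i k j)"

definition trace_free3 :: "real ^ 'n ^ 'n \<Rightarrow> 'n::finite comp3 \<Rightarrow> bool" where
  "trace_free3 G T \<longleftrightarrow>
     (\<forall>k. (\<Sum>a\<in>UNIV. \<Sum>b\<in>UNIV. ginv G a b * T a b k) = 0 \<and>
          (\<Sum>a\<in>UNIV. \<Sum>b\<in>UNIV. ginv G a b * T a k b) = 0 \<and>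
          (\<Sum>a\<in>UNIV. \<Sum>b\<in>UNIV. ginv G a b * T k a b) = 0)"

definition trace_free4 :: "real ^ 'n ^ 'n \<Rightarrow> 'n::finite comp4 \<Rightarrow> bool" where
  "trace_free4 G T \<longleftrightarrow>
     (\<forall>k l. (\<Sum>a\<in>UNIV. \<Sum>b\<in>UNIV. ginv G a b * T a b k l) = 0 \<and>
            (\<Sum>a\<in>UNIV. \<Sum>b\<in>UNIV. ginv G a b * T a k b l) = 0 \<and>
            (\<Sum>a\<in>UNIV. \<Sum>b\<in>UNIV. ginv G a b * T a k l b) = 0 \<and>
            (\<Sum>a\<in>UNIV. \<Sum>b\<in>UNIV. ginv G a b * T k a b l) = 0 \<and>
            (\<Sum>a\<in>UNIV. \<Sum>b\<in>UNIV. ginv G a b * T k a l b) = 0 \<and>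
            (\<Sum>a\<in>UNIV. \<Sum>b\<in>UNIV. ginv G a b * T k l a b) = 0)"

definition pure_trace4 :: "real ^ 'n ^ 'n \<Rightarrow> 'n::finite comp4 \<Rightarrow> bool" where
  "pure_trace4 G T \<longleftrightarrow>
     (\<exists>H1 H2 H3 H4 H5 H6 :: 'n \<Rightarrow> 'n \<Rightarrow> real. \<forall>i j k l.
        T i j k l = G $ i $ j * H1 k l + G $ i $ k * H2 j l + G $ i $ l * H3 j k
                  + G $ j $ k * H4 i l + G $ j $ l * H5 i k + G $ k $ l * H6 i j)"

text \<open>\<open>T'\<close> is the totally trace-free part of \<open>T\<close>: trace-free and pure-trace
  tensors are complementary subspaces, and \<open>T'\<close> is the trace-free component of \<open>T\<close>.\<close>

definition is_trace_free_part4 ::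
  "real ^ 'n ^ 'n \<Rightarrow> 'n::finite comp4 \<Rightarrow> 'n comp4 \<Rightarrow> bool" where
  "is_trace_free_part4 G T T' \<longleftrightarrow>
     trace_free4 G T' \<and> pure_trace4 G (\<lambda>i j k l. T i j k l - T' i j k l)"

text \<open>The trace-free part of a totally symmetric \<open>Y\<close>; the factor is determined by
  \<open>g\<^sup>a\<^sup>b (g\<^sub>a\<^sub>b t\<^sub>k + g\<^sub>a\<^sub>k t\<^sub>b + g\<^sub>b\<^sub>k t\<^sub>a) = (n + 2) t\<^sub>k\<close>
  (see \<open>trace_free_part_sym3_trace_free\<close> below).\<close>

definition trace_free_part_sym3 ::
  "real ^ 'n ^ 'n \<Rightarrow> 'n::finite comp3 \<Rightarrow> 'n comp3" where
  "trace_free_part_sym3 G Y i j k =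
     (let t = (\<lambda>m. \<Sum>a\<in>UNIV. \<Sum>b\<in>UNIV. ginv G a b * Y a b m) in
      Y i j k - (G $ i $ j * t k + G $ i $ k * t j + G $ j $ k * t i) / (real CARD('n) + 2))"

definition symmetrise3 :: "'n comp3 \<Rightarrow> 'n comp3" where
  "symmetrise3 X i j k = X i j k + X i k j + X j i k + X j k i + X k i j + X k j i"

text \<open>\<open>\<Pi>\<^sub>i\<^sub>j\<^sub>k X\<^sub>i\<^sub>j\<^sub>k\<^sub>l\<close>\<close>

definition Pi_ijk :: "real ^ 'n ^ 'n \<Rightarrow> 'n::finite comp4 \<Rightarrow> 'n comp4" where
  "Pi_ijk G X i j k l = trace_free_part_sym3 G (symmetrise3 (\<lambda>a b c. X a b c l)) i j k"

lemma totally_symmetric_symmetrise3: "totally_symmetric (symmetrise3 X)"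
  by (simp add: totally_symmetric_def symmetrise3_def)

lemma trace_free_part_sym3_trace_free:
  fixes G :: "real ^ 'n ^ 'n"
  assumes Y: "totally_symmetric Y" and sym: "transpose G = G" and inv: "invertible G"
  shows "trace_free3 G (trace_free_part_sym3 G Y)"
proof -
  define t where "t = (\<lambda>m. \<Sum>a\<in>UNIV. \<Sum>b\<in>UNIV. ginv G a b * Y a b m)"
  let ?Z = "trace_free_part_sym3 G Y"
  have Gs: "G $ i $ j = G $ j $ i" for i j
    using sym by (metis (no_types) transpose_def vec_lambda_beta)
  have Ys: "Y i j k = Y j i k" "Y i j k = Y i k j" for i j k
    using Y unfolding totally_symmetric_def by metis+
  have Z: "?Z i j k = Y i j k - (G $ i $ j * t k + G $ i $ k * t j + G $ j $ k * t i) / (real CARD('n) + 2)"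
    for i j k by (simp add: trace_free_part_sym3_def t_def)
  have Zs: "?Z i j k = ?Z j i k" "?Z i j k = ?Z i k j" for i j k
    unfolding Z using Ys[of i j k] Gs[of i j] Gs[of i k] Gs[of j k] by (simp_all add: algebra_simps)
  have "matrix_inv G ** G = mat 1" "G ** matrix_inv G = mat 1"
    using someI_ex[OF inv[unfolded invertible_def]] by (simp_all add: matrix_inv_def)
  then have L: "(\<Sum>b\<in>UNIV. ginv G a b * G $ b $ k) = (if a = k then 1 else 0)"
    and R: "(\<Sum>b\<in>UNIV. G $ a $ b * ginv G b k) = (if a = k then 1 else 0)" for a k
    by (simp_all add: matrix_matrix_mult_def mat_def vec_eq_iff)
  have 1: "(\<Sum>a\<in>UNIV. \<Sum>b\<in>UNIV. ginv G a b * (G $ a $ b * t k)) = real CARD('n) * t k" for k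
  proof -
    have "(\<Sum>a\<in>UNIV. \<Sum>b\<in>UNIV. ginv G a b * (G $ a $ b * t k))
        = (\<Sum>a\<in>UNIV. (\<Sum>b\<in>UNIV. ginv G a b * G $ b $ a) * t k)"
      by (simp add: sum_distrib_right mult.assoc Gs)
    then show ?thesis by (simp add: L)
  qed
  have 2: "(\<Sum>a\<in>UNIV. \<Sum>b\<in>UNIV. ginv G a b * (G $ b $ k * t a)) = t k" for k
  proof -
    have "(\<Sum>a\<in>UNIV. \<Sum>b\<in>UNIV. ginv G a b * (G $ b $ k * t a))
        = (\<Sum>a\<in>UNIV. (\<Sum>b\<in>UNIV. ginv G a b * G $ b $ k) * t a)"
      by (simp add: sum_distrib_right mult.assoc)
    then show ?thesis by (simp add: L if_distrib[of "\<lambda>x. x * _"] cong: if_cong)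
  qed
  have 3: "(\<Sum>a\<in>UNIV. \<Sum>b\<in>UNIV. ginv G a b * (G $ a $ k * t b)) = t k" for k
  proof -
    have "(\<Sum>a\<in>UNIV. \<Sum>b\<in>UNIV. ginv G a b * (G $ a $ k * t b))
        = (\<Sum>b\<in>UNIV. \<Sum>a\<in>UNIV. ginv G a b * (G $ a $ k * t b))"
      by (rule sum.swap)
    also have "\<dots> = (\<Sum>b\<in>UNIV. (\<Sum>a\<in>UNIV. G $ k $ a * ginv G a b) * t b)"
      by (simp add: sum_distrib_left mult_ac Gs[of _ k])
    finally show ?thesis by (simp add: R if_distrib[of "\<lambda>x. x * _"] cong: if_cong)
  qed
  have tr: "(\<Sum>a\<in>UNIV. \<Sum>b\<in>UNIV. ginv G a b * ?Z a b k) = 0" for k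
  proof -
    have "(\<Sum>a\<in>UNIV. \<Sum>b\<in>UNIV. ginv G a b * ?Z a b k)
      = (\<Sum>a\<in>UNIV. \<Sum>b\<in>UNIV. ginv G a b * Y a b k
          - (ginv G a b * (G $ a $ b * t k) + ginv G a b * (G $ a $ k * t b)
             + ginv G a b * (G $ b $ k * t a)) / (real CARD('n) + 2))"
      unfolding Z by (intro sum.cong refl) (simp add: algebra_simps)
    also have "\<dots> = t k - (real CARD('n) * t k + t k + t k) / (real CARD('n) + 2)"
      unfolding sum_subtractf sum_divide_distrib[symmetric] sum.distrib 1 2 3 by (simp add: t_def)
    also have "real CARD('n) * t k + t k + t k = t k * (real CARD('n) + 2)"
      by (simp add: algebra_simps)
    finally show ?thesis by (simp add: add_nonneg_eq_0_iff)
  qed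
  have "(\<Sum>a\<in>UNIV. \<Sum>b\<in>UNIV. ginv G a b * ?Z a k b) = 0"
       "(\<Sum>a\<in>UNIV. \<Sum>b\<in>UNIV. ginv G a b * ?Z k a b) = 0" for k
    using tr[of k] by (metis (no_types, lifting) Zs sum.cong)+
  with tr show ?thesis unfolding trace_free3_def by blast
qed


section \<open>The quadratic expressions\<close>

text \<open>\<open>g\<^sup>a\<^sup>b (\<Psi>\<^sub>b\<^sub>i\<^sub>j \<Psi>\<^sub>k\<^sub>l\<^sub>a - \<Psi>\<^sub>b\<^sub>i\<^sub>k \<Psi>\<^sub>j\<^sub>l\<^sub>a)\<close>\<close>

definition quadratic_condition4 :: "real ^ 'n ^ 'n \<Rightarrow> 'n::finite comp3 \<Rightarrow> 'n comp4" where
  "quadratic_condition4 G P i j k l =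
     (\<Sum>a\<in>UNIV. \<Sum>b\<in>UNIV. ginv G a b * (P b i j * P k l a - P b i k * P j l a))"

text \<open>\<open>S\<^sub>i\<^sub>l\<^sup>a S\<^sub>j\<^sub>k\<^sub>a + 4/(n-2) S\<^sub>j\<^sup>a\<^sup>b S\<^sub>k\<^sub>a\<^sub>b g\<^sub>i\<^sub>l\<close>\<close>

definition rhs4 :: "real ^ 'n ^ 'n \<Rightarrow> 'n::finite comp3 \<Rightarrow> 'n comp4" where
  "rhs4 G S i j k l =
     (\<Sum>a\<in>UNIV. \<Sum>b\<in>UNIV. ginv G a b * S i l b * S j k a)
     + 4 / (real CARD('n) - 2) *
       (\<Sum>a\<in>UNIV. \<Sum>b\<in>UNIV. \<Sum>c\<in>UNIV. \<Sum>d\<in>UNIV. ginv G a c * ginv G b d * S j c d * S k a b)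
       * G $ i $ l"

end

theory Submission
  imports Defs
begin

text \<open>
  The equation for \<open>S\<close> is overdetermined, but it has explicit solutions, built from a commutative
  algebra attached to \<open>\<Psi>\<close>.

  Let \<open>V\<close> be the tangent space at \<open>x\<^sub>0\<close> with the form \<open>ip\<close> of a flat metric of the conformal class, and
  let \<open>S0 u\<close> be the endomorphisms of \<open>V\<close> given by the cubic form \<open>C = - \<Psi> / 3\<close>. The quadratic condition
  says that their commutators form a curvature tensor without Weyl part, hence are determined by
  one symmetric endomorphism \<open>N\<close>. This is what makes it possible to enlarge \<open>V\<close> by two null directions
  \<open>1\<close> and \<open>\<nu>\<close> to a commutative algebra with unit \<open>1\<close> in which \<open>u v = S0 u v + ip u v \<nu> + ip (N u) v 1\<close>. Associativity
  of the products with \<open>\<nu>\<close> requires a Codazzi equation for \<open>N\<close> and a formula for \<open>N\<^sup>2\<close>; both follow from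
  the commutator relation alone (\<open>codazzi\<close>, \<open>N_N\<close>, \<open>mul_assoc\<close>). The algebra carries an invariant
  form \<open>eps (x y)\<close> that extends \<open>ip\<close> and has null vectors \<open>1\<close> and \<open>\<nu>\<close>.

  The null cone of this form models the flat conformal structure. In flat coordinates \<open>f\<close> the
  paraboloid \<open>y = 1 + f - (ip f f / 2) \<nu>\<close> is a section of the cone on which the form induces the flat
  metric, and a multiple \<open>\<sigma> = u y\<close> induces the metric multiplied by \<open>u\<^sup>2\<close>. Every section has the cubic form
  \<open>C\<^sub>i\<^sub>j\<^sub>k = eps (\<sigma>\<inverse> \<partial>\<^sub>i\<sigma> \<partial>\<^sub>j\<sigma> \<partial>\<^sub>k\<sigma>)\<close>. It is trace-free if \<open>\<sigma>\<inverse> \<partial>\<^sub>k\<sigma>\<close> is orthogonal to the Casimir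
  element, which prescribes the closed differential of \<open>ln u\<close>. For such a section, differentiating \<open>C\<close>
  and expanding the result in the frame formed by \<open>\<sigma>\<close>, \<open>\<partial>\<^sub>i\<sigma>\<close> and a transversal null vector gives
  the equation for \<open>S = - 3 C\<close> and the metric \<open>u\<^sup>2\<close> times the flat one: associativity turns the term
  \<open>\<sigma>\<inverse> \<sigma>\<inverse> \<partial>\<^sub>l\<sigma> \<partial>\<^sub>i\<sigma> \<partial>\<^sub>j\<sigma> \<partial>\<^sub>k\<sigma>\<close> into the square of \<open>C\<close> up to traces (\<open>structure_equation\<close>). At \<open>x\<^sub>0\<close> one has
  \<open>\<sigma> = 1\<close> and \<open>S = \<Psi>\<close>.

  What remains are existence statements for \<open>f\<close> and \<open>u\<close>. Both are instances of the solvability of a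
  linear total differential system with vanishing curvature (\<open>flat_linear_system_solvable\<close>),
  which is proved by Picard iteration.
\<close>

section \<open>Calculus of smooth maps on open sets\<close>

lemma C_k_on_cong:
  assumes "open S" "\<And>x. x \<in> S \<Longrightarrow> f x = g x"
  shows "C_k_on k f S \<longleftrightarrow> C_k_on k g S"
  using assms(2)
proof (induction k arbitrary: f g)
  case 0
  then show ?case by (auto cong: continuous_on_cong)
next
  case (Suc k)
  have ev: "\<forall>\<^sub>F y in at x. f y = g y" "f x = g x" if "x \<in> S" for x
    using that assms(1) Suc.prems eventually_at_topological by blast+
  have hd: "(f has_derivative D) (at x) \<longleftrightarrow> (g has_derivative D) (at x)" if "x \<in> S" for x D
    using has_derivative_transform_eventually[of f D x UNIV g]
      has_derivative_transform_eventually[of g D x UNIV f] ev[OF that]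
    by (auto simp: eq_commute)
  then have "f differentiable (at x) \<longleftrightarrow> g differentiable (at x)"
    "frechet_derivative f (at x) = frechet_derivative g (at x)" if "x \<in> S" for x
    using that by (simp_all add: differentiable_def frechet_derivative_def)
  moreover from this(2) have "C_k_on k (\<lambda>x. frechet_derivative f (at x) v) S
      \<longleftrightarrow> C_k_on k (\<lambda>x. frechet_derivative g (at x) v) S" for v
    by (intro Suc.IH) simp
  ultimately show ?case by simp
qed

lemma C_k_on_SucI:
  assumes "open S" "\<And>x. x \<in> S \<Longrightarrow> (f has_derivative f' x) (at x)"
    "\<And>v. C_k_on k (\<lambda>x. f' x v) S"
  shows "C_k_on (Suc k) f S"
proof -
  have "frechet_derivative f (at x) = f' x" if "x \<in> S" for x
    using assms(2)[OF that] frechet_derivative_at by metis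
  then have "C_k_on k (\<lambda>x. frechet_derivative f (at x) v) S \<longleftrightarrow> C_k_on k (\<lambda>x. f' x v) S" for v
    by (intro C_k_on_cong assms(1)) simp
  with assms show ?thesis by (auto simp: differentiable_def)
qed

lemma C_k_on_Suc_imp: "C_k_on (Suc k) f S \<Longrightarrow> C_k_on k f S"
proof (induction k arbitrary: f)
  case 0
  then have "\<forall>x\<in>S. f differentiable (at x)" by simp
  then show ?case
    by (simp add: continuous_at_imp_continuous_on differentiable_imp_continuous_within)
next
  case (Suc k)
  have "C_k_on k (\<lambda>x. frechet_derivative f (at x) v) S" for v
    by (rule Suc.IH) (use Suc.prems C_k_on.simps(2) in blast)
  then show ?case using Suc.prems C_k_on.simps(2) by blast
qed

lemma C_k_on_subset: "C_k_on k f S \<Longrightarrow> T \<subseteq> S \<Longrightarrow> C_k_on k f T"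
proof (induction k arbitrary: f)
  case 0
  then show ?case using continuous_on_subset by auto
next
  case (Suc k)
  then show ?case unfolding C_k_on.simps(2) by blast
qed

lemma C_k_on_imp_continuous: "C_k_on k f S \<Longrightarrow> continuous_on S f"
proof (induction k)
  case (Suc k)
  then show ?case using C_k_on_Suc_imp by blast
qed simp

lemma C_k_on_has_derivative:
  "C_k_on (Suc k) f S \<Longrightarrow> x \<in> S \<Longrightarrow> (f has_derivative frechet_derivative f (at x)) (at x)"
  unfolding frechet_derivative_works[symmetric] C_k_on.simps by blast

lemma C_k_on_frechet_derivative:
  "C_k_on (Suc k) f S \<Longrightarrow> C_k_on k (\<lambda>x. frechet_derivative f (at x) v) S"
  unfolding C_k_on.simps by blast

lemma C_k_on_const: "open S \<Longrightarrow> C_k_on k (\<lambda>x. c) S"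
proof (induction k arbitrary: c)
  case (Suc k)
  show ?case
    by (rule C_k_on_SucI[where f' = "\<lambda>x h. 0", OF Suc.prems has_derivative_const Suc.IH[OF Suc.prems]])
qed simp

lemma C_k_on_bounded_linear:
  assumes "open S" "bounded_linear L"
  shows "C_k_on k f S \<Longrightarrow> C_k_on k (\<lambda>x. L (f x)) S"
proof (induction k arbitrary: f)
  case 0
  then show ?case using assms(2) bounded_linear.continuous_on by auto
next
  case (Suc k)
  show ?case
  proof (rule C_k_on_SucI[where f' = "\<lambda>x h. L (frechet_derivative f (at x) h)"])
    show "((\<lambda>x. L (f x)) has_derivative (\<lambda>h. L (frechet_derivative f (at x) h))) (at x)"
      if "x \<in> S" for x
      using bounded_linear.has_derivative[OF assms(2) C_k_on_has_derivative[OF Suc.prems that]] .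
    show "C_k_on k (\<lambda>x. L (frechet_derivative f (at x) v)) S" for v
      by (intro Suc.IH C_k_on_frechet_derivative Suc.prems)
  qed (rule assms(1))
qed

lemma C_k_on_add:
  assumes "open S"
  shows "C_k_on k f S \<Longrightarrow> C_k_on k g S \<Longrightarrow> C_k_on k (\<lambda>x. f x + g x) S"
proof (induction k arbitrary: f g)
  case 0
  then show ?case by (auto intro: continuous_on_add)
next
  case (Suc k)
  show ?case
  proof (rule C_k_on_SucI[where f' = "\<lambda>x h. frechet_derivative f (at x) h + frechet_derivative g (at x) h"])
    show "((\<lambda>x. f x + g x) has_derivative
            (\<lambda>h. frechet_derivative f (at x) h + frechet_derivative g (at x) h)) (at x)"
      if "x \<in> S" for x
      using has_derivative_add C_k_on_has_derivative[OF Suc.prems(1) that]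
        C_k_on_has_derivative[OF Suc.prems(2) that] by blast
    show "C_k_on k (\<lambda>x. frechet_derivative f (at x) v + frechet_derivative g (at x) v) S" for v
      by (intro Suc.IH C_k_on_frechet_derivative Suc.prems)
  qed (rule assms)
qed

lemma C_k_on_bilinear:
  assumes "open S" "bounded_bilinear B"
  shows "C_k_on k f S \<Longrightarrow> C_k_on k g S \<Longrightarrow> C_k_on k (\<lambda>x. B (f x) (g x)) S"
proof (induction k arbitrary: f g)
  case 0
  then show ?case using bounded_bilinear.continuous_on[OF assms(2)] by auto
next
  case (Suc k)
  let ?f' = "\<lambda>x. frechet_derivative f (at x)" and ?g' = "\<lambda>x. frechet_derivative g (at x)"
  show ?case
  proof (rule C_k_on_SucI[where f' = "\<lambda>x h. B (f x) (?g' x h) + B (?f' x h) (g x)"])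
    show "((\<lambda>x. B (f x) (g x)) has_derivative
            (\<lambda>h. B (f x) (?g' x h) + B (?f' x h) (g x))) (at x)" if "x \<in> S" for x
      using bounded_bilinear.FDERIV[OF assms(2) C_k_on_has_derivative[OF Suc.prems(1) that]
        C_k_on_has_derivative[OF Suc.prems(2) that]] .
    show "C_k_on k (\<lambda>x. B (f x) (?g' x v) + B (?f' x v) (g x)) S" for v
      by (intro C_k_on_add assms(1) Suc.IH C_k_on_frechet_derivative Suc.prems
          Suc.prems[THEN C_k_on_Suc_imp])
  qed (rule assms(1))
qed

lemma C_k_on_sum:
  assumes "open S" "\<And>i. i \<in> I \<Longrightarrow> C_k_on k (f i) S"
  shows "C_k_on k (\<lambda>x. \<Sum>i\<in>I. f i x) S"
  using assms(2)
proof (induction I rule: infinite_finite_induct)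
  case (insert i I)
  then show ?case by (simp add: C_k_on_add[OF assms(1)])
qed (simp_all add: C_k_on_const[OF assms(1)])

text \<open>The chain rule writes a partial derivative of a composition as a finite sum of products
  of partial derivatives, which is where the middle space has to be finite-dimensional.\<close>

lemma C_k_on_compose:
  fixes f :: "'b::euclidean_space \<Rightarrow> 'c::real_normed_vector"
  assumes "open S" "open T" "g ` S \<subseteq> T"
  shows "C_k_on k f T \<Longrightarrow> C_k_on k g S \<Longrightarrow> C_k_on k (\<lambda>x. f (g x)) S"
proof (induction k arbitrary: f)
  case 0
  then show ?case using assms(3) continuous_on_compose2 by auto
next
  case (Suc k)
  let ?f' = "\<lambda>y. frechet_derivative f (at y)" and ?g' = "\<lambda>x. frechet_derivative g (at x)"
  have gT: "g x \<in> T" if "x \<in> S" for x using that assms(3) by auto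
  show ?case
  proof (rule C_k_on_SucI[where f' = "\<lambda>x h. \<Sum>b\<in>Basis. (?g' x h \<bullet> b) *\<^sub>R ?f' (g x) b"])
    show "((\<lambda>x. f (g x)) has_derivative (\<lambda>h. \<Sum>b\<in>Basis. (?g' x h \<bullet> b) *\<^sub>R ?f' (g x) b)) (at x)"
      if "x \<in> S" for x
    proof -
      have l: "linear (?f' (g x))"
        using C_k_on_has_derivative[OF Suc.prems(1) gT[OF that]] has_derivative_linear by blast
      have eq: "?f' (g x) w = (\<Sum>b\<in>Basis. (w \<bullet> b) *\<^sub>R ?f' (g x) b)" for w
        by (subst euclidean_representation[symmetric])
          (simp only: linear_sum[OF l] linear_scale[OF l])
      have "((\<lambda>x. f (g x)) has_derivative (\<lambda>h. ?f' (g x) (?g' x h))) (at x)"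
        using has_derivative_compose[OF C_k_on_has_derivative[OF Suc.prems(2) that]
            C_k_on_has_derivative[OF Suc.prems(1) gT[OF that]]] .
      then show ?thesis by (subst (asm) eq)
    qed
    show "C_k_on k (\<lambda>x. \<Sum>b\<in>Basis. (?g' x v \<bullet> b) *\<^sub>R ?f' (g x) b) S" for v
    proof (rule C_k_on_sum[OF assms(1)])
      fix b :: 'b
      have 1: "C_k_on k (\<lambda>x. ?g' x v) S" by (rule C_k_on_frechet_derivative[OF Suc.prems(2)])
      have 2: "C_k_on k (\<lambda>x. ?f' (g x) b) S"
        by (rule Suc.IH[OF C_k_on_frechet_derivative[OF Suc.prems(1)] C_k_on_Suc_imp[OF Suc.prems(2)]])
      show "C_k_on k (\<lambda>x. (?g' x v \<bullet> b) *\<^sub>R ?f' (g x) b) S"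
        by (rule C_k_on_bilinear[OF assms(1) bounded_bilinear_scaleR
              C_k_on_bounded_linear[OF assms(1) bounded_linear_inner_left 1] 2])
    qed
  qed (rule assms(1))
qed

lemma smooth_on_cong:
  assumes "open S" "\<And>x. x \<in> S \<Longrightarrow> f x = g x"
  shows "smooth_on f S \<longleftrightarrow> smooth_on g S"
proof -
  have "C_k_on k f S \<longleftrightarrow> C_k_on k g S" for k
    by (rule C_k_on_cong[OF assms])
  then show ?thesis by (simp only: smooth_on_def)
qed

lemma smooth_on_subset: "smooth_on f S \<Longrightarrow> T \<subseteq> S \<Longrightarrow> smooth_on f T"
  unfolding smooth_on_def by (blast intro: C_k_on_subset)

lemma smooth_on_const: "open S \<Longrightarrow> smooth_on (\<lambda>x. c) S"
  by (simp add: smooth_on_def C_k_on_const)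

lemma smooth_on_bounded_linear:
  "bounded_linear L \<Longrightarrow> open S \<Longrightarrow> smooth_on f S \<Longrightarrow> smooth_on (\<lambda>x. L (f x)) S"
  by (simp add: smooth_on_def C_k_on_bounded_linear)

lemma smooth_on_add:
  "open S \<Longrightarrow> smooth_on f S \<Longrightarrow> smooth_on g S \<Longrightarrow> smooth_on (\<lambda>x. f x + g x) S"
  by (simp add: smooth_on_def C_k_on_add)

lemma smooth_on_bilinear:
  "bounded_bilinear B \<Longrightarrow> open S \<Longrightarrow> smooth_on f S \<Longrightarrow> smooth_on g S
    \<Longrightarrow> smooth_on (\<lambda>x. B (f x) (g x)) S"
  by (simp add: smooth_on_def C_k_on_bilinear)

lemmas smooth_on_mult = smooth_on_bilinear[OF bounded_bilinear_mult]
lemmas smooth_on_scaleR = smooth_on_bilinear[OF bounded_bilinear_scaleR]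

lemma smooth_on_diff:
  fixes f :: "_ \<Rightarrow> 'b::real_normed_vector"
  assumes "open S" "smooth_on f S" "smooth_on g S"
  shows "smooth_on (\<lambda>x. f x - g x) S"
  using smooth_on_add[OF assms(1,2)
      smooth_on_bounded_linear[OF bounded_linear_minus[OF bounded_linear_ident] assms(1,3)]]
  by simp

lemma smooth_on_sum:
  "open S \<Longrightarrow> (\<And>i. i \<in> I \<Longrightarrow> smooth_on (f i) S) \<Longrightarrow> smooth_on (\<lambda>x. \<Sum>i\<in>I. f i x) S"
  by (simp add: smooth_on_def C_k_on_sum)

lemma smooth_on_ident: "open S \<Longrightarrow> smooth_on (\<lambda>x. x) S"
proof -
  assume S: "open S"
  have "C_k_on k (\<lambda>x. x) S" for k
  proof (cases k)
    case (Suc j)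
    show ?thesis unfolding Suc
      by (rule C_k_on_SucI[where f' = "\<lambda>x h. h", OF S has_derivative_ident C_k_on_const[OF S]])
  qed simp
  then show ?thesis by (simp add: smooth_on_def)
qed

lemma smooth_on_compose:
  fixes f :: "'b::euclidean_space \<Rightarrow> 'c::real_normed_vector"
  shows "smooth_on f T \<Longrightarrow> smooth_on g S \<Longrightarrow> open S \<Longrightarrow> open T \<Longrightarrow> g ` S \<subseteq> T
    \<Longrightarrow> smooth_on (\<lambda>x. f (g x)) S"
  by (simp add: smooth_on_def C_k_on_compose)

lemma smooth_on_imp_continuous: "smooth_on f S \<Longrightarrow> continuous_on S f"
  using C_k_on_imp_continuous smooth_on_def by blast

lemma smooth_on_has_derivative:
  "smooth_on f S \<Longrightarrow> x \<in> S \<Longrightarrow> (f has_derivative frechet_derivative f (at x)) (at x)"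
  using C_k_on_has_derivative smooth_on_def by blast

lemma smooth_on_frechet_derivative:
  "smooth_on f S \<Longrightarrow> smooth_on (\<lambda>x. frechet_derivative f (at x) v) S"
  unfolding smooth_on_def by (blast intro: C_k_on_frechet_derivative)

lemma smooth_on_vec_lambda:
  fixes f :: "'n::finite \<Rightarrow> 'a::real_normed_vector \<Rightarrow> 'b::real_normed_vector"
  assumes "open S" "\<And>i. smooth_on (f i) S"
  shows "smooth_on (\<lambda>x. \<chi> i. f i x) S"
proof -
  have ax: "bounded_linear (\<lambda>y::'b. \<chi> j. if j = i then y else 0)" for i :: 'n
  proof (rule bounded_linear_intro[where K = 1])
    fix y :: 'b
    show "norm (\<chi> j. if j = i then y else 0) \<le> norm y * 1"
      by (simp add: norm_vec_def L2_set_def if_distrib[of norm] if_distrib[of "\<lambda>x. x\<^sup>2"] cong: if_cong)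
  qed (auto simp: vec_eq_iff)
  have "smooth_on (\<lambda>x. \<Sum>i\<in>UNIV. \<chi> j. if j = i then f i x else 0) S"
    by (intro smooth_on_sum smooth_on_bounded_linear[OF ax] assms)
  also have "(\<lambda>x. \<Sum>i\<in>UNIV. \<chi> j. if j = i then f i x else 0) = (\<lambda>x. \<chi> i. f i x)"
    by (auto simp: vec_eq_iff)
  finally show ?thesis .
qed

lemma smooth_on_vec_nth:
  "open S \<Longrightarrow> smooth_on f S \<Longrightarrow> smooth_on (\<lambda>x. f x $ i) S"
  by (rule smooth_on_bounded_linear[OF bounded_linear_vec_nth])

text \<open>Everything follows from \<open>z(y) - z(x) = - z(y) (f(y) - f(x)) z(x)\<close>: first continuity of \<open>z\<close>,
  then its derivative \<open>- z f' z\<close>, and from that smoothness by induction on the order. The product is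
  a variable because the lemma is needed for matrices and for the algebra of a cubic form.\<close>

lemma smooth_on_inverse:
  fixes P :: "'b::real_normed_vector \<Rightarrow> 'b \<Rightarrow> 'b"
  assumes P: "bounded_bilinear P" and assoc: "\<And>a b c. P (P a b) c = P a (P b c)"
    and one: "\<And>a. P one a = a" "\<And>a. P a one = a"
    and S: "open S" and f: "smooth_on f S"
    and zf: "\<And>x. x \<in> S \<Longrightarrow> P (z x) (f x) = one" and fz: "\<And>x. x \<in> S \<Longrightarrow> P (f x) (z x) = one"
  shows "smooth_on z S"
    and "x \<in> S \<Longrightarrow> (z has_derivative (\<lambda>h. - P (P (z x) (frechet_derivative f (at x) h)) (z x))) (at x)"
proof -
  interpret P: bounded_bilinear P by (rule P)
  let ?f' = "\<lambda>x. frechet_derivative f (at x)"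
  obtain K where K: "K > 0" "\<And>a b. norm (P a b) \<le> norm a * norm b * K"
    using P.pos_bounded by blast
  have diff: "z y - z x = - P (P (z y) (f y - f x)) (z x)" if "x \<in> S" "y \<in> S" for x y
    using that by (simp add: P.diff_left P.diff_right zf assoc fz one)
  have cont: "continuous (at x) z" if x: "x \<in> S" for x
  proof -
    define c where "c y = norm (f y - f x) * norm (z x) * K\<^sup>2" for y
    have isc: "isCont f x"
      using continuous_on_eq_continuous_at[OF S] smooth_on_imp_continuous[OF f] x by blast
    have clim: "(c \<longlongrightarrow> 0) (at x)"
      unfolding c_def using isc
      by (auto intro!: tendsto_mult_left_zero tendsto_norm_zero LIM_zero simp: isCont_def)
    have evS: "\<forall>\<^sub>F y in at x. y \<in> S"
      using S x eventually_at_topological by blast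
    have bd: "norm (z y - z x) \<le> c y * norm (z y)" if "y \<in> S" for y
    proof -
      have "norm (z y - z x) = norm (P (P (z y) (f y - f x)) (z x))"
        using diff[OF x that] by simp
      also have "\<dots> \<le> norm (P (z y) (f y - f x)) * norm (z x) * K" by (rule K)
      also have "\<dots> \<le> (norm (z y) * norm (f y - f x) * K) * norm (z x) * K"
        using K by (intro mult_right_mono) auto
      finally show ?thesis by (simp add: c_def power2_eq_square mult_ac)
    qed
    have ev2: "\<forall>\<^sub>F y in at x. norm (z y - z x) \<le> 2 * norm (z x) * c y"
    proof -
      have "\<forall>\<^sub>F y in at x. c y < 1/2" using clim by (intro order_tendstoD) auto
      with evS show ?thesis
      proof eventually_elim
        case (elim y)
        have cy: "c y \<ge> 0" using K by (simp add: c_def)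
        have "norm (z y) \<le> norm (z x) + norm (z y - z x)"
          by (metis add.commute diff_add_cancel norm_triangle_ineq)
        also have "\<dots> \<le> norm (z x) + 1/2 * norm (z y)"
          using bd[OF elim(1)] elim(2) mult_right_mono[of "c y" "1/2" "norm (z y)"] by simp
        finally have "norm (z y) \<le> 2 * norm (z x)" by simp
        then have "c y * norm (z y) \<le> c y * (2 * norm (z x))"
          using cy by (intro mult_left_mono)
        with bd[OF elim(1)] show ?case by (simp add: mult_ac)
      qed
    qed
    have "((\<lambda>y. 2 * norm (z x) * c y) \<longlongrightarrow> 0) (at x)"
      using clim by (intro tendsto_mult_right_zero)
    then have "((\<lambda>y. z y - z x) \<longlongrightarrow> 0) (at x)"
      by (rule Lim_null_comparison[rotated]) (use ev2 in simp)
    then show ?thesis using LIM_zero_iff continuous_at by (metis)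
  qed
  have der: "(z has_derivative (\<lambda>h. - P (P (z x) (?f' x h)) (z x))) (at x)" if x: "x \<in> S" for x
  proof -
    note fd = smooth_on_has_derivative[OF f x]
    define e where "e y = (1 / norm (y - x)) *\<^sub>R (f y - f x - ?f' x (y - x))" for y
    define q where "q y = (1 / norm (y - x)) *\<^sub>R ?f' x (y - x)" for y
    have elim: "(e \<longlongrightarrow> 0) (at x)"
      using fd unfolding has_derivative_at2 e_def diff_diff_eq by blast
    obtain M where M: "\<And>h. norm (?f' x h) \<le> norm h * M"
      using has_derivative_bounded_linear[OF fd] bounded_linear.bounded by blast
    have qb: "norm (q y) \<le> \<bar>M\<bar>" for y
    proof (cases "y = x")
      case False
      have "norm (?f' x (y - x)) / norm (y - x) \<le> M"
        using M[of "y - x"] False by (simp add: divide_le_eq mult.commute)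
      then show ?thesis by (simp add: q_def)
    qed (simp add: q_def)
    have zl: "(z \<longlongrightarrow> z x) (at x)" using cont[OF x] by (simp add: continuous_at)
    let ?R = "\<lambda>y. - P (P (z y) (e y)) (z x) - P (P (z y - z x) (q y)) (z x)"
    have "(?R \<longlongrightarrow> - P (P (z x) 0) (z x) - 0) (at x)"
    proof (intro tendsto_diff tendsto_minus P.tendsto zl elim tendsto_const)
      have z0: "((\<lambda>y. norm (z y - z x) * (\<bar>M\<bar> * K) * (norm (z x) * K)) \<longlongrightarrow> 0) (at x)"
        using LIM_zero[OF zl] by (intro tendsto_mult_left_zero tendsto_norm_zero)
      show "((\<lambda>y. P (P (z y - z x) (q y)) (z x)) \<longlongrightarrow> 0) (at x)"
      proof (rule Lim_null_comparison[OF _ z0], rule always_eventually, rule allI)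
        fix y
        have "norm (P (P (z y - z x) (q y)) (z x)) \<le> norm (P (z y - z x) (q y)) * norm (z x) * K"
          by (rule K)
        also have "\<dots> \<le> (norm (z y - z x) * norm (q y) * K) * norm (z x) * K"
          using K by (intro mult_right_mono) auto
        also have "\<dots> \<le> (norm (z y - z x) * \<bar>M\<bar> * K) * norm (z x) * K"
          using K qb by (intro mult_right_mono mult_left_mono) auto
        finally show "norm (P (P (z y - z x) (q y)) (z x))
            \<le> norm (z y - z x) * (\<bar>M\<bar> * K) * (norm (z x) * K)"
          by (simp add: mult_ac)
      qed
    qed
    then have lim: "(?R \<longlongrightarrow> 0) (at x)" by (simp add: P.zero_left P.zero_right)
    have "\<forall>\<^sub>F y in at x. ?R y =
      (1 / norm (y - x)) *\<^sub>R (z y - z x - (- P (P (z x) (?f' x (y - x))) (z x)))"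
    proof -
      have "?R y = (1 / norm (y - x)) *\<^sub>R (z y - z x - (- P (P (z x) (?f' x (y - x))) (z x)))"
        if "y \<in> S" for y
      proof -
        let ?c = "1 / norm (y - x)"
        have e: "e y = ?c *\<^sub>R (f y - f x) - q y"
          by (simp add: e_def q_def algebra_simps)
        have "P (P (z y) (?c *\<^sub>R (f y - f x))) (z x) = - (?c *\<^sub>R (z y - z x))"
          unfolding diff[OF x that] by (simp add: P.scaleR_left P.scaleR_right)
        then have "?R y = ?c *\<^sub>R (z y - z x) + P (P (z x) (q y)) (z x)"
          unfolding e by (simp add: P.diff_left P.diff_right)
        then show ?thesis
          by (simp add: q_def P.scaleR_left P.scaleR_right scaleR_add_right)
      qed
      then show ?thesis using S x eventually_at_topological by blast
    qed
    then have "((\<lambda>y. (1 / norm (y - x)) *\<^sub>R (z y - z x - (- P (P (z x) (?f' x (y - x))) (z x))))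
        \<longlongrightarrow> 0) (at x)"
      by (rule Lim_transform_eventually[OF lim])
    moreover have "bounded_linear (\<lambda>h. - P (P (z x) (?f' x h)) (z x))"
      by (intro bounded_linear_minus bounded_linear_compose[OF P.bounded_linear_left]
          bounded_linear_compose[OF P.bounded_linear_right]
          has_derivative_bounded_linear[OF fd])
    ultimately show ?thesis unfolding has_derivative_at2 diff_diff_eq by blast
  qed
  then show "x \<in> S \<Longrightarrow> (z has_derivative (\<lambda>h. - P (P (z x) (?f' x h)) (z x))) (at x)" .
  have "C_k_on k z S" for k
  proof (induction k)
    case 0
    then show ?case using cont by (simp add: continuous_at_imp_continuous_on)
  next
    case (Suc k)
    show ?case
    proof (rule C_k_on_SucI[OF S der])
      fix v
      have "C_k_on k (\<lambda>x. ?f' x v) S"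
        using smooth_on_frechet_derivative[OF f] by (simp add: smooth_on_def)
      then show "C_k_on k (\<lambda>x. - P (P (z x) (?f' x v)) (z x)) S"
        by (intro C_k_on_bounded_linear[OF S bounded_linear_minus[OF bounded_linear_ident]]
            C_k_on_bilinear[OF S P] Suc)
    qed
  qed
  then show "smooth_on z S" by (simp add: smooth_on_def)
qed

text \<open>Two applications of the mean value theorem. The left-hand side is symmetric in \<open>u\<close> and \<open>v\<close>, the
  right-hand side is not visibly so, and this gives Schwarz's theorem as \<open>t\<close> tends to zero.\<close>

lemma second_difference_mean_value:
  fixes f :: "'a::real_normed_vector \<Rightarrow> real"
  assumes S: "open S" and f: "smooth_on f S" and t: "t > 0"
    and sub: "\<And>a b. 0 \<le> a \<Longrightarrow> a \<le> t \<Longrightarrow> 0 \<le> b \<Longrightarrow> b \<le> t \<Longrightarrow> x + a *\<^sub>R u + b *\<^sub>R v \<in> S"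
  shows "\<exists>a b. 0 < a \<and> a < t \<and> 0 < b \<and> b < t \<and>
    f (x + t *\<^sub>R u + t *\<^sub>R v) - f (x + t *\<^sub>R u) - f (x + t *\<^sub>R v) + f x
    = t * t * frechet_derivative (\<lambda>y. frechet_derivative f (at y) u) (at (x + a *\<^sub>R u + b *\<^sub>R v)) v"
proof -
  let ?f' = "\<lambda>x. frechet_derivative f (at x)"
  let ?g = "\<lambda>y. ?f' y u"
  have D: "((\<lambda>s. F (p + s *\<^sub>R w)) has_real_derivative frechet_derivative F (at (p + s *\<^sub>R w)) w) (at s)"
    if "smooth_on F S" "p + s *\<^sub>R w \<in> S" for F :: "'a \<Rightarrow> real" and p w s
  proof -
    have d: "(F has_derivative frechet_derivative F (at (p + s *\<^sub>R w))) (at (p + s *\<^sub>R w))"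
      by (rule smooth_on_has_derivative[OF that])
    have "((\<lambda>s. p + s *\<^sub>R w) has_derivative (\<lambda>h. h *\<^sub>R w)) (at s)"
      by (auto intro!: derivative_eq_intros)
    from has_derivative_compose[OF this d]
    have "((\<lambda>s. F (p + s *\<^sub>R w)) has_derivative (\<lambda>h. frechet_derivative F (at (p + s *\<^sub>R w)) (h *\<^sub>R w))) (at s)" .
    moreover have "frechet_derivative F (at (p + s *\<^sub>R w)) (h *\<^sub>R w) = frechet_derivative F (at (p + s *\<^sub>R w)) w * h" for h
      using linear_scale[OF has_derivative_linear[OF d]] by simp
    ultimately show ?thesis by (simp add: has_field_derivative_def)
  qed
  define h where "h s = f (x + t *\<^sub>R v + s *\<^sub>R u) - f (x + s *\<^sub>R u)" for s
  have 1: "(h has_real_derivative ?f' (x + t *\<^sub>R v + s *\<^sub>R u) u - ?f' (x + s *\<^sub>R u) u) (at s)"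
    if "0 \<le> s" "s \<le> t" for s
    unfolding h_def
    using sub[of s t] sub[of s 0] that t by (intro DERIV_diff D f) (auto simp: algebra_simps)
  obtain a where a: "0 < a" "a < t"
    "h t - h 0 = (t - 0) * (?f' (x + t *\<^sub>R v + a *\<^sub>R u) u - ?f' (x + a *\<^sub>R u) u)"
    using MVT2[OF t, of h "\<lambda>s. ?f' (x + t *\<^sub>R v + s *\<^sub>R u) u - ?f' (x + s *\<^sub>R u) u"] 1 by auto
  have 2: "((\<lambda>s. ?g (x + a *\<^sub>R u + s *\<^sub>R v)) has_real_derivative
      frechet_derivative ?g (at (x + a *\<^sub>R u + s *\<^sub>R v)) v) (at s)" if "0 \<le> s" "s \<le> t" for s
    using sub[of a s] that a by (intro D smooth_on_frechet_derivative f) auto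
  obtain b where b: "0 < b" "b < t"
    "?g (x + a *\<^sub>R u + t *\<^sub>R v) - ?g (x + a *\<^sub>R u + 0 *\<^sub>R v)
      = (t - 0) * frechet_derivative ?g (at (x + a *\<^sub>R u + b *\<^sub>R v)) v"
    using MVT2[OF t 2] by blast
  have "f (x + t *\<^sub>R u + t *\<^sub>R v) - f (x + t *\<^sub>R u) - f (x + t *\<^sub>R v) + f x = h t - h 0"
    by (simp add: h_def algebra_simps)
  also have "\<dots> = t * (?g (x + a *\<^sub>R u + t *\<^sub>R v) - ?g (x + a *\<^sub>R u + 0 *\<^sub>R v))"
    using a(3) by (simp add: algebra_simps)
  also have "\<dots> = t * t * frechet_derivative ?g (at (x + a *\<^sub>R u + b *\<^sub>R v)) v"
    using b(3) by simp
  finally show ?thesis using a(1,2) b(1,2) by blast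
qed

lemma frechet_derivative_inner:
  assumes "(f has_derivative f') (at x)"
  shows "frechet_derivative (\<lambda>y. f y \<bullet> b) (at x) v = f' v \<bullet> b"
  by (metis assms frechet_derivative_at has_derivative_inner_left)

lemma second_derivative_symmetric:
  fixes f :: "'a::real_normed_vector \<Rightarrow> 'b::euclidean_space"
  assumes S: "open S" and f: "smooth_on f S" and x: "x \<in> S"
  shows "frechet_derivative (\<lambda>y. frechet_derivative f (at y) u) (at x) v
       = frechet_derivative (\<lambda>y. frechet_derivative f (at y) v) (at x) u"
proof -
  let ?D = "\<lambda>F u v y. frechet_derivative (\<lambda>y. frechet_derivative F (at y) u) (at y) v"
  have real: "?D F u v x = ?D F v u x" if F: "smooth_on F S" for F :: "'a \<Rightarrow> real"
  proof (rule ccontr)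
    assume ne: "?D F u v x \<noteq> ?D F v u x"
    define \<epsilon> where "\<epsilon> = \<bar>?D F u v x - ?D F v u x\<bar> / 2"
    have \<epsilon>: "\<epsilon> > 0" using ne by (simp add: \<epsilon>_def)
    have "continuous_on S (?D F w z)" for w z
      by (intro smooth_on_imp_continuous smooth_on_frechet_derivative F)
    then have "isCont (?D F w z) x" for w z
      using S x continuous_on_eq_continuous_at by blast
    then have "\<exists>d>0. \<forall>y. dist y x < d \<longrightarrow> dist (?D F w z y) (?D F w z x) < \<epsilon>" for w z
      using \<epsilon> unfolding continuous_at_eps_delta by blast
    then obtain d1 d2 d3 where d: "d1 > 0" "\<And>y. dist y x < d1 \<Longrightarrow> dist (?D F u v y) (?D F u v x) < \<epsilon>"
      "d2 > 0" "\<And>y. dist y x < d2 \<Longrightarrow> dist (?D F v u y) (?D F v u x) < \<epsilon>"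
      "d3 > 0" "\<And>y. dist y x < d3 \<Longrightarrow> y \<in> S"
      using S x unfolding open_dist by metis
    define m where "m = min d1 (min d2 d3)"
    define t where "t = m / (2 * (norm u + norm v + 1))"
    have m: "m > 0" using d by (simp add: m_def)
    have nuv: "norm u + norm v + 1 > 0" by (smt (verit) norm_ge_zero)
    then have t: "t > 0" using m by (simp add: t_def)
    have close: "dist (x + a *\<^sub>R u + b *\<^sub>R v) x < m" if "0 \<le> a" "a \<le> t" "0 \<le> b" "b \<le> t" for a b
    proof -
      have "dist (x + a *\<^sub>R u + b *\<^sub>R v) x = norm (a *\<^sub>R u + b *\<^sub>R v)"
        by (simp add: dist_norm algebra_simps)
      also have "\<dots> \<le> a * norm u + b * norm v"
        using norm_triangle_ineq[of "a *\<^sub>R u" "b *\<^sub>R v"] that by simp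
      also have "\<dots> \<le> t * norm u + t * norm v"
        using that by (intro add_mono mult_right_mono) auto
      also have "\<dots> \<le> t * (norm u + norm v + 1)" using t by (simp add: algebra_simps)
      also have "\<dots> = m / 2" using nuv unfolding t_def by (simp del: distrib_left_numeral)
      finally show ?thesis using m by simp
    qed
    obtain a b where ab: "0 < a" "a < t" "0 < b" "b < t"
      "F (x + t *\<^sub>R u + t *\<^sub>R v) - F (x + t *\<^sub>R u) - F (x + t *\<^sub>R v) + F x
        = t * t * ?D F u v (x + a *\<^sub>R u + b *\<^sub>R v)"
      using second_difference_mean_value[OF S F t, of x u v] close d by (metis m_def min_less_iff_conj)
    have close': "dist (x + a *\<^sub>R v + b *\<^sub>R u) x < m" if "0 \<le> a" "a \<le> t" "0 \<le> b" "b \<le> t" for a b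
      using close[of b a] that by (simp add: algebra_simps)
    obtain a' b' where ab': "0 < a'" "a' < t" "0 < b'" "b' < t"
      "F (x + t *\<^sub>R v + t *\<^sub>R u) - F (x + t *\<^sub>R v) - F (x + t *\<^sub>R u) + F x
        = t * t * ?D F v u (x + a' *\<^sub>R v + b' *\<^sub>R u)"
      using second_difference_mean_value[OF S F t, of x v u] close' d by (metis m_def min_less_iff_conj)
    have "t * t * ?D F u v (x + a *\<^sub>R u + b *\<^sub>R v) = t * t * ?D F v u (x + a' *\<^sub>R v + b' *\<^sub>R u)"
      using ab(5) ab'(5) by (simp add: algebra_simps)
    then have eq: "?D F u v (x + a *\<^sub>R u + b *\<^sub>R v) = ?D F v u (x + a' *\<^sub>R v + b' *\<^sub>R u)"
      using t by simp
    have 1: "\<bar>?D F u v (x + a *\<^sub>R u + b *\<^sub>R v) - ?D F u v x\<bar> < \<epsilon>"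
      using ab close[of a b] by (intro d(2)[unfolded dist_real_def]) (auto simp: m_def)
    have 2: "\<bar>?D F v u (x + a' *\<^sub>R v + b' *\<^sub>R u) - ?D F v u x\<bar> < \<epsilon>"
      using ab' close'[of a' b'] by (intro d(4)[unfolded dist_real_def]) (auto simp: m_def)
    have "\<bar>p - p0\<bar> < \<epsilon> \<Longrightarrow> \<bar>p - q0\<bar> < \<epsilon> \<Longrightarrow> \<epsilon> = \<bar>p0 - q0\<bar> / 2 \<Longrightarrow> False" for p p0 q0
      using abs_triangle_ineq4[of "p - p0" "p - q0"] by (simp add: abs_minus_commute[of q0])
    from this[OF 1[unfolded eq] 2 \<epsilon>_def] show False .
  qed
  have comp: "?D f u v x \<bullet> b = ?D (\<lambda>y. f y \<bullet> b) u v x" for b u v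
  proof -
    have "((\<lambda>y. frechet_derivative f (at y) u) has_derivative
            frechet_derivative (\<lambda>y. frechet_derivative f (at y) u) (at x)) (at x)"
      by (rule smooth_on_has_derivative[OF smooth_on_frechet_derivative[OF f] x])
    then have "?D f u v x \<bullet> b = frechet_derivative (\<lambda>y. frechet_derivative f (at y) u \<bullet> b) (at x) v"
      by (rule frechet_derivative_inner[symmetric])
    also have "frechet_derivative (\<lambda>y. frechet_derivative f (at y) u \<bullet> b) (at x)
        = frechet_derivative (\<lambda>y. frechet_derivative (\<lambda>y. f y \<bullet> b) (at y) u) (at x)"
    proof -
      have eq: "frechet_derivative f (at y) u \<bullet> b = frechet_derivative (\<lambda>y. f y \<bullet> b) (at y) u"
        if "y \<in> S" for y
        by (rule frechet_derivative_inner[OF smooth_on_has_derivative[OF f that], symmetric])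
      have sm: "smooth_on (\<lambda>y. frechet_derivative f (at y) u \<bullet> b) S"
        by (intro smooth_on_bounded_linear[OF bounded_linear_inner_left] S smooth_on_frechet_derivative f)
      have "((\<lambda>y. frechet_derivative (\<lambda>y. f y \<bullet> b) (at y) u) has_derivative
          frechet_derivative (\<lambda>y. frechet_derivative f (at y) u \<bullet> b) (at x)) (at x)"
        by (rule has_derivative_transform_within_open[OF smooth_on_has_derivative[OF sm x] S x eq])
      then show ?thesis by (rule frechet_derivative_at)
    qed
    finally show ?thesis .
  qed
  have "?D f u v x \<bullet> b = ?D f v u x \<bullet> b" for b
    unfolding comp by (rule real[OF smooth_on_bounded_linear[OF bounded_linear_inner_left S f]])
  from euclidean_eqI[OF this] show ?thesis .
qed

section \<open>Linear total differential systems with vanishing curvature\<close>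

text \<open>Picard iteration for \<open>dF = \<omega> F\<close> along the rays from the origin. It uses only the radial part of
  the system. The start \<open>0\<close> makes the first iterate constant, so that its differential is exactly what
  the system prescribes from the start.\<close>

primrec picard ::
  "('a::euclidean_space \<Rightarrow> 'a \<Rightarrow>\<^sub>L 'b \<Rightarrow>\<^sub>L 'b) \<Rightarrow> 'b::euclidean_space \<Rightarrow> nat \<Rightarrow> 'a \<Rightarrow> 'b" where
  "picard \<omega> v 0 = (\<lambda>x. 0)"
| "picard \<omega> v (Suc k) = (\<lambda>x. v + integral {0..1} (\<lambda>t. \<omega> (t *\<^sub>R x) x (picard \<omega> v k (t *\<^sub>R x))))"

text \<open>The coefficient \<open>\<omega> x h\<close> is the endomorphism in the direction \<open>h\<close>, and \<open>flat\<close> is the symmetry of the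
  second derivative that a solution would have. The ball is so small that a Picard step at
  least halves distances.\<close>

locale flat_connection_ball =
  fixes \<omega> :: "'a::euclidean_space \<Rightarrow> 'a \<Rightarrow>\<^sub>L 'b::euclidean_space \<Rightarrow>\<^sub>L 'b"
    and \<omega>' :: "'a \<Rightarrow> 'a \<Rightarrow>\<^sub>L 'a \<Rightarrow>\<^sub>L 'b \<Rightarrow>\<^sub>L 'b"
    and r M :: real
  assumes r: "r > 0" and M: "M > 0" "M * r \<le> 1 / 4"
    and \<omega>_der: "\<And>x. x \<in> ball 0 r \<Longrightarrow> (\<omega> has_derivative \<omega>' x) (at x)"
    and \<omega>'_cont: "continuous_on (ball 0 r) \<omega>'"
    and \<omega>_bound: "\<And>x. x \<in> ball 0 r \<Longrightarrow> norm (\<omega> x) \<le> M"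
    and flat: "\<And>x h k v. x \<in> ball 0 r \<Longrightarrow>
      \<omega>' x h k v + \<omega> x k (\<omega> x h v) = \<omega>' x k h v + \<omega> x h (\<omega> x k v)"
begin

lemma \<omega>_cont: "continuous_on (ball 0 r) \<omega>"
  using \<omega>_der has_derivative_continuous continuous_at_imp_continuous_on by blast

lemma ray_in_ball: "x \<in> ball 0 r \<Longrightarrow> 0 \<le> t \<Longrightarrow> t \<le> 1 \<Longrightarrow> t *\<^sub>R x \<in> ball (0::'a) r"
proof -
  assume a: "x \<in> ball 0 r" "0 \<le> t" "t \<le> 1"
  have "\<bar>t\<bar> * norm x \<le> 1 * norm x" using a by (intro mult_right_mono) auto
  then show ?thesis using a by simp
qed

lemma \<omega>_apply_bound: "x \<in> ball 0 r \<Longrightarrow> norm (\<omega> x h v) \<le> M * norm h * norm v"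
proof -
  assume x: "x \<in> ball 0 r"
  have "norm (\<omega> x h v) \<le> norm (\<omega> x h) * norm v" by (rule norm_blinfun)
  also have "\<dots> \<le> (norm (\<omega> x) * norm h) * norm v" by (intro mult_right_mono norm_blinfun) simp
  also have "\<dots> \<le> (M * norm h) * norm v" by (intro mult_right_mono \<omega>_bound x) auto
  finally show ?thesis .
qed

lemma ray_cont:
  fixes f :: "'a \<Rightarrow> 'c::topological_space"
  assumes "continuous_on (ball 0 r) f"
  shows "continuous_on (ball 0 r \<times> cbox 0 1) (\<lambda>p. f (snd p *\<^sub>R fst p))"
proof (rule continuous_on_compose2[OF assms])
  show "(\<lambda>p. snd p *\<^sub>R fst p) ` (ball 0 r \<times> cbox 0 1) \<subseteq> ball (0::'a) r"
    using ray_in_ball by (auto simp del: mem_ball)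
qed (intro continuous_intros)

lemma ray_cont1:
  fixes f :: "'a \<Rightarrow> 'c::topological_space"
  assumes "continuous_on (ball 0 r) f" "x \<in> ball 0 r"
  shows "continuous_on (cbox 0 1) (\<lambda>t. f (t *\<^sub>R x))"
proof (rule continuous_on_compose2[OF assms(1)])
  show "(\<lambda>t. t *\<^sub>R x) ` cbox 0 1 \<subseteq> ball 0 r"
    using ray_in_ball[OF assms(2)] by (auto simp del: mem_ball)
qed (intro continuous_intros)

text \<open>A Picard step keeps maps continuously differentiable; its derivative comes from differentiating
  under the integral sign.\<close>

context
  fixes G :: "'a \<Rightarrow> 'b" and DG :: "'a \<Rightarrow> 'a \<Rightarrow>\<^sub>L 'b"
  assumes G: "\<And>x. x \<in> ball 0 r \<Longrightarrow> (G has_derivative DG x) (at x)"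
    and DG: "continuous_on (ball 0 r) DG"
begin

definition step_integrand :: "'a \<Rightarrow> real \<Rightarrow> 'a \<Rightarrow> 'b" where
  "step_integrand x t h = (let y = t *\<^sub>R x in
     t *\<^sub>R (\<omega>' y h x (G y)) + \<omega> y h (G y) + t *\<^sub>R (\<omega> y x (DG y h)))"

definition step_derivative :: "'a \<Rightarrow> 'a \<Rightarrow>\<^sub>L 'b" where
  "step_derivative x = integral (cbox 0 1) (\<lambda>t. Blinfun (step_integrand x t))"

lemma G_cont: "continuous_on (ball 0 r) G"
  using G has_derivative_continuous continuous_at_imp_continuous_on by blast

lemma bl_step: "bounded_linear (step_integrand x t)"
  unfolding step_integrand_def Let_def
  by (intro linear_conv_bounded_linear[THEN iffD1] linearI)
    (simp_all add: blinfun.bilinear_simps algebra_simps)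

lemma step_integrand_cont:
  "continuous_on (ball 0 r \<times> cbox 0 1) (\<lambda>(x, t). Blinfun (step_integrand x t))"
proof (rule continuous_on_blinfun_componentwise)
  fix h :: 'a
  have "continuous_on (ball 0 r \<times> cbox 0 1) (\<lambda>p. step_integrand (fst p) (snd p) h)"
    unfolding step_integrand_def Let_def
    by (intro continuous_intros blinfun.continuous_on ray_cont \<omega>_cont \<omega>'_cont G_cont DG)
  then show "continuous_on (ball 0 r \<times> cbox 0 1)
      (\<lambda>p. blinfun_apply (case p of (x, t) \<Rightarrow> Blinfun (step_integrand x t)) h)"
    by (simp add: case_prod_beta bounded_linear_Blinfun_apply[OF bl_step])
qed

lemma step_integrand_cont1:
  assumes "x \<in> ball 0 r"
  shows "continuous_on (cbox 0 1) (\<lambda>t. Blinfun (step_integrand x t))"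
proof -
  have "continuous_on (cbox 0 1) (\<lambda>t::real. (x, t))" by (intro continuous_intros)
  moreover have "(\<lambda>t::real. (x, t)) ` cbox 0 1 \<subseteq> ball 0 r \<times> cbox 0 1" using assms by auto
  ultimately show ?thesis using continuous_on_compose2[OF step_integrand_cont] by fastforce
qed

lemma step_derivative_apply:
  assumes "x \<in> ball 0 r"
  shows "step_derivative x h = integral {0..1} (\<lambda>t. step_integrand x t h)"
  unfolding step_derivative_def
  by (subst blinfun_apply_integral)
    (use integrable_continuous[OF step_integrand_cont1[OF assms]]
     in \<open>simp_all add: bounded_linear_Blinfun_apply[OF bl_step]\<close>)

lemma step_derivative_cont: "continuous_on (ball 0 r) step_derivative"
  unfolding step_derivative_def by (rule integral_continuous_on_param[OF step_integrand_cont])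

lemma step_has_derivative:
  assumes x: "x \<in> ball 0 r"
  shows "((\<lambda>x. v + integral {0..1} (\<lambda>t. \<omega> (t *\<^sub>R x) x (G (t *\<^sub>R x)))) has_derivative
    step_derivative x) (at x)"
proof -
  have "((\<lambda>x. integral (cbox 0 1) (\<lambda>t. \<omega> (t *\<^sub>R x) x (G (t *\<^sub>R x)))) has_derivative
      integral (cbox 0 1) (\<lambda>t. Blinfun (step_integrand x t))) (at x within ball 0 r)"
  proof (rule leibniz_rule[OF _ _ step_integrand_cont x])
    fix x :: 'a and t :: real
    assume x: "x \<in> ball 0 r" and t: "t \<in> cbox 0 1"
    then have y: "t *\<^sub>R x \<in> ball 0 r" using ray_in_ball by auto
    have sc: "((\<lambda>x. t *\<^sub>R x) has_derivative (\<lambda>h. t *\<^sub>R h)) (at x within ball 0 r)"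
      by (auto intro!: derivative_eq_intros)
    have 1: "((\<lambda>x. \<omega> (t *\<^sub>R x)) has_derivative (\<lambda>h. \<omega>' (t *\<^sub>R x) (t *\<^sub>R h))) (at x within ball 0 r)"
      by (rule has_derivative_compose[OF sc \<omega>_der[OF y]])
    have 2: "((\<lambda>x. G (t *\<^sub>R x)) has_derivative (\<lambda>h. DG (t *\<^sub>R x) (t *\<^sub>R h))) (at x within ball 0 r)"
      by (rule has_derivative_compose[OF sc G[OF y]])
    have 3: "((\<lambda>x. \<omega> (t *\<^sub>R x) x) has_derivative
        (\<lambda>h. \<omega> (t *\<^sub>R x) h + \<omega>' (t *\<^sub>R x) (t *\<^sub>R h) x)) (at x within ball 0 r)"
      by (rule blinfun.FDERIV[OF 1 has_derivative_ident])
    have "((\<lambda>x. \<omega> (t *\<^sub>R x) x (G (t *\<^sub>R x))) has_derivative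
        (\<lambda>h. \<omega> (t *\<^sub>R x) x (DG (t *\<^sub>R x) (t *\<^sub>R h))
          + (\<omega> (t *\<^sub>R x) h + \<omega>' (t *\<^sub>R x) (t *\<^sub>R h) x) (G (t *\<^sub>R x)))) (at x within ball 0 r)"
      by (rule blinfun.FDERIV[OF 3 2])
    also have "(\<lambda>h. \<omega> (t *\<^sub>R x) x (DG (t *\<^sub>R x) (t *\<^sub>R h))
          + (\<omega> (t *\<^sub>R x) h + \<omega>' (t *\<^sub>R x) (t *\<^sub>R h) x) (G (t *\<^sub>R x))) = Blinfun (step_integrand x t)"
      unfolding bounded_linear_Blinfun_apply[OF bl_step] step_integrand_def Let_def
      by (simp add: blinfun.bilinear_simps algebra_simps)
    finally show "((\<lambda>x. \<omega> (t *\<^sub>R x) x (G (t *\<^sub>R x))) has_derivative Blinfun (step_integrand x t))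
        (at x within ball 0 r)" .
  next
    fix x :: 'a assume x: "x \<in> ball 0 r"
    have "continuous_on (cbox 0 1) (\<lambda>t. \<omega> (t *\<^sub>R x) x (G (t *\<^sub>R x)))"
      by (intro blinfun.continuous_on continuous_on_const ray_cont1[OF \<omega>_cont x] ray_cont1[OF G_cont x])
    then show "(\<lambda>t. \<omega> (t *\<^sub>R x) x (G (t *\<^sub>R x))) integrable_on cbox 0 1"
      by (rule integrable_continuous)
  qed auto
  then show ?thesis
    unfolding step_derivative_def using x
    by (auto intro!: derivative_eq_intros simp: at_within_open[OF x open_ball])
qed

text \<open>How far one step is from solving the system, in terms of the same defect of \<open>G\<close> relative to
  the preceding iterate \<open>H\<close>. Both terms below are integrals along the same ray, the second by the
  fundamental theorem of calculus, and flatness makes the terms without a defect cancel.\<close>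

lemma step_defect:
  assumes x: "x \<in> ball 0 r"
    and GH: "\<And>y. y \<in> ball 0 r \<Longrightarrow> norm (G y - H y) \<le> \<delta>"
    and D: "\<And>y h. y \<in> ball 0 r \<Longrightarrow> norm (DG y h - \<omega> y h (H y)) \<le> \<epsilon> * norm h"
  shows "norm (step_derivative x h - \<omega> x h (G x)) \<le> (M * \<delta> + \<epsilon>) / 2 * norm h"
proof -
  define J where "J t = (let y = t *\<^sub>R x in
    \<omega> y h (G y) + t *\<^sub>R (\<omega>' y x h (G y)) + t *\<^sub>R (\<omega> y h (DG y x)))" for t
  have "(J has_integral (1 *\<^sub>R \<omega> (1 *\<^sub>R x) h (G (1 *\<^sub>R x)) - 0 *\<^sub>R \<omega> (0 *\<^sub>R x) h (G (0 *\<^sub>R x)))) {0..1}"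
  proof (rule fundamental_theorem_of_calculus)
    fix t :: real assume t: "t \<in> {0..1}"
    then have y: "t *\<^sub>R x \<in> ball 0 r" using ray_in_ball[OF x] by auto
    have sc: "((\<lambda>t. t *\<^sub>R x) has_derivative (\<lambda>s. s *\<^sub>R x)) (at t within {0..1})"
      by (auto intro!: derivative_eq_intros)
    have 1: "((\<lambda>t. \<omega> (t *\<^sub>R x)) has_derivative (\<lambda>s. \<omega>' (t *\<^sub>R x) (s *\<^sub>R x))) (at t within {0..1})"
      by (rule has_derivative_compose[OF sc \<omega>_der[OF y]])
    have 2: "((\<lambda>t. G (t *\<^sub>R x)) has_derivative (\<lambda>s. DG (t *\<^sub>R x) (s *\<^sub>R x))) (at t within {0..1})"
      by (rule has_derivative_compose[OF sc G[OF y]])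
    have 3: "((\<lambda>t. \<omega> (t *\<^sub>R x) h) has_derivative
        (\<lambda>s. \<omega> (t *\<^sub>R x) 0 + \<omega>' (t *\<^sub>R x) (s *\<^sub>R x) h)) (at t within {0..1})"
      by (rule blinfun.FDERIV[OF 1 has_derivative_const])
    have 4: "((\<lambda>t. t *\<^sub>R \<omega> (t *\<^sub>R x) h (G (t *\<^sub>R x))) has_derivative
      (\<lambda>s. t *\<^sub>R (\<omega> (t *\<^sub>R x) h (DG (t *\<^sub>R x) (s *\<^sub>R x))
         + (\<omega> (t *\<^sub>R x) 0 + \<omega>' (t *\<^sub>R x) (s *\<^sub>R x) h) (G (t *\<^sub>R x)))
         + s *\<^sub>R \<omega> (t *\<^sub>R x) h (G (t *\<^sub>R x)))) (at t within {0..1})"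
      by (rule has_derivative_scaleR[OF has_derivative_ident blinfun.FDERIV[OF 3 2]])
    have 5: "t *\<^sub>R (\<omega> (t *\<^sub>R x) h (DG (t *\<^sub>R x) (s *\<^sub>R x))
         + (\<omega> (t *\<^sub>R x) 0 + \<omega>' (t *\<^sub>R x) (s *\<^sub>R x) h) (G (t *\<^sub>R x)))
         + s *\<^sub>R \<omega> (t *\<^sub>R x) h (G (t *\<^sub>R x)) = s *\<^sub>R J t" for s
      by (simp add: J_def Let_def blinfun.bilinear_simps algebra_simps)
    show "((\<lambda>t. t *\<^sub>R \<omega> (t *\<^sub>R x) h (G (t *\<^sub>R x))) has_vector_derivative J t) (at t within {0..1})"
      unfolding has_vector_derivative_def using 4 unfolding 5 .
  qed simp
  then have J: "(J has_integral \<omega> x h (G x)) {0..1}" by simp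
  have Ic: "continuous_on {0..1} (\<lambda>t. step_integrand x t h)"
    using blinfun.continuous_on[OF step_integrand_cont1[OF x] continuous_on_const[of _ h]]
    by (simp add: bounded_linear_Blinfun_apply[OF bl_step])
  have Jc: "continuous_on {0..1} J"
    using continuous_on_id[of "cbox (0::real) 1"] unfolding J_def Let_def cbox_interval[symmetric]
    by (intro continuous_on_add continuous_on_scaleR blinfun.continuous_on continuous_on_const
        ray_cont1[OF \<omega>_cont x] ray_cont1[OF \<omega>'_cont x] ray_cont1[OF G_cont x] ray_cont1[OF DG x])
  have "step_derivative x h - \<omega> x h (G x) = integral {0..1} (\<lambda>t. step_integrand x t h - J t)"
    unfolding step_derivative_apply[OF x] integral_unique[OF J, symmetric]
    by (subst integral_diff) (auto intro!: integrable_continuous_real Ic Jc)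
  also have "norm \<dots> \<le> ((M * \<delta> + \<epsilon>) / 2 * norm h) * (1 - 0)"
  proof (rule integral_bound)
    fix t :: real assume t: "t \<in> {0..1}"
    define y where "y = t *\<^sub>R x"
    have y: "y \<in> ball 0 r" using ray_in_ball[OF x] t by (auto simp: y_def)
    let ?e = "\<lambda>h. DG y h - \<omega> y h (H y)" and ?g = "G y - H y"
    have "step_integrand x t h - J t = t *\<^sub>R ((\<omega>' y h x (G y) - \<omega>' y x h (G y))
        + \<omega> y x (DG y h) - \<omega> y h (DG y x))"
      by (simp add: step_integrand_def J_def Let_def y_def algebra_simps)
    also have "\<omega>' y h x (G y) - \<omega>' y x h (G y) = \<omega> y h (\<omega> y x (G y)) - \<omega> y x (\<omega> y h (G y))"
      using flat[OF y, of h x "G y"] by (simp add: algebra_simps)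
    also have "\<omega> y h (\<omega> y x (G y)) - \<omega> y x (\<omega> y h (G y)) + \<omega> y x (DG y h) - \<omega> y h (DG y x)
      = \<omega> y h (\<omega> y x ?g) - \<omega> y x (\<omega> y h ?g) + \<omega> y x (?e h) - \<omega> y h (?e x)"
      by (simp add: blinfun.bilinear_simps algebra_simps)
    finally have eq: "step_integrand x t h - J t
      = t *\<^sub>R (\<omega> y h (\<omega> y x ?g) - \<omega> y x (\<omega> y h ?g) + \<omega> y x (?e h) - \<omega> y h (?e x))" .
    have "norm ?g \<ge> 0" by simp
    then have \<delta>: "\<delta> \<ge> 0" using GH[OF y] by linarith
    have b2: "norm (\<omega> y a (\<omega> y b ?g)) \<le> M * norm a * (M * norm b * \<delta>)" for a b
    proof -
      have "norm (\<omega> y a (\<omega> y b ?g)) \<le> M * norm a * norm (\<omega> y b ?g)" by (rule \<omega>_apply_bound[OF y])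
      also have "\<dots> \<le> M * norm a * (M * norm b * norm ?g)"
        using M by (intro mult_left_mono \<omega>_apply_bound[OF y]) auto
      also have "\<dots> \<le> M * norm a * (M * norm b * \<delta>)"
        using M by (intro mult_left_mono GH[OF y]) auto
      finally show ?thesis .
    qed
    have b1: "norm (\<omega> y a (?e b)) \<le> M * norm a * (\<epsilon> * norm b)" for a b
      by (rule order_trans[OF \<omega>_apply_bound[OF y]]) (use M in \<open>intro mult_left_mono D[OF y], auto\<close>)
    have "norm (\<omega> y h (\<omega> y x ?g) - \<omega> y x (\<omega> y h ?g) + \<omega> y x (?e h) - \<omega> y h (?e x))
      \<le> norm (\<omega> y h (\<omega> y x ?g)) + norm (\<omega> y x (\<omega> y h ?g)) + norm (\<omega> y x (?e h)) + norm (\<omega> y h (?e x))"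
      by norm
    also have "\<dots> \<le> M * norm h * (M * norm x * \<delta>) + M * norm x * (M * norm h * \<delta>)
        + M * norm x * (\<epsilon> * norm h) + M * norm h * (\<epsilon> * norm x)"
      by (intro add_mono b1 b2)
    also have "\<dots> = (2 * (M * norm x)) * (M * \<delta> + \<epsilon>) * norm h"
      by (simp add: algebra_simps)
    also have "\<dots> \<le> (1 / 2) * (M * \<delta> + \<epsilon>) * norm h"
    proof (cases "h = 0")
      case False
      have "0 \<le> \<epsilon> * norm h" using D[OF y, of h] norm_ge_zero order_trans by blast
      then have "\<epsilon> \<ge> 0" using False by (simp add: zero_le_mult_iff)
      have "M * norm x \<le> M * r" using M x by (intro mult_left_mono) auto
      then have "2 * (M * norm x) \<le> 1 / 2" using M(2) by linarith
      then show ?thesis using \<open>\<epsilon> \<ge> 0\<close> \<delta> M by (intro mult_right_mono) auto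
    qed simp
    finally have "norm (\<omega> y h (\<omega> y x ?g) - \<omega> y x (\<omega> y h ?g) + \<omega> y x (?e h) - \<omega> y h (?e x))
      \<le> (M * \<delta> + \<epsilon>) / 2 * norm h" by simp
    moreover have "\<bar>t\<bar> * norm (\<omega> y h (\<omega> y x ?g) - \<omega> y x (\<omega> y h ?g) + \<omega> y x (?e h) - \<omega> y h (?e x))
      \<le> 1 * norm (\<omega> y h (\<omega> y x ?g) - \<omega> y x (\<omega> y h ?g) + \<omega> y x (?e h) - \<omega> y h (?e x))"
      using t by (intro mult_right_mono) auto
    ultimately show "norm (step_integrand x t h - J t) \<le> (M * \<delta> + \<epsilon>) / 2 * norm h"
      unfolding eq norm_scaleR by linarith
  qed (auto intro!: continuous_on_diff Ic Jc)
  finally show ?thesis by simp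
qed

end

lemma picard_has_derivative:
  "\<exists>DF. continuous_on (ball 0 r) DF \<and> (\<forall>x\<in>ball 0 r. (picard \<omega> v k has_derivative blinfun_apply (DF x)) (at x))"
proof (induction k)
  case 0
  show ?case by (rule exI[of _ "\<lambda>x. 0"]) (simp add: zero_blinfun.rep_eq)
next
  case (Suc k)
  then obtain DF where DF: "continuous_on (ball 0 r) DF"
    "\<And>x. x \<in> ball 0 r \<Longrightarrow> (picard \<omega> v k has_derivative blinfun_apply (DF x)) (at x)" by blast
  show ?case
    using step_has_derivative[OF DF(2,1)] step_derivative_cont[OF DF(2,1)] by auto
qed

lemma picard_cont: "continuous_on (ball 0 r) (picard \<omega> v k)"
  using picard_has_derivative[of v k] has_derivative_continuous continuous_at_imp_continuous_on by blast

lemma picard_difference: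
  "x \<in> ball 0 r \<Longrightarrow> norm (picard \<omega> v (Suc k) x - picard \<omega> v k x) \<le> norm v * (1 / 2) ^ k"
proof (induction k arbitrary: x)
  case 0
  then show ?case by (simp add: blinfun.zero_right)
next
  case (Suc k)
  let ?I = "\<lambda>k t. \<omega> (t *\<^sub>R x) x (picard \<omega> v k (t *\<^sub>R x))"
  have c: "continuous_on {0..1} (?I k)" for k
    using blinfun.continuous_on[OF blinfun.continuous_on[OF ray_cont1[OF \<omega>_cont Suc.prems]
          continuous_on_const[of _ x]] ray_cont1[OF picard_cont Suc.prems], of v k]
    by simp
  have "picard \<omega> v (Suc (Suc k)) x - picard \<omega> v (Suc k) x
      = integral {0..1} (?I (Suc k)) - integral {0..1} (?I k)"
    by simp
  also have "\<dots> = integral {0..1} (\<lambda>t. ?I (Suc k) t - ?I k t)"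
    by (rule integral_diff[symmetric]; rule integrable_continuous_real; rule c)
  also have "norm \<dots> \<le> (norm v * (1 / 2) ^ Suc k) * (1 - 0)"
  proof (rule integral_bound)
    fix t :: real assume t: "t \<in> {0..1}"
    then have y: "t *\<^sub>R x \<in> ball 0 r" using ray_in_ball[OF Suc.prems] by auto
    have "norm (?I (Suc k) t - ?I k t)
        = norm (\<omega> (t *\<^sub>R x) x (picard \<omega> v (Suc k) (t *\<^sub>R x) - picard \<omega> v k (t *\<^sub>R x)))"
      by (simp only: blinfun.diff_right)
    also have "\<dots> \<le> (M * norm x) * norm (picard \<omega> v (Suc k) (t *\<^sub>R x) - picard \<omega> v k (t *\<^sub>R x))"
      by (rule \<omega>_apply_bound[OF y])
    also have "\<dots> \<le> (M * norm x) * (norm v * (1 / 2) ^ k)"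
      using M by (intro mult_left_mono Suc.IH y) auto
    also have "\<dots> \<le> (1 / 2) * (norm v * (1 / 2) ^ k)"
    proof (rule mult_right_mono)
      have "M * norm x \<le> M * r" using M Suc.prems by (intro mult_left_mono) auto
      then show "M * norm x \<le> 1 / 2" using M(2) by linarith
    qed simp
    finally show "norm (?I (Suc k) t - ?I k t) \<le> norm v * (1 / 2) ^ Suc k" by simp
  qed (auto intro!: continuous_on_diff c simp del: picard.simps)
  finally show ?case by simp
qed

text \<open>Each step halves the defect and adds a term from the difference of two iterates, which is itself of
  order \<open>(1 / 2) ^ k\<close>; this accounts for the factor \<open>k\<close>.\<close>

lemma picard_defect:
  "\<exists>DF. \<forall>x\<in>ball 0 r. (picard \<omega> v (Suc k) has_derivative blinfun_apply (DF x)) (at x) \<and>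
    (\<forall>h. norm (DF x h - \<omega> x h (picard \<omega> v k x)) \<le> M * norm v * (real k * (1 / 2) ^ k) * norm h)"
proof (induction k)
  case 0
  show ?case
    by (rule exI[of _ "\<lambda>x. 0"]) (simp add: zero_blinfun.rep_eq blinfun.zero_right)
next
  case (Suc k)
  then obtain D where D: "\<And>x. x \<in> ball 0 r \<Longrightarrow> (picard \<omega> v (Suc k) has_derivative blinfun_apply (D x)) (at x)"
    "\<And>x h. x \<in> ball 0 r \<Longrightarrow> norm (D x h - \<omega> x h (picard \<omega> v k x)) \<le> M * norm v * (real k * (1 / 2) ^ k) * norm h"
    by blast
  have Dc: "continuous_on (ball 0 r) D"
  proof -
    obtain DF where DF: "continuous_on (ball 0 r) DF"
      "\<And>x. x \<in> ball 0 r \<Longrightarrow> (picard \<omega> v (Suc k) has_derivative blinfun_apply (DF x)) (at x)"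
      using picard_has_derivative by blast
    have "D x = DF x" if "x \<in> ball 0 r" for x
      using has_derivative_unique[OF D(1) DF(2)] that by (simp add: blinfun_apply_inject)
    then show ?thesis using DF(1) continuous_on_cong by metis
  qed
  have "norm (step_derivative (picard \<omega> v (Suc k)) D x h - \<omega> x h (picard \<omega> v (Suc k) x))
    \<le> M * norm v * (real (Suc k) * (1 / 2) ^ Suc k) * norm h" if x: "x \<in> ball 0 r" for x h
  proof -
    have "norm (step_derivative (picard \<omega> v (Suc k)) D x h - \<omega> x h (picard \<omega> v (Suc k) x))
      \<le> (M * (norm v * (1 / 2) ^ k) + M * norm v * (real k * (1 / 2) ^ k)) / 2 * norm h"
      by (rule step_defect[OF D(1) Dc x picard_difference D(2)])
    also have "\<dots> = M * norm v * (real (Suc k) * (1 / 2) ^ Suc k) * norm h"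
      by (simp add: algebra_simps add_divide_distrib)
    finally show ?thesis .
  qed
  moreover have "(picard \<omega> v (Suc (Suc k)) has_derivative step_derivative (picard \<omega> v (Suc k)) D x) (at x)"
    if "x \<in> ball 0 r" for x
    using step_has_derivative[OF D(1) Dc that, of v] by simp
  ultimately show ?case by blast
qed

text \<open>The defects tend to zero uniformly, so the limit of the iterates solves the system.\<close>

lemma solution_exists:
  "\<exists>F. F 0 = v \<and> (\<forall>x\<in>ball 0 r. (F has_derivative (\<lambda>h. \<omega> x h (F x))) (at x))"
proof -
  let ?p = "picard \<omega> v"
  define F where "F x = (\<Sum>i. ?p (Suc i) x - ?p i x)" for x
  have tel: "(\<Sum>i<n. ?p (Suc i) x - ?p i x) = ?p n x" for n x
    by (induction n) auto
  have "summable (\<lambda>k. norm v * (1 / 2) ^ k :: real)"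
    by (intro summable_mult summable_geometric) simp
  then have ul: "uniform_limit (ball 0 r) ?p F sequentially"
    using Weierstrass_m_test[of "ball 0 r" "\<lambda>i x. ?p (Suc i) x - ?p i x" "\<lambda>k. norm v * (1 / 2) ^ k"]
      picard_difference
    unfolding F_def tel by (simp add: tel del: picard.simps)
  have lim: "(\<lambda>n. ?p n x) \<longlonglongrightarrow> F x" if "x \<in> ball 0 r" for x
    by (rule tendsto_uniform_limitI[OF ul that])
  have F0: "F 0 = v"
  proof -
    have "?p (Suc n) 0 = v" for n by (simp add: blinfun.zero_left blinfun.zero_right)
    then have "(\<lambda>n. ?p (Suc n) 0) \<longlonglongrightarrow> v" by (simp only: tendsto_const)
    moreover have "(\<lambda>n. ?p (Suc n) 0) \<longlonglongrightarrow> F 0" by (rule LIMSEQ_Suc[OF lim]) (use r in simp)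
    ultimately show ?thesis by (rule LIMSEQ_unique[THEN sym])
  qed
  have "\<forall>n. \<exists>DF. \<forall>x\<in>ball 0 r. (?p (Suc n) has_derivative blinfun_apply (DF x)) (at x) \<and>
    (\<forall>h. norm (DF x h - \<omega> x h (?p n x)) \<le> M * norm v * (real n * (1 / 2) ^ n) * norm h)"
    using picard_defect by blast
  then obtain DF where DF: "\<And>n x. x \<in> ball 0 r \<Longrightarrow> (?p (Suc n) has_derivative blinfun_apply (DF n x)) (at x)"
    "\<And>n x h. x \<in> ball 0 r \<Longrightarrow> norm (DF n x h - \<omega> x h (?p n x)) \<le> M * norm v * (real n * (1 / 2) ^ n) * norm h"
    by metis
  have "\<exists>g. \<forall>x\<in>ball 0 r. (\<lambda>n. ?p (Suc n) x) \<longlonglongrightarrow> g x \<and>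
      (g has_derivative (\<lambda>h. \<omega> x h (F x))) (at x within ball 0 r)"
  proof (rule has_derivative_sequence)
    show "(?p (Suc n) has_derivative DF n x) (at x within ball 0 r)" if "x \<in> ball 0 r" for n x
      by (rule has_derivative_at_withinI[OF DF(1)[OF that]])
    show "0 \<in> ball (0::'a) r" using r by simp
    then show "(\<lambda>n. ?p (Suc n) 0) \<longlonglongrightarrow> F 0" by (rule LIMSEQ_Suc[OF lim])
    fix e :: real assume e: "e > 0"
    have "(\<lambda>n. M * norm v * (real n * (1 / 2) ^ n)) \<longlonglongrightarrow> M * norm v * 0"
      by (intro tendsto_mult_left powser_times_n_limit_0) simp
    then have ev1: "\<forall>\<^sub>F n in sequentially. M * norm v * (real n * (1 / 2) ^ n) < e / 2"
      using e by (intro order_tendstoD(2)) auto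
    have ev2: "\<forall>\<^sub>F n in sequentially. \<forall>x\<in>ball 0 r. dist (?p n x) (F x) < e / (2 * M)"
      using ul e M unfolding uniform_limit_iff by simp
    from ev1 ev2 show "\<forall>\<^sub>F n in sequentially. \<forall>x\<in>ball 0 r. \<forall>h.
        norm (DF n x h - \<omega> x h (F x)) \<le> e * norm h"
    proof eventually_elim
      case (elim n)
      show ?case
      proof (intro ballI allI)
        fix x h :: 'a assume x: "x \<in> ball 0 r"
        have "norm (DF n x h - \<omega> x h (F x))
            \<le> norm (DF n x h - \<omega> x h (?p n x)) + norm (\<omega> x h (?p n x - F x))"
          unfolding blinfun.diff_right by norm
        also have "\<dots> \<le> e / 2 * norm h + M * norm h * (e / (2 * M))"
        proof (rule add_mono)
          show "norm (DF n x h - \<omega> x h (?p n x)) \<le> e / 2 * norm h"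
            by (rule order_trans[OF DF(2)[OF x]]) (use elim(1) in \<open>intro mult_right_mono, auto\<close>)
          show "norm (\<omega> x h (?p n x - F x)) \<le> M * norm h * (e / (2 * M))"
            by (rule order_trans[OF \<omega>_apply_bound[OF x]])
              (use elim(2) x M in \<open>intro mult_left_mono, auto simp: dist_norm less_imp_le\<close>)
        qed
        also have "\<dots> = e * norm h" using M by (simp add: field_simps)
        finally show "norm (DF n x h - \<omega> x h (F x)) \<le> e * norm h" .
      qed
    qed
  qed simp
  then obtain g where g: "\<And>x. x \<in> ball 0 r \<Longrightarrow> (\<lambda>n. ?p (Suc n) x) \<longlonglongrightarrow> g x"
    "\<And>x. x \<in> ball 0 r \<Longrightarrow> (g has_derivative (\<lambda>h. \<omega> x h (F x))) (at x within ball 0 r)"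
    by blast
  have "g x = F x" if "x \<in> ball 0 r" for x
    using LIMSEQ_unique[OF g(1)[OF that] LIMSEQ_Suc[OF lim[OF that]]] .
  then have "(F has_derivative (\<lambda>h. \<omega> x h (F x))) (at x)" if "x \<in> ball 0 r" for x
    using has_derivative_transform[OF that _ g(2)[OF that], of F] that
    by (simp add: at_within_open[OF that open_ball])
  with F0 show ?thesis by blast
qed

end

lemma bounded_bilinear_matrix_vector_mult:
  "bounded_bilinear ((*v) :: real^'n^'m \<Rightarrow> real^'n \<Rightarrow> real^'m)"
  unfolding bilinear_conv_bounded_bilinear[symmetric] bilinear_def
  by (auto intro!: linearI simp: matrix_vector_right_distrib matrix_vector_mult_add_rdistrib
      scaleR_matrix_vector_assoc[symmetric] matrix_vector_mult_scaleR)

lemma bounded_bilinear_matrix_matrix_mult: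
  "bounded_bilinear ((**) :: real^'n^'m \<Rightarrow> real^'k^'n \<Rightarrow> real^'k^'m)"
  unfolding bilinear_conv_bounded_bilinear[symmetric] bilinear_def
  by (auto intro!: linearI simp: vec_eq_iff matrix_matrix_mult_def sum.distrib algebra_simps
      sum_distrib_left)

text \<open>The radius depends only on the coefficients, so all initial values share one ball. Once a
  solution is differentiable, the equation expresses its derivatives through itself and so makes
  it smooth.\<close>

theorem flat_linear_system_solvable:
  fixes A :: "'n::finite \<Rightarrow> real^'n \<Rightarrow> real^'k^'k::finite"
  assumes S: "open S" "x0 \<in> S" and A: "\<And>l. smooth_on (A l) S"
    and flat: "\<And>x l m. x \<in> S \<Longrightarrow>
      frechet_derivative (A l) (at x) (axis m 1) + A l x ** A m x
      = frechet_derivative (A m) (at x) (axis l 1) + A m x ** A l x"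
  shows "\<exists>r>0. ball x0 r \<subseteq> S \<and> (\<forall>v. \<exists>F. F x0 = v \<and> smooth_on F (ball x0 r) \<and>
    (\<forall>x\<in>ball x0 r. (F has_derivative (\<lambda>h. \<Sum>l\<in>UNIV. h $ l *\<^sub>R (A l x *v F x))) (at x)))"
proof -
  \<comment> \<open>The matrices are packed into one vector so that continuity and differentiability of \<open>\<omega>\<close> as a
    map into operators follow from linearity of \<open>\<Phi>\<close> on a finite-dimensional space.\<close>
  define \<Phi> :: "(real^'k^'k)^'n \<Rightarrow> (real^'n) \<Rightarrow>\<^sub>L (real^'k) \<Rightarrow>\<^sub>L (real^'k)"
    where "\<Phi> a = Blinfun (\<lambda>h. Blinfun (\<lambda>v. \<Sum>l\<in>UNIV. h $ l *\<^sub>R (a $ l *v v)))" for a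
  have bl1: "bounded_linear (\<lambda>v. \<Sum>l\<in>UNIV. h $ l *\<^sub>R (a $ l *v v))" for h and a :: "(real^'k^'k)^'n"
    by (intro linear_conv_bounded_linear[THEN iffD1] linearI)
      (simp_all add: matrix_vector_right_distrib matrix_vector_mult_scaleR sum.distrib
        scaleR_sum_right algebra_simps)
  have bl2: "bounded_linear (\<lambda>h. Blinfun (\<lambda>v. \<Sum>l\<in>UNIV. h $ l *\<^sub>R (a $ l *v v)))" for a :: "(real^'k^'k)^'n"
    by (intro linear_conv_bounded_linear[THEN iffD1] linearI blinfun_eqI;
        unfold blinfun.add_left blinfun.scaleR_left bounded_linear_Blinfun_apply[OF bl1])
      (simp_all add: sum.distrib scaleR_sum_right algebra_simps)
  have \<Phi>: "\<Phi> a h v = (\<Sum>l\<in>UNIV. h $ l *\<^sub>R (a $ l *v v))" for a h v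
    by (simp add: \<Phi>_def bounded_linear_Blinfun_apply[OF bl1] bounded_linear_Blinfun_apply[OF bl2])
  have bl\<Phi>: "bounded_linear \<Phi>"
    by (intro linear_conv_bounded_linear[THEN iffD1] linearI blinfun_eqI)
      (simp_all add: \<Phi> blinfun.bilinear_simps sum.distrib scaleR_sum_right algebra_simps
        matrix_vector_mult_add_rdistrib scaleR_matrix_vector_assoc[symmetric])
  define a where "a x = (\<chi> l. A l (x0 + x))" for x
  define \<omega> where "\<omega> x = \<Phi> (a x)" for x
  define S' where "S' = (\<lambda>x. x0 + x) -` S"
  have S': "open S'" "0 \<in> S'"
    using S unfolding S'_def by (auto intro!: open_vimage continuous_intros)
  have a_sm: "smooth_on a S'"
    unfolding a_def S'_def
    by (intro smooth_on_vec_lambda smooth_on_compose[OF A] smooth_on_add smooth_on_const smooth_on_ident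
        S'[unfolded S'_def] S) auto
  define a' where "a' x = frechet_derivative a (at x)" for x
  have a': "(a has_derivative a' x) (at x)" if "x \<in> S'" for x
    unfolding a'_def by (rule smooth_on_has_derivative[OF a_sm that])
  define \<omega>' where "\<omega>' x = Blinfun (\<lambda>h. \<Phi> (a' x h))" for x
  have \<omega>'_apply: "\<omega>' x h = \<Phi> (a' x h)" if "x \<in> S'" for x h
    unfolding \<omega>'_def
    by (rule bounded_linear_Blinfun_apply[THEN fun_cong])
      (rule bounded_linear_compose[OF bl\<Phi> has_derivative_bounded_linear[OF a'[OF that]]])
  have \<omega>_der: "(\<omega> has_derivative \<omega>' x) (at x)" if "x \<in> S'" for x
  proof -
    have "blinfun_apply (\<omega>' x) = (\<lambda>h. \<Phi> (a' x h))" using \<omega>'_apply[OF that] by auto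
    then show ?thesis unfolding \<omega>_def using bounded_linear.has_derivative[OF bl\<Phi> a'[OF that]] by simp
  qed
  have \<omega>'_cont: "continuous_on S' \<omega>'"
  proof (rule continuous_on_blinfun_componentwise)
    fix h :: "real^'n"
    have "continuous_on S' (\<lambda>x. \<Phi> (a' x h))"
      unfolding a'_def
      by (intro bounded_linear.continuous_on[OF bl\<Phi>] smooth_on_imp_continuous
          smooth_on_frechet_derivative a_sm)
    then show "continuous_on S' (\<lambda>x. \<omega>' x h)" 
      by (rule continuous_on_eq) (simp add: \<omega>'_apply)
  qed
  have a'_nth: "a' x h $ l = frechet_derivative (A l) (at (x0 + x)) h" if "x \<in> S'" for x h l
  proof -
    have "((\<lambda>x. a x $ l) has_derivative (\<lambda>h. a' x h $ l)) (at x)"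
      by (rule bounded_linear.has_derivative[OF bounded_linear_vec_nth a'[OF that]])
    moreover have "((\<lambda>x. A l (x0 + x)) has_derivative frechet_derivative (A l) (at (x0 + x))) (at x)"
    proof (rule has_derivative_compose[of "\<lambda>x. x0 + x" "\<lambda>h. h", simplified])
      show "((+) x0 has_derivative (\<lambda>h. h)) (at x)" by (auto intro!: derivative_eq_intros)
      show "(A l has_derivative frechet_derivative (A l) (at (x0 + x))) (at (x0 + x))"
        by (rule smooth_on_has_derivative[OF A]) (use that S'_def in auto)
    qed
    ultimately show ?thesis
      unfolding a_def vec_lambda_beta by (rule has_derivative_unique[THEN fun_cong])
  qed
  have flat': "\<omega>' x h k v + \<omega> x k (\<omega> x h v) = \<omega>' x k h v + \<omega> x h (\<omega> x k v)" if x: "x \<in> S'" for x h k v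
  proof -
    let ?y = "x0 + x"
    let ?d = "\<lambda>l m. frechet_derivative (A l) (at ?y) (axis m 1)"
    have y: "?y \<in> S" using x S'_def by auto
    have lin: "frechet_derivative (A l) (at ?y) h = (\<Sum>m\<in>UNIV. h $ m *\<^sub>R ?d l m)" for l h
    proof -
      have l: "linear (frechet_derivative (A l) (at ?y))"
        using smooth_on_has_derivative[OF A y] has_derivative_linear by blast
      have "h = (\<Sum>m\<in>UNIV. h $ m *\<^sub>R axis m 1)"
        using basis_expansion[of h] by (simp add: scalar_mult_eq_scaleR)
      from arg_cong[OF this, of "frechet_derivative (A l) (at ?y)"]
      show ?thesis by (simp only: linear_sum[OF l] linear_scale[OF l])
    qed
    have 1: "\<omega>' x h k v + \<omega> x k (\<omega> x h v)
        = (\<Sum>l\<in>UNIV. \<Sum>m\<in>UNIV. (k $ l * h $ m) *\<^sub>R ((?d l m + A l ?y ** A m ?y) *v v))" for h k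
      unfolding \<omega>'_apply[OF x] \<omega>_def \<Phi> a'_nth[OF x] lin[of _ h]
      by (simp add: a_def linear_sum[OF matrix_vector_mul_linear]
          bounded_bilinear.sum_left[OF bounded_bilinear_matrix_vector_mult]
          scaleR_sum_right sum.distrib[symmetric] matrix_vector_mult_add_rdistrib
          scaleR_matrix_vector_assoc[symmetric] matrix_vector_mult_scaleR matrix_vector_mul_assoc
          scaleR_add_right)
    have "(\<Sum>l\<in>UNIV. \<Sum>m\<in>UNIV. (k $ l * h $ m) *\<^sub>R ((?d l m + A l ?y ** A m ?y) *v v))
        = (\<Sum>l\<in>UNIV. \<Sum>m\<in>UNIV. (k $ l * h $ m) *\<^sub>R ((?d m l + A m ?y ** A l ?y) *v v))"
      by (simp add: flat[OF y])
    also have "\<dots> = (\<Sum>l\<in>UNIV. \<Sum>m\<in>UNIV. (h $ l * k $ m) *\<^sub>R ((?d l m + A l ?y ** A m ?y) *v v))"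
      by (subst sum.swap) (simp add: mult.commute)
    finally show ?thesis unfolding 1 .
  qed
  obtain R where R: "R > 0" "cball 0 R \<subseteq> S'"
    using S' open_contains_cball_eq by blast
  have "continuous_on S' \<omega>"
    using \<omega>_der has_derivative_continuous continuous_at_imp_continuous_on by blast
  then have "compact (\<omega> ` cball 0 R)"
    using R continuous_on_subset compact_continuous_image compact_cball by blast
  then obtain M0 where M0: "\<And>x. x \<in> cball 0 R \<Longrightarrow> norm (\<omega> x) \<le> M0"
    using compact_imp_bounded bounded_iff by (metis imageI)
  define M where "M = \<bar>M0\<bar> + 1"
  define r where "r = min R (1 / (4 * M))"
  have M: "M > 0" by (simp add: M_def)
  have r: "r > 0" using R M by (simp add: r_def)
  have rS: "ball 0 r \<subseteq> S'" using R by (auto simp: r_def)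
  interpret flat_connection_ball \<omega> \<omega>' r M
  proof
    have "M * r \<le> M * (1 / (4 * M))" using M by (intro mult_left_mono) (auto simp: r_def)
    then show "M * r \<le> 1 / 4" using M by simp
    show "norm (\<omega> x) \<le> M" if "x \<in> ball 0 r" for x
      using M0[of x] that by (auto simp: M_def r_def)
  qed (use r M rS \<omega>_der flat' \<omega>'_cont continuous_on_subset in auto)
  have sub: "ball x0 r \<subseteq> S"
  proof
    fix x assume "x \<in> ball x0 r"
    then have "x - x0 \<in> ball 0 r" by (simp add: dist_norm norm_minus_commute)
    then show "x \<in> S" using rS S'_def by auto
  qed
  have "\<exists>F. F x0 = v \<and> smooth_on F (ball x0 r) \<and>
    (\<forall>x\<in>ball x0 r. (F has_derivative (\<lambda>h. \<Sum>l\<in>UNIV. h $ l *\<^sub>R (A l x *v F x))) (at x))" for v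
  proof -
    obtain F0 where F0: "F0 0 = v" "\<And>x. x \<in> ball 0 r \<Longrightarrow> (F0 has_derivative (\<lambda>h. \<omega> x h (F0 x))) (at x)"
      using solution_exists by blast
    define F where "F x = F0 (x - x0)" for x
    have der: "(F has_derivative (\<lambda>h. \<Sum>l\<in>UNIV. h $ l *\<^sub>R (A l x *v F x))) (at x)"
      if x: "x \<in> ball x0 r" for x
    proof -
      have "x - x0 \<in> ball 0 r" using x by (simp add: dist_norm norm_minus_commute)
      moreover have "((\<lambda>x. x - x0) has_derivative (\<lambda>h. h)) (at x)"
        by (auto intro!: derivative_eq_intros)
      ultimately have "(F has_derivative (\<lambda>h. \<omega> (x - x0) h (F0 (x - x0)))) (at x)"
        unfolding F_def using has_derivative_compose F0(2) by blast
      then show ?thesis unfolding \<omega>_def \<Phi> by (simp add: a_def F_def)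
    qed
    have "C_k_on k F (ball x0 r)" for k
    proof (induction k)
      case 0
      show ?case
        unfolding C_k_on.simps
        by (intro continuous_at_imp_continuous_on ballI) (rule has_derivative_continuous[OF der])
    next
      case (Suc k)
      show ?case
      proof (rule C_k_on_SucI[OF open_ball der])
        have "C_k_on k (A l) (ball x0 r)" for l
          using smooth_on_subset[OF A sub] by (simp add: smooth_on_def)
        then show "C_k_on k (\<lambda>x. \<Sum>l\<in>UNIV. h $ l *\<^sub>R (A l x *v F x)) (ball x0 r)" for h
          by (intro C_k_on_sum C_k_on_bounded_linear[OF open_ball bounded_linear_scaleR_right]
              C_k_on_bilinear[OF open_ball bounded_bilinear_matrix_vector_mult] Suc open_ball)
      qed
    qed
    then have "smooth_on F (ball x0 r)" by (simp add: smooth_on_def)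
    moreover have "F x0 = v" by (simp add: F_def F0)
    ultimately show ?thesis using der by blast
  qed
  with r sub show ?thesis by blast
qed

section \<open>The commutative algebra of a cubic form\<close>

text \<open>A nondegenerate symmetric form of arbitrary signature with a pair of dual bases. Traces are
  written as \<open>\<Sum>a. B (e a) (d a)\<close>, which needs no orthonormal basis.\<close>

locale framed_space =
  fixes ip :: "'a::euclidean_space \<Rightarrow> 'a \<Rightarrow> real" and e d :: "'i::finite \<Rightarrow> 'a"
  assumes ip: "bounded_bilinear ip" and ip_comm: "ip u v = ip v u"
    and frame: "(\<Sum>a\<in>UNIV. ip u (d a) *\<^sub>R e a) = u"
    and dual_frame: "(\<Sum>a\<in>UNIV. ip u (e a) *\<^sub>R d a) = u"
    and dual: "ip (e a) (d b) = (if a = b then 1 else 0)"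
begin

sublocale ip: bounded_bilinear ip by (rule ip)

lemmas ip_simps = ip.add_left ip.add_right ip.diff_left ip.diff_right ip.scaleR_left ip.scaleR_right
  ip.minus_left ip.minus_right ip.zero_left ip.zero_right

lemma nondegenerate: "(\<And>x. ip u x = ip v x) \<Longrightarrow> u = v"
  by (subst (1 2) frame[symmetric]) simp

lemma parseval: "(\<Sum>a\<in>UNIV. ip x (e a) * ip y (d a)) = ip x y"
proof -
  have "ip x (\<Sum>a\<in>UNIV. ip y (d a) *\<^sub>R e a) = (\<Sum>a\<in>UNIV. ip x (e a) * ip y (d a))"
    by (simp add: ip.sum_right ip.scaleR_right mult.commute)
  then show ?thesis by (simp add: frame)
qed

lemma parseval': "(\<Sum>a\<in>UNIV. ip (e a) x * ip y (d a)) = ip x y"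
  using parseval by (simp add: ip_comm)

definition n :: real where "n = (\<Sum>a\<in>UNIV. ip (e a) (d a))"

lemma n_eq: "n = real CARD('i)"
  by (simp add: n_def dual)

text \<open>Cyclicity of the trace: \<open>T\<close> passes from the first slot of a bilinear map to the second.\<close>

lemma trace_adjoint:
  assumes B: "bounded_bilinear B" and T: "\<And>x y. ip (T x) y = ip x (T' y)"
  shows "(\<Sum>a\<in>UNIV. B (T (e a)) (d a)) = (\<Sum>a\<in>UNIV. B (e a) (T' (d a)))"
proof -
  interpret B: bounded_bilinear B by (rule B)
  have "(\<Sum>a\<in>UNIV. B (T (e a)) (d a))
      = (\<Sum>a\<in>UNIV. B (\<Sum>c\<in>UNIV. ip (T (e a)) (d c) *\<^sub>R e c) (d a))"
    by (simp add: frame)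
  also have "\<dots> = (\<Sum>a\<in>UNIV. \<Sum>c\<in>UNIV. ip (T' (d c)) (e a) *\<^sub>R B (e c) (d a))"
    by (simp add: B.sum_left B.scaleR_left T ip_comm[of "e _"])
  also have "\<dots> = (\<Sum>c\<in>UNIV. B (e c) (\<Sum>a\<in>UNIV. ip (T' (d c)) (e a) *\<^sub>R d a))"
    by (subst sum.swap) (simp add: B.sum_right B.scaleR_right)
  finally show ?thesis by (simp add: dual_frame)
qed

lemma trace_flip:
  assumes B: "bounded_bilinear B"
  shows "(\<Sum>a\<in>UNIV. B (e a) (d a)) = (\<Sum>a\<in>UNIV. B (d a) (e a))"
proof -
  interpret B: bounded_bilinear B by (rule B)
  have d: "d a = (\<Sum>c\<in>UNIV. ip (d a) (d c) *\<^sub>R e c)" for a by (simp add: frame)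
  have "(\<Sum>a\<in>UNIV. B (e a) (d a)) = (\<Sum>a\<in>UNIV. \<Sum>c\<in>UNIV. ip (d a) (d c) *\<^sub>R B (e a) (e c))"
    by (subst d) (simp add: B.sum_right B.scaleR_right)
  also have "\<dots> = (\<Sum>c\<in>UNIV. \<Sum>a\<in>UNIV. ip (d c) (d a) *\<^sub>R B (e a) (e c))"
    by (subst sum.swap) (simp add: ip_comm)
  also have "\<dots> = (\<Sum>a\<in>UNIV. B (d a) (e a))"
    by (subst (2) d) (simp add: B.sum_left B.scaleR_left)
  finally show ?thesis .
qed

end

text \<open>A trace-free totally symmetric cubic form \<open>ip (S u v) w\<close> whose operators \<open>S u\<close> have commutators
  of a curvature tensor without Weyl part, with \<open>N\<close> in the role of the Schouten tensor.\<close>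

locale weyl_free_cubic = framed_space ip e d
  for ip :: "'a::euclidean_space \<Rightarrow> 'a \<Rightarrow> real" and e d :: "'i::finite \<Rightarrow> 'a" +
  fixes S :: "'a \<Rightarrow> 'a \<Rightarrow> 'a" and N :: "'a \<Rightarrow> 'a"
  assumes card: "CARD('i) \<ge> 3"
    and S: "bounded_bilinear S" and S_comm: "S u v = S v u"
    and S_adj: "ip (S u v) w = ip v (S u w)"
    and S_trace: "(\<Sum>a\<in>UNIV. S (e a) (d a)) = 0"
    and N: "bounded_linear N" and N_adj: "ip (N u) v = ip u (N v)"
    and S_commutator: "S u (S v w) - S v (S u w)
      = ip u w *\<^sub>R N v - ip v w *\<^sub>R N u + ip (N u) w *\<^sub>R v - ip (N v) w *\<^sub>R u"
begin

sublocale S: bounded_bilinear S by (rule S)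
sublocale N: bounded_linear N by (rule N)

lemmas S_simps = S.add_left S.add_right S.diff_left S.diff_right S.scaleR_left S.scaleR_right
  S.minus_left S.minus_right S.zero_left S.zero_right
lemmas N_simps = N.add N.diff N.scaleR N.neg N.zero

lemma S_adj': "ip (S u v) w = ip u (S v w)"
  by (metis S_adj S_comm)

lemma trace_S: "(\<Sum>a\<in>UNIV. ip (e a) (S u (d a))) = 0"
proof -
  have "(\<Sum>a\<in>UNIV. ip (e a) (S u (d a))) = ip u (\<Sum>a\<in>UNIV. S (e a) (d a))"
    unfolding ip.sum_right by (rule sum.cong[OF refl]) (metis S_adj S_adj')
  then show ?thesis by (simp add: S_trace ip.zero_right)
qed

definition \<tau> :: "'a \<Rightarrow> 'a \<Rightarrow> real" where
  "\<tau> u v = (\<Sum>a\<in>UNIV. ip (S u (e a)) (S v (d a)))"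

definition trace_N :: real where
  "trace_N = (\<Sum>a\<in>UNIV. ip (N (e a)) (d a))"

text \<open>The trace form \<open>\<tau>\<close> is the Ricci tensor of the commutator relation.\<close>

lemma \<tau>_eq: "\<tau> v u = (n - 2) * ip (N u) v + trace_N * ip u v"
proof -
  have "(\<Sum>a\<in>UNIV. ip (S u (S (e a) v) - S (e a) (S u v)) (d a))
      = \<tau> v u - ip (S u v) (\<Sum>a\<in>UNIV. S (e a) (d a))"
    unfolding \<tau>_def ip.sum_right sum_subtractf[symmetric]
    by (rule sum.cong[OF refl]) (simp only: ip.diff_left S_adj[of u] S_adj[of "e _"] S_comm[of "e _" v])
  moreover have "(\<Sum>a\<in>UNIV. ip (S u (S (e a) v) - S (e a) (S u v)) (d a))
      = ip u v * trace_N - ip v (N u) + ip (N u) v * n - ip (N v) u"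
  proof -
    have "ip (S u (S (e a) v) - S (e a) (S u v)) (d a)
        = ip u v * ip (N (e a)) (d a) - ip (e a) v * ip (N u) (d a)
          + ip (N u) v * ip (e a) (d a) - ip (e a) (N v) * ip u (d a)" for a
      unfolding S_commutator by (simp add: ip.diff_left ip.add_left ip.scaleR_left N_adj[of "e a" v])
    then show ?thesis
      by (simp only: sum.distrib sum_subtractf sum_distrib_left[symmetric] parseval' n_def[symmetric]
          trace_N_def[symmetric])
  qed
  moreover have "ip v (N u) = ip (N u) v" "ip (N v) u = ip (N u) v"
    by (simp_all only: N_adj ip_comm[of v] ip_comm[of "N _"])
  ultimately show ?thesis
    by (simp add: S_trace ip.zero_right algebra_simps)
qed

text \<open>The trace part of the Codazzi equation below.\<close>

definition b :: "'a \<Rightarrow> real" where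
  "b u = (\<Sum>a\<in>UNIV. ip (N (e a)) (S u (d a))) / (n - 1)"

lemma n_minus_1: "n - 1 > 0" using card by (simp add: n_eq)

text \<open>Transposing a product of self-adjoint operators reverses it, so \<open>tr(S u S w S x)\<close> is symmetric in
  \<open>u\<close> and \<open>w\<close>.\<close>

lemma trace_SSS: "(\<Sum>a\<in>UNIV. ip (S w (S x (e a))) (S u (d a)))
    = (\<Sum>a\<in>UNIV. ip (S u (S x (e a))) (S w (d a)))"
proof -
  have bb: "bounded_bilinear (\<lambda>p q. ip p (S w (S u q)))"
    by (intro bounded_bilinear.comp[OF ip bounded_linear_ident] bounded_linear_compose[OF S.bounded_linear_right]
        S.bounded_linear_right)
  have "(\<Sum>a\<in>UNIV. ip (S w (S x (e a))) (S u (d a))) = (\<Sum>a\<in>UNIV. ip (S x (e a)) (S w (S u (d a))))"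
    by (simp only: S_adj[of w])
  also have "\<dots> = (\<Sum>a\<in>UNIV. ip (e a) (S w (S u (S x (d a)))))"
    by (rule trace_adjoint[OF bb S_adj])
  also have "\<dots> = (\<Sum>a\<in>UNIV. ip (d a) (S w (S u (S x (e a)))))"
    by (rule trace_flip)
      (intro bounded_bilinear.comp[OF ip bounded_linear_ident] bounded_linear_compose[OF S.bounded_linear_right]
        S.bounded_linear_right)
  also have "\<dots> = (\<Sum>a\<in>UNIV. ip (S u (S x (e a))) (S w (d a)))"
    by (rule sum.cong[OF refl]) (metis S_adj ip_comm)
  finally show ?thesis .
qed

text \<open>A Codazzi equation for \<open>N\<close>, from two computations of \<open>\<tau>(S w x, u)\<close> antisymmetrised in \<open>u\<close> and \<open>w\<close>.
  By the commutator relation it is \<open>tr(S u S w S x)\<close>, which drops out, plus terms in \<open>N\<close>; by the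
  contracted relation it is \<open>(n - 2) ip (N u) (S w x)\<close> up to terms that drop out. The two combine to
  a nonzero multiple \<open>n - 1\<close> of the tensor in question, so dimension three needs no separate argument.\<close>

lemma codazzi: "S w (N u) - S u (N w) = b w *\<^sub>R u - b u *\<^sub>R w"
proof (rule nondegenerate)
  fix x
  have \<beta>: "(\<Sum>a\<in>UNIV. ip (N (e a)) (S u (d a))) = (n - 1) * b u" for u
    using n_minus_1 by (simp add: b_def)
  have 1: "\<tau> (S w x) u = (\<Sum>a\<in>UNIV. ip (S w (S x (e a))) (S u (d a)))
      + ip (S u (N w)) x - ip w x * ((n - 1) * b u) + ip (N x) (S u w)" for u w
  proof -
    have "S (S w x) (e a) = S w (S x (e a)) + ip (e a) x *\<^sub>R N w - ip w x *\<^sub>R N (e a)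
        + ip (N (e a)) x *\<^sub>R w - ip (N w) x *\<^sub>R e a" for a
      using S_commutator[of "e a" w x] by (simp add: S_comm[of _ "e a"] algebra_simps)
    then have "\<tau> (S w x) u = (\<Sum>a\<in>UNIV. ip (S w (S x (e a))) (S u (d a))
        + ip (e a) x * ip (S u (N w)) (d a) - ip w x * ip (N (e a)) (S u (d a))
        + ip (e a) (N x) * ip (S u w) (d a) - ip (N w) x * ip (e a) (S u (d a)))"
      unfolding \<tau>_def by (simp add: ip_simps S_adj[of u] N_adj[of "e _" x])
    also have "\<dots> = (\<Sum>a\<in>UNIV. ip (S w (S x (e a))) (S u (d a)))
      + ip x (S u (N w)) - ip w x * ((n - 1) * b u) + ip (N x) (S u w) - ip (N w) x * 0"
      unfolding sum.distrib sum_subtractf sum_distrib_left[symmetric] parseval' \<beta> trace_S ..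
    finally show ?thesis by (simp add: ip_comm)
  qed
  have 2: "\<tau> (S w x) u = (n - 2) * ip (S w (N u)) x + trace_N * ip u (S w x)" for u w
    unfolding \<tau>_eq by (simp add: S_adj)
  have "(n - 1) * ip (S w (N u) - S u (N w)) x = (n - 1) * ip (b w *\<^sub>R u - b u *\<^sub>R w) x"
    using 1[of w u] 1[of u w] 2[of w u] 2[of u w] trace_SSS[of w x u]
    by (simp add: ip_simps algebra_simps S_comm[of w u] S_adj'[symmetric] S_comm)
  then show "ip (S w (N u) - S u (N w)) x = ip (b w *\<^sub>R u - b u *\<^sub>R w) x"
    using n_minus_1 by simp
qed

lemma b_linear: "b (u + v) = b u + b v" "b (r *\<^sub>R u) = r * b u"
  by (simp_all add: b_def S_simps ip_simps sum.distrib add_divide_distrib sum_distrib_left)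

definition B :: 'a where
  "B = (\<Sum>a\<in>UNIV. b (e a) *\<^sub>R d a)"

lemma ip_B: "ip B u = b u"
proof -
  have lb: "linear b" by (rule linearI) (simp_all add: b_linear)
  have "ip B u = (\<Sum>a\<in>UNIV. b (ip u (d a) *\<^sub>R e a))"
    by (simp add: B_def ip.sum_left ip.scaleR_left b_linear(2) ip_comm[of "d _"] mult.commute)
  also have "\<dots> = b u" by (simp add: linear_sum[OF lb, symmetric] frame)
  finally show ?thesis .
qed

lemma ip_B': "ip u B = b u" using ip_B ip_comm by metis

lemma S_N: "S w (N u) = N (S u w) + ip u w *\<^sub>R B - b u *\<^sub>R w"
proof (rule nondegenerate)
  fix x
  have "ip (N (S u w)) x = ip w (S u (N x))" by (simp add: N_adj S_adj)
  also have "S u (N x) = S x (N u) + b u *\<^sub>R x - b x *\<^sub>R u"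
    using codazzi[of u x] by (simp add: algebra_simps)
  also have "ip w \<dots> = ip w (S x (N u)) + b u * ip w x - b x * ip u w"
    by (simp add: ip.add_right ip.diff_right ip.scaleR_right ip_comm[of w u])
  also have "ip w (S x (N u)) = ip (S w (N u)) x" by (metis S_adj S_comm ip_comm)
  finally show "ip (S w (N u)) x = ip (N (S u w) + ip u w *\<^sub>R B - b u *\<^sub>R w) x"
    by (simp add: ip.add_left ip.diff_left ip.scaleR_left ip_B)
qed

definition \<beta> :: real where
  "\<beta> = (\<Sum>a\<in>UNIV. ip (N (N (e a)) - S B (e a)) (d a)) / n"

text \<open>Put \<open>M = N\<^sup>2 - S B\<close>. Applying \<open>N\<close> to the commutator relation and moving it through with the Codazzi
  equation leaves a relation between \<open>M u\<close>, \<open>M v\<close>, \<open>u\<close> and \<open>v\<close> alone; its trace over \<open>v\<close> says that \<open>M\<close> is a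
  multiple of the identity.\<close>

lemma N_N: "N (N u) = S B u + \<beta> *\<^sub>R u"
proof -
  define M where "M u = N (N u) - S B u" for u
  have M_adj: "ip (M u) v = ip u (M v)" for u v
    by (simp add: M_def ip_simps N_adj S_adj)
  have NS: "N (S u v) = S u (N v) + b v *\<^sub>R u - ip u v *\<^sub>R B" for u v
    using S_N[of u v] by (simp add: S_comm[of v] ip_comm[of v])
  have star: "ip u w *\<^sub>R M v - ip v w *\<^sub>R M u = ip (M u) w *\<^sub>R v - ip (M v) w *\<^sub>R u" for u v w
  proof -
    have 1: "N (S u (S v w)) = S u (S v (N w)) + b w *\<^sub>R S u v - ip v w *\<^sub>R S B u
        + ip (S B v) w *\<^sub>R u - ip u (S v w) *\<^sub>R B" for u v
    proof -
      have "b (S v w) = ip (S B v) w" by (simp add: ip_B[symmetric] S_adj')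
      then show ?thesis by (simp add: NS S_simps S_comm[of u B])
    qed
    have "N (S u (S v w) - S v (S u w))
        = S u (S v (N w)) - S v (S u (N w)) - ip v w *\<^sub>R S B u + ip u w *\<^sub>R S B v
          + ip (S B v) w *\<^sub>R u - ip (S B u) w *\<^sub>R v"
      unfolding N.diff 1 using S_adj'[of u v w] S_adj[of u v w]
      by (simp add: S_comm[of v u] algebra_simps)
    also have "S u (S v (N w)) - S v (S u (N w))
        = ip (N u) w *\<^sub>R N v - ip (N v) w *\<^sub>R N u + ip (N (N u)) w *\<^sub>R v - ip (N (N v)) w *\<^sub>R u"
      unfolding S_commutator by (simp add: N_adj)
    finally show ?thesis
      unfolding S_commutator N_simps M_def by (simp add: ip_simps algebra_simps)
  qed
  have "ip (M u) w = ip (\<beta> *\<^sub>R u) w" for w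
  proof -
    have "(\<Sum>a\<in>UNIV. ip (ip u w *\<^sub>R M (e a) - ip (e a) w *\<^sub>R M u) (d a))
        = (\<Sum>a\<in>UNIV. ip (ip (M u) w *\<^sub>R e a - ip (M (e a)) w *\<^sub>R u) (d a))"
      unfolding star ..
    then have "ip u w * (\<Sum>a\<in>UNIV. ip (M (e a)) (d a)) - ip w (M u)
        = ip (M u) w * n - ip (M w) u"
      by (simp only: ip.diff_left ip.scaleR_left real_scaleR_def sum_subtractf
          sum_distrib_left[symmetric] n_def[symmetric] parseval' M_adj[of "e _" w])
    moreover have "ip w (M u) = ip (M u) w" by (rule ip_comm)
    moreover have "ip (M w) u = ip (M u) w" unfolding M_adj[of w] by (rule ip_comm)
    moreover have "(\<Sum>a\<in>UNIV. ip (M (e a)) (d a)) = n * \<beta>"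
      using card by (simp add: \<beta>_def M_def n_eq)
    ultimately have "n * ip (M u) w = n * (\<beta> * ip u w)"
      by (auto simp: algebra_simps)
    then show ?thesis using n_minus_1 by (simp add: ip_simps)
  qed
  then have "M u = \<beta> *\<^sub>R u" by (rule nondegenerate)
  then show ?thesis by (simp add: M_def algebra_simps)
qed

subsection \<open>The algebra\<close>

text \<open>Triples \<open>(a, u, p)\<close> stand for \<open>a 1 + u + p \<nu>\<close>. The products are \<open>u v = S u v + ip u v \<nu> + ip (N u) v 1\<close>,
  \<open>u \<nu> = N u + b u 1\<close> and \<open>\<nu> \<nu> = \<beta> 1 + B\<close>: the first makes associativity on \<open>u, v, w\<close> the commutator
  relation, and the others are then forced by the invariance of the form \<open>eps (x y)\<close>, which pairs
  \<open>1\<close> with \<open>\<nu>\<close> and restricts to \<open>ip\<close>.\<close>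

definition mul :: "real \<times> 'a \<times> real \<Rightarrow> real \<times> 'a \<times> real \<Rightarrow> real \<times> 'a \<times> real" where
  "mul x y = (case x of (a, u, p) \<Rightarrow> case y of (c, v, q) \<Rightarrow>
     (a * c + ip (N u) v + p * b v + q * b u + \<beta> * p * q,
      a *\<^sub>R v + c *\<^sub>R u + S u v + q *\<^sub>R N u + p *\<^sub>R N v + (p * q) *\<^sub>R B,
      a * q + c * p + ip u v))"

definition one :: "real \<times> 'a \<times> real" where "one = (1, 0, 0)"
definition eps :: "real \<times> 'a \<times> real \<Rightarrow> real" where "eps x = snd (snd x)"

lemma mul_simp: "mul (a, u, p) (c, v, q) =
     (a * c + ip (N u) v + p * b v + q * b u + \<beta> * p * q,
      a *\<^sub>R v + c *\<^sub>R u + S u v + q *\<^sub>R N u + p *\<^sub>R N v + (p * q) *\<^sub>R B,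
      a * q + c * p + ip u v)"
  by (simp add: mul_def)

lemma N_sym: "ip (N u) v = ip (N v) u"
  unfolding N_adj[of v] by (rule ip_comm)

lemma mul_commute: "mul x y = mul y x"
  by (cases x, cases y) (simp add: mul_simp S_comm N_sym algebra_simps, simp add: ip_comm)

lemma b_zero: "b 0 = 0" using b_linear(2)[of 0 0] by simp

lemma mul_one: "mul one x = x"
  by (cases x) (simp add: mul_simp one_def b_zero S_simps N_simps ip_simps)

lemma b_S: "b (S u v) = ip (S B u) v" by (simp add: ip_B[symmetric] S_adj')

lemma b_N: "b (N u) = ip (N B) u" by (simp add: ip_B[symmetric] N_adj)

lemma S_B_sym: "ip (S B u) v = ip (S B v) u"
  unfolding S_adj[of B v] by (rule ip_comm)

text \<open>For a commutative product, symmetry of \<open>(x y) z\<close> in \<open>x\<close> and \<open>z\<close> is associativity. The components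
  reduce to the commutator relation, the Codazzi equation and the formula for \<open>N\<^sup>2\<close>.\<close>

lemma mul_reverse: "mul (mul x y) z = mul (mul z y) x"
proof -
  obtain a u p where x: "x = (a, u, p)" by (cases x)
  obtain c v q where y: "y = (c, v, q)" by (cases y)
  obtain f w r where z: "z = (f, w, r)" by (cases z)
  have "ip (N (S u v)) w + ip u v * b w = ip v (N (S w u)) + ip w u * b v" for u w
  proof -
    have "ip (N (S u v)) w = ip v (S u (N w))" by (simp add: N_adj S_adj)
    then show ?thesis unfolding S_N by (simp add: ip_simps ip_B' ip_comm[of v] algebra_simps)
  qed
  from this[of u w] this[of w u]
  have F1: "ip (N (S u v)) w + ip u v * b w = ip (N (S w v)) u + ip w v * b u"
    by (simp add: S_comm[of u w] ip_comm[of u w])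
  have ST: "ip (S u v) w = ip (S w v) u" by (metis S_adj S_comm ip_comm)
  have F2: "S (S u v) w = S (S w v) u + (ip w v *\<^sub>R N u - ip u v *\<^sub>R N w
      + ip (N w) v *\<^sub>R u - ip (N u) v *\<^sub>R w)"
    using S_commutator[of w u v] by (simp add: S_comm[of _ w] S_comm[of _ u] algebra_simps)
  show ?thesis unfolding x y z mul_simp prod.inject
  proof (intro conjI)
    show "(a * c + ip (N u) v + p * b v + q * b u + \<beta> * p * q) * f
        + ip (N (a *\<^sub>R v + c *\<^sub>R u + S u v + q *\<^sub>R N u + p *\<^sub>R N v + (p * q) *\<^sub>R B)) w
        + (a * q + c * p + ip u v) * b w
        + r * b (a *\<^sub>R v + c *\<^sub>R u + S u v + q *\<^sub>R N u + p *\<^sub>R N v + (p * q) *\<^sub>R B)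
        + \<beta> * (a * q + c * p + ip u v) * r
      = (f * c + ip (N w) v + r * b v + q * b w + \<beta> * r * q) * a
        + ip (N (f *\<^sub>R v + c *\<^sub>R w + S w v + q *\<^sub>R N w + r *\<^sub>R N v + (r * q) *\<^sub>R B)) u
        + (f * q + c * r + ip w v) * b u
        + p * b (f *\<^sub>R v + c *\<^sub>R w + S w v + q *\<^sub>R N w + r *\<^sub>R N v + (r * q) *\<^sub>R B)
        + \<beta> * (f * q + c * r + ip w v) * p"
      using F1
      by (simp add: N_simps ip.add_left ip.scaleR_left b_linear N_N b_S b_N N_sym[of v] N_sym[of w u]
          S_B_sym[of v] S_B_sym[of w u] ip_comm[of v u] ip_comm[of v w] ip_comm[of w u] algebra_simps)
    show "(a * c + ip (N u) v + p * b v + q * b u + \<beta> * p * q) *\<^sub>R w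
        + f *\<^sub>R (a *\<^sub>R v + c *\<^sub>R u + S u v + q *\<^sub>R N u + p *\<^sub>R N v + (p * q) *\<^sub>R B)
        + S (a *\<^sub>R v + c *\<^sub>R u + S u v + q *\<^sub>R N u + p *\<^sub>R N v + (p * q) *\<^sub>R B) w
        + r *\<^sub>R N (a *\<^sub>R v + c *\<^sub>R u + S u v + q *\<^sub>R N u + p *\<^sub>R N v + (p * q) *\<^sub>R B)
        + (a * q + c * p + ip u v) *\<^sub>R N w + ((a * q + c * p + ip u v) * r) *\<^sub>R B
      = (f * c + ip (N w) v + r * b v + q * b w + \<beta> * r * q) *\<^sub>R u
        + a *\<^sub>R (f *\<^sub>R v + c *\<^sub>R w + S w v + q *\<^sub>R N w + r *\<^sub>R N v + (r * q) *\<^sub>R B)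
        + S (f *\<^sub>R v + c *\<^sub>R w + S w v + q *\<^sub>R N w + r *\<^sub>R N v + (r * q) *\<^sub>R B) u
        + p *\<^sub>R N (f *\<^sub>R v + c *\<^sub>R w + S w v + q *\<^sub>R N w + r *\<^sub>R N v + (r * q) *\<^sub>R B)
        + (f * q + c * r + ip w v) *\<^sub>R N u + ((f * q + c * r + ip w v) * p) *\<^sub>R B"
      unfolding S.add_left S.scaleR_left N.add N.scaleR F2
        S_comm[of "N u" w] S_comm[of "N w" u] S_comm[of "N v" w] S_comm[of "N v" u] S_N N_N
      by (simp add: S_comm[of v u] S_comm[of v w] S_comm[of w u]
          ip_comm[of v u] ip_comm[of v w] ip_comm[of w u] N_sym[of v u] N_sym[of v w] N_sym[of w u]
          algebra_simps)
    show "(a * c + ip (N u) v + p * b v + q * b u + \<beta> * p * q) * r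
        + f * (a * q + c * p + ip u v)
        + ip (a *\<^sub>R v + c *\<^sub>R u + S u v + q *\<^sub>R N u + p *\<^sub>R N v + (p * q) *\<^sub>R B) w
      = (f * c + ip (N w) v + r * b v + q * b w + \<beta> * r * q) * p
        + a * (f * q + c * r + ip w v)
        + ip (f *\<^sub>R v + c *\<^sub>R w + S w v + q *\<^sub>R N w + r *\<^sub>R N v + (r * q) *\<^sub>R B) u"
      using ST
      by (simp add: ip.add_left ip.scaleR_left ip_B N_sym[of v] N_sym[of w u] ip_comm[of v u] ip_comm[of v w] ip_comm[of w u]
          algebra_simps)
  qed
qed

lemma mul_assoc: "mul (mul x y) z = mul x (mul y z)"
  using mul_reverse[of x y z] by (simp add: mul_commute)

end

section \<open>Inverse Gram matrices and trace-free parts\<close>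

lemma matrix_inv_mult:
  fixes G :: "real^'n^'n"
  assumes "invertible G"
  shows "G ** matrix_inv G = mat 1" "matrix_inv G ** G = mat 1"
  using someI_ex[OF assms[unfolded invertible_def]] by (simp_all add: matrix_inv_def)

lemma ginv_mult:
  fixes G :: "real^'n^'n"
  assumes "invertible G"
  shows "(\<Sum>b\<in>UNIV. G $ a $ b * ginv G b c) = (if a = c then 1 else 0)"
    and "(\<Sum>b\<in>UNIV. ginv G a b * G $ b $ c) = (if a = c then 1 else 0)"
  using arg_cong[OF matrix_inv_mult(1)[OF assms], of "\<lambda>M. M $ a $ c"]
    arg_cong[OF matrix_inv_mult(2)[OF assms], of "\<lambda>M. M $ a $ c"]
  by (simp_all add: matrix_matrix_mult_def mat_def)

lemma matrix_inv_unique: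
  fixes G :: "real^'n^'n"
  assumes "X ** G = mat 1"
  shows "matrix_inv G = X"
proof -
  have "invertible G" using assms invertible_left_inverse by blast
  then have "X ** (G ** matrix_inv G) = X" by (simp add: matrix_inv_mult)
  then show ?thesis by (simp add: matrix_mul_assoc assms)
qed

lemma matrix_inv_symmetric:
  fixes G :: "real^'n^'n"
  assumes "invertible G" "transpose G = G"
  shows "transpose (matrix_inv G) = matrix_inv G"
proof -
  have "transpose (matrix_inv G) ** G = transpose (G ** matrix_inv G)"
    by (simp add: matrix_transpose_mul assms(2))
  then have "transpose (matrix_inv G) ** G = mat 1"
    by (simp add: matrix_inv_mult assms(1))
  from matrix_inv_unique[OF this] show ?thesis by simp
qed

lemma ginv_symmetric:
  fixes G :: "real^'n^'n"
  assumes "invertible G" "\<And>i j. G $ i $ j = G $ j $ i"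
  shows "ginv G a b = ginv G b a"
proof -
  have "transpose G = G" using assms(2) by (simp add: transpose_def vec_eq_iff)
  from arg_cong[OF matrix_inv_symmetric[OF assms(1) this], of "\<lambda>M. M $ a $ b"]
  show ?thesis by (simp add: transpose_def)
qed

lemma ginv_scale:
  fixes G :: "real^'n^'n"
  assumes "invertible G" "r \<noteq> 0"
  shows "invertible (r *\<^sub>R G)" "ginv (r *\<^sub>R G) a b = ginv G a b / r"
proof -
  have 1: "((1 / r) *\<^sub>R matrix_inv G) ** (r *\<^sub>R G) = mat 1"
  proof -
    have "((1 / r) *\<^sub>R matrix_inv G) ** (r *\<^sub>R G) = matrix_inv G ** G"
      using assms(2) by (simp add: vec_eq_iff matrix_matrix_mult_def)
    then show ?thesis by (simp add: matrix_inv_mult assms(1))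
  qed
  then show "invertible (r *\<^sub>R G)" using invertible_left_inverse by blast
  show "ginv (r *\<^sub>R G) a b = ginv G a b / r" by (simp add: matrix_inv_unique[OF 1])
qed

lemma sum_delta_mult:
  "(\<Sum>b\<in>UNIV. (if a = b then 1 else 0) * f b) = (f a :: real)"
  "(\<Sum>b\<in>UNIV. (if b = a then 1 else 0) * f b) = (f a :: real)" for a :: "'n::finite"
  by (simp_all add: if_distrib[of "\<lambda>x. x * _"] cong: if_cong)

lemma ginv_contract:
  fixes G :: "real^'n^'n"
  assumes G: "invertible G" "\<And>i j. G $ i $ j = G $ j $ i"
  shows "(\<Sum>a\<in>UNIV. \<Sum>b\<in>UNIV. ginv G a b * (T a * G $ b $ k)) = T k"
    and "(\<Sum>a\<in>UNIV. \<Sum>b\<in>UNIV. ginv G a b * (T a * G $ k $ b)) = T k"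
    and "(\<Sum>a\<in>UNIV. \<Sum>b\<in>UNIV. ginv G a b * (G $ k $ a * T b)) = T k"
    and "(\<Sum>a\<in>UNIV. \<Sum>b\<in>UNIV. ginv G a b * (G $ a $ k * T b)) = T k"
    and "(\<Sum>a\<in>UNIV. \<Sum>b\<in>UNIV. ginv G a b * G $ a $ b) = real CARD('n)"
proof -
  have "(\<Sum>a\<in>UNIV. \<Sum>b\<in>UNIV. ginv G a b * (T a * G $ b $ k))
      = (\<Sum>a\<in>UNIV. (\<Sum>b\<in>UNIV. ginv G a b * G $ b $ k) * T a)" for T
    by (simp add: sum_distrib_left mult_ac)
  then show 1: "(\<Sum>a\<in>UNIV. \<Sum>b\<in>UNIV. ginv G a b * (T a * G $ b $ k)) = T k" for T
    by (simp only: ginv_mult[OF G(1)] sum_delta_mult)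
  then show "(\<Sum>a\<in>UNIV. \<Sum>b\<in>UNIV. ginv G a b * (T a * G $ k $ b)) = T k"
    by (simp only: G(2)[of k])
  have "(\<Sum>a\<in>UNIV. \<Sum>b\<in>UNIV. ginv G a b * (G $ k $ a * T b))
      = (\<Sum>a\<in>UNIV. \<Sum>b\<in>UNIV. ginv G a b * (T a * G $ b $ k))"
    by (subst sum.swap) (simp only: ginv_symmetric[OF G, of _ "_"] G(2)[of k] mult.commute[of "G $ _ $ _"])
  then show 3: "(\<Sum>a\<in>UNIV. \<Sum>b\<in>UNIV. ginv G a b * (G $ k $ a * T b)) = T k"
    using 1 by simp
  then show "(\<Sum>a\<in>UNIV. \<Sum>b\<in>UNIV. ginv G a b * (G $ a $ k * T b)) = T k"
    by (simp only: G(2)[of k])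
  have "(\<Sum>a\<in>UNIV. \<Sum>b\<in>UNIV. ginv G a b * G $ a $ b)
      = (\<Sum>a\<in>UNIV. \<Sum>b\<in>UNIV. ginv G a b * G $ b $ a)"
    by (simp only: G(2))
  then show "(\<Sum>a\<in>UNIV. \<Sum>b\<in>UNIV. ginv G a b * G $ a $ b) = real CARD('n)"
    by (simp add: ginv_mult[OF G(1)])
qed

text \<open>The terms with \<open>v\<close> are what taking the trace-free part removes, so a trace-free \<open>Z\<close> that differs
  from \<open>Y\<close> by such terms is the trace-free part of \<open>Y\<close>; \<open>v\<close> need not be computed from \<open>Y\<close>.\<close>

lemma trace_free_part_sym3_eqI:
  fixes G :: "real^'n^'n"
  assumes G: "invertible G" "\<And>i j. G $ i $ j = G $ j $ i"
    and tr: "\<And>k. (\<Sum>a\<in>UNIV. \<Sum>b\<in>UNIV. ginv G a b * Z a b k) = 0"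
    and Z: "\<And>i j k. Z i j k = Y i j k + (G $ i $ j * v k + G $ i $ k * v j + G $ j $ k * v i)"
  shows "trace_free_part_sym3 G Y = Z"
proof -
  have t: "(\<Sum>a\<in>UNIV. \<Sum>b\<in>UNIV. ginv G a b * Y a b k) = - (real CARD('n) + 2) * v k" for k
  proof -
    have "(\<Sum>a\<in>UNIV. \<Sum>b\<in>UNIV. ginv G a b * Z a b k)
      = (\<Sum>a\<in>UNIV. \<Sum>b\<in>UNIV. ginv G a b * Y a b k) + (\<Sum>a\<in>UNIV. \<Sum>b\<in>UNIV. ginv G a b * G $ a $ b) * v k
        + (\<Sum>a\<in>UNIV. \<Sum>b\<in>UNIV. ginv G a b * (G $ a $ k * v b))
        + (\<Sum>a\<in>UNIV. \<Sum>b\<in>UNIV. ginv G a b * (v a * G $ b $ k))"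
      unfolding Z by (simp add: sum.distrib sum_distrib_right sum_distrib_left algebra_simps)
    then show ?thesis using tr[of k] unfolding ginv_contract[OF G] by (simp add: algebra_simps)
  qed
  have n2: "real CARD('n) + 2 \<noteq> 0" by (simp add: add_nonneg_eq_0_iff)
  show ?thesis
    unfolding trace_free_part_sym3_def t Let_def Z[abs_def]
    using n2 by (intro ext) (simp add: field_simps)
qed

section \<open>Null frames in a commutative Frobenius algebra\<close>

text \<open>A commutative associative algebra with a linear form; \<open>eps (x \<odot> y)\<close> is its invariant form.\<close>

locale comm_frobenius =
  fixes mul :: "'w::euclidean_space \<Rightarrow> 'w \<Rightarrow> 'w" (infixl "\<odot>" 70)
    and unit :: 'w and eps :: "'w \<Rightarrow> real"
  assumes mul: "bounded_bilinear (\<odot>)" and eps: "bounded_linear eps"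
    and mul_comm: "x \<odot> y = y \<odot> x" and mul_ass: "(x \<odot> y) \<odot> z = x \<odot> (y \<odot> z)"
    and unit: "unit \<odot> x = x"
begin

sublocale mul: bounded_bilinear "(\<odot>)" by (rule mul)
sublocale eps: bounded_linear eps by (rule eps)

lemma mul_left_comm: "x \<odot> (y \<odot> z) = y \<odot> (x \<odot> z)"
  by (metis mul_ass mul_comm)

lemmas mul_ac = mul_ass mul_comm mul_left_comm

lemma unit_right: "x \<odot> unit = x"
  using unit mul_comm by metis

lemmas mul_simps = mul.add_left mul.add_right mul.diff_left mul.diff_right mul.scaleR_left
  mul.scaleR_right mul.minus_left mul.minus_right
lemmas eps_simps = eps.add eps.diff eps.scaleR eps.neg

text \<open>A null vector \<open>s\<close> of the invariant form \<open>eps (x \<odot> y)\<close>, tangent vectors \<open>s1 i\<close> of the null cone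
  at \<open>s\<close> with Gram matrix \<open>G\<close>, and the null vector \<open>\<nu>\<close> transversal to the cone along them.\<close>

definition null_frame :: "real^'n^'n \<Rightarrow> 'w \<Rightarrow> ('n::finite \<Rightarrow> 'w) \<Rightarrow> 'w \<Rightarrow> bool" where
  "null_frame G s s1 \<nu> \<longleftrightarrow> invertible G \<and> eps (s \<odot> s) = 0 \<and> eps (s \<odot> \<nu>) = 1 \<and> eps (\<nu> \<odot> \<nu>) = 0 \<and>
     (\<forall>i. eps (s \<odot> s1 i) = 0 \<and> eps (s1 i \<odot> \<nu>) = 0) \<and> (\<forall>i j. eps (s1 i \<odot> s1 j) = G $ i $ j)"

text \<open>The inverse of the invariant form, written in the frame and fed into a bilinear map. When the
  frame spans, it does not depend on the frame.\<close>

definition casimir ::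
  "real^'n^'n \<Rightarrow> 'w \<Rightarrow> ('n::finite \<Rightarrow> 'w) \<Rightarrow> 'w \<Rightarrow> ('w \<Rightarrow> 'w \<Rightarrow> 'w) \<Rightarrow> 'w" where
  "casimir G s s1 \<nu> B = (\<Sum>a\<in>UNIV. \<Sum>b\<in>UNIV. ginv G a b *\<^sub>R B (s1 a) (s1 b)) + B s \<nu> + B \<nu> s"

text \<open>The frame of the section \<open>l y\<close> of the null cone, where \<open>l1\<close> is the differential of the function \<open>l\<close>.
  The formula for \<open>\<nu>'\<close> is forced by the conditions on a null frame. Since the inverse form does not
  depend on the frame, neither do completeness of the frame nor the Casimir element.\<close>

lemma null_frame_rescale:
  fixes g :: "real^'n^'n" and l1 :: "'n \<Rightarrow> real"
  assumes fr: "null_frame g y y1 \<nu>" and l: "l \<noteq> 0"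
  defines "\<mu> \<equiv> \<lambda>i. l1 i / l"
  defines "P \<equiv> \<Sum>a\<in>UNIV. \<Sum>b\<in>UNIV. (ginv g a b * \<mu> a) *\<^sub>R y1 b"
  defines "m \<equiv> \<Sum>a\<in>UNIV. \<Sum>b\<in>UNIV. ginv g a b * (\<mu> a * \<mu> b)"
  defines "\<nu>' \<equiv> (1 / l) *\<^sub>R (\<nu> - P - (m / 2) *\<^sub>R y)"
  shows "null_frame (l\<^sup>2 *\<^sub>R g) (l *\<^sub>R y) (\<lambda>i. l1 i *\<^sub>R y + l *\<^sub>R y1 i) \<nu>'"
    and "bounded_bilinear B \<Longrightarrow>
      casimir (l\<^sup>2 *\<^sub>R g) (l *\<^sub>R y) (\<lambda>i. l1 i *\<^sub>R y + l *\<^sub>R y1 i) \<nu>' B = casimir g y y1 \<nu> B"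
proof -
  note F = fr[unfolded null_frame_def]
  have ginv: "invertible g" and yy: "eps (y \<odot> y) = 0" and yn: "eps (y \<odot> \<nu>) = 1"
    and nn: "eps (\<nu> \<odot> \<nu>) = 0" and yy1: "\<And>i. eps (y \<odot> y1 i) = 0" and y1n: "\<And>i. eps (y1 i \<odot> \<nu>) = 0"
    and y1y1: "\<And>i j. eps (y1 i \<odot> y1 j) = g $ i $ j"
    using F by auto
  have gs: "g $ i $ j = g $ j $ i" for i j using y1y1[of i j] y1y1[of j i] mul_comm by simp
  have Py: "eps (y \<odot> P) = 0" and Pn: "eps (\<nu> \<odot> P) = 0"
    by (simp_all add: P_def mul.sum_right mul.scaleR_right eps.sum eps.scaleR yy1 mul_comm[of \<nu>] y1n)
  have y1P: "eps (y1 i \<odot> P) = \<mu> i" for i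
    by (simp add: P_def mul.sum_right mul.scaleR_right eps.sum eps.scaleR y1y1 mult.assoc
        ginv_contract(2)[OF ginv gs])
  have PP: "eps (P \<odot> P) = m"
  proof -
    have "eps (P \<odot> P) = (\<Sum>a\<in>UNIV. \<Sum>b\<in>UNIV. (ginv g a b * \<mu> a) * eps (y1 b \<odot> P))"
      by (subst (1) P_def) (simp add: mul.sum_left mul.scaleR_left eps.sum eps.scaleR)
    then show ?thesis by (simp add: y1P m_def mult.assoc)
  qed
  have l1: "l1 i = l * \<mu> i" for i using l by (simp add: \<mu>_def)
  have l2: "l\<^sup>2 \<noteq> 0" using l by simp
  show "null_frame (l\<^sup>2 *\<^sub>R g) (l *\<^sub>R y) (\<lambda>i. l1 i *\<^sub>R y + l *\<^sub>R y1 i) \<nu>'"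
    unfolding null_frame_def
  proof (intro conjI allI)
    show "invertible (l\<^sup>2 *\<^sub>R g)" by (rule ginv_scale(1)[OF ginv l2])
    show "eps (l *\<^sub>R y \<odot> l *\<^sub>R y) = 0"
      by (simp add: mul_simps eps_simps yy)
    show "eps (l *\<^sub>R y \<odot> \<nu>') = 1"
      using l by (simp add: \<nu>'_def mul_simps eps_simps yy yn Py)
    have "eps (\<nu>' \<odot> \<nu>') = (1 / l) * (1 / l) * (eps (\<nu> \<odot> \<nu>) + eps (P \<odot> P) - 2 * eps (\<nu> \<odot> P) - m * eps (y \<odot> \<nu>)
        + m * eps (y \<odot> P) + (m / 2) * (m / 2) * eps (y \<odot> y))"
      by (simp add: \<nu>'_def mul_simps eps_simps mul_comm[of P \<nu>] mul_comm[of P y] mul_comm[of \<nu> y] algebra_simps)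
    then show "eps (\<nu>' \<odot> \<nu>') = 0" by (simp add: nn PP Pn yn Py yy)
    fix i
    show "eps (l *\<^sub>R y \<odot> (l1 i *\<^sub>R y + l *\<^sub>R y1 i)) = 0"
      by (simp add: mul_simps eps_simps yy yy1)
    show "eps ((l1 i *\<^sub>R y + l *\<^sub>R y1 i) \<odot> \<nu>') = 0"
      using l by (simp add: \<nu>'_def l1 mul_simps eps_simps yy yn y1n Py y1P yy1 mul_comm[of "y1 i" y])
    fix j
    show "eps ((l1 i *\<^sub>R y + l *\<^sub>R y1 i) \<odot> (l1 j *\<^sub>R y + l *\<^sub>R y1 j)) = (l\<^sup>2 *\<^sub>R g) $ i $ j"
      by (simp add: mul_simps eps_simps yy yy1 mul_comm[of "y1 i" y] y1y1 power2_eq_square)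
  qed
  assume B: "bounded_bilinear B"
  interpret B: bounded_bilinear B by (rule B)
  have "(\<Sum>a\<in>UNIV. \<Sum>b\<in>UNIV. ginv (l\<^sup>2 *\<^sub>R g) a b *\<^sub>R B (l1 a *\<^sub>R y + l *\<^sub>R y1 a) (l1 b *\<^sub>R y + l *\<^sub>R y1 b))
      = (\<Sum>a\<in>UNIV. \<Sum>b\<in>UNIV. ginv g a b *\<^sub>R B (y1 a) (y1 b) + (ginv g a b * \<mu> a) *\<^sub>R B y (y1 b)
          + (ginv g a b * \<mu> b) *\<^sub>R B (y1 a) y + (ginv g a b * (\<mu> a * \<mu> b)) *\<^sub>R B y y)"
  proof (intro sum.cong refl)
    fix a b
    have "B (l1 a *\<^sub>R y + l *\<^sub>R y1 a) (l1 b *\<^sub>R y + l *\<^sub>R y1 b) = l\<^sup>2 *\<^sub>R (B (y1 a) (y1 b) + \<mu> a *\<^sub>R B y (y1 b)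
       + \<mu> b *\<^sub>R B (y1 a) y + (\<mu> a * \<mu> b) *\<^sub>R B y y)"
      by (simp add: l1 B.add_left B.add_right B.scaleR_left B.scaleR_right power2_eq_square algebra_simps)
    then show "ginv (l\<^sup>2 *\<^sub>R g) a b *\<^sub>R B (l1 a *\<^sub>R y + l *\<^sub>R y1 a) (l1 b *\<^sub>R y + l *\<^sub>R y1 b)
      = ginv g a b *\<^sub>R B (y1 a) (y1 b) + (ginv g a b * \<mu> a) *\<^sub>R B y (y1 b)
          + (ginv g a b * \<mu> b) *\<^sub>R B (y1 a) y + (ginv g a b * (\<mu> a * \<mu> b)) *\<^sub>R B y y"
      using l2 by (simp add: ginv_scale(2)[OF ginv l2] scaleR_add_right)
  qed
  also have "\<dots> = (\<Sum>a\<in>UNIV. \<Sum>b\<in>UNIV. ginv g a b *\<^sub>R B (y1 a) (y1 b)) + B y P + B P y + m *\<^sub>R B y y"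
  proof -
    have 1: "B y P = (\<Sum>a\<in>UNIV. \<Sum>b\<in>UNIV. (ginv g a b * \<mu> a) *\<^sub>R B y (y1 b))"
      by (simp add: P_def B.sum_right B.scaleR_right)
    have "B P y = (\<Sum>a\<in>UNIV. \<Sum>b\<in>UNIV. (ginv g a b * \<mu> a) *\<^sub>R B (y1 b) y)"
      by (simp add: P_def B.sum_left B.scaleR_left)
    also have "\<dots> = (\<Sum>b\<in>UNIV. \<Sum>a\<in>UNIV. (ginv g a b * \<mu> a) *\<^sub>R B (y1 b) y)"
      by (rule sum.swap)
    also have "\<dots> = (\<Sum>a\<in>UNIV. \<Sum>b\<in>UNIV. (ginv g a b * \<mu> b) *\<^sub>R B (y1 a) y)"
      by (intro sum.cong refl) (simp only: ginv_symmetric[OF ginv gs])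
    finally have 2: "B P y = (\<Sum>a\<in>UNIV. \<Sum>b\<in>UNIV. (ginv g a b * \<mu> b) *\<^sub>R B (y1 a) y)" .
    show ?thesis unfolding 1 2 by (simp add: sum.distrib m_def scaleR_sum_left)
  qed
  finally have calc: "(\<Sum>a\<in>UNIV. \<Sum>b\<in>UNIV. ginv (l\<^sup>2 *\<^sub>R g) a b *\<^sub>R B (l1 a *\<^sub>R y + l *\<^sub>R y1 a) (l1 b *\<^sub>R y + l *\<^sub>R y1 b))
      = (\<Sum>a\<in>UNIV. \<Sum>b\<in>UNIV. ginv g a b *\<^sub>R B (y1 a) (y1 b)) + B y P + B P y + m *\<^sub>R B y y" .
  show "casimir (l\<^sup>2 *\<^sub>R g) (l *\<^sub>R y) (\<lambda>i. l1 i *\<^sub>R y + l *\<^sub>R y1 i) \<nu>' B = casimir g y y1 \<nu> B"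
  proof -
    have "B (l *\<^sub>R y) \<nu>' = B y \<nu> - B y P - (m / 2) *\<^sub>R B y y"
      "B \<nu>' (l *\<^sub>R y) = B \<nu> y - B P y - (m / 2) *\<^sub>R B y y"
      using l by (simp_all add: \<nu>'_def B.scaleR_left B.scaleR_right B.diff_left B.diff_right
          scaleR_right_diff_distrib)
    moreover have "m *\<^sub>R B y y = (m / 2) *\<^sub>R B y y + (m / 2) *\<^sub>R B y y"
      by (simp add: scaleR_add_left[symmetric])
    ultimately show ?thesis by (simp add: casimir_def calc)
  qed
qed

end

section \<open>The differential equation for sections of the null cone\<close>

text \<open>The pointwise identity behind the theorem. Here \<open>s\<close>, \<open>s1\<close>, \<open>s2\<close> are the values of a section of
  the null cone and of its first and second derivatives, \<open>r\<close> is the inverse of \<open>s\<close>, and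
  \<open>\<omega>\<close> is the Casimir element. The section is normalised so that \<open>\<omega>\<close> is orthogonal to \<open>r \<odot> s1 k\<close>,
  which makes the cubic form \<open>C\<close> trace-free; \<open>\<omega>_d\<close> is the derivative of this normalisation.\<close>

locale cone_point = comm_frobenius mul unit eps
  for mul :: "'w::euclidean_space \<Rightarrow> 'w \<Rightarrow> 'w" (infixl "\<odot>" 70) and unit eps +
  fixes G :: "real^'n^'n" and s r \<nu> \<omega> :: 'w and s1 :: "'n::finite \<Rightarrow> 'w" and s2 :: "'n \<Rightarrow> 'n \<Rightarrow> 'w"
  assumes card: "CARD('n) \<ge> 3"
    and fr: "null_frame G s s1 \<nu>"
    and complete: "casimir G s s1 \<nu> (\<lambda>u v. eps (w \<odot> u) *\<^sub>R v) = w"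
    and omega: "casimir G s s1 \<nu> (\<odot>) = \<omega>"
    and rs: "r \<odot> s = unit"
    and s_s2: "eps (s \<odot> s2 i j) = - G $ i $ j"
    and \<omega>_tangent: "eps (\<omega> \<odot> r \<odot> s1 k) = 0"
    and \<omega>_d: "eps (\<omega> \<odot> r \<odot> r \<odot> s1 k \<odot> s1 l) = eps (\<omega> \<odot> r \<odot> s2 k l)"
    and eps_\<omega>: "eps \<omega> = real CARD('n) + 2"
begin

lemma invG: "invertible G" and nn: "eps (\<nu> \<odot> \<nu>) = 0"
    and s1n: "eps (s1 i \<odot> \<nu>) = 0" and s1s1: "eps (s1 i \<odot> s1 j) = G $ i $ j"
  using fr unfolding null_frame_def by auto

lemma symG: "G $ i $ j = G $ j $ i"
  using s1s1[of i j] s1s1[of j i] mul_comm by simp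

lemmas contract = ginv_contract[OF invG symG]

lemma r_cancel: "r \<odot> (s \<odot> x) = x" "s \<odot> (r \<odot> x) = x"
  by (simp_all add: mul_ass[symmetric] rs mul_comm[of s r] unit)

lemma pairing: "eps (w \<odot> z) = eps (w \<odot> \<nu>) * eps (s \<odot> z)
    + (\<Sum>a\<in>UNIV. \<Sum>b\<in>UNIV. ginv G a b * (eps (w \<odot> s1 a) * eps (s1 b \<odot> z))) + eps (w \<odot> s) * eps (\<nu> \<odot> z)"
proof -
  have "eps (w \<odot> z) = eps (casimir G s s1 \<nu> (\<lambda>u v. eps (w \<odot> u) *\<^sub>R v) \<odot> z)"
    by (simp add: complete)
  then show ?thesis
    by (simp add: casimir_def mul.sum_left eps.sum mul_simps eps_simps mult.assoc)
qed

definition C where "C i j k = eps (r \<odot> s1 i \<odot> s1 j \<odot> s1 k)"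
definition \<rho> where "\<rho> i j = eps (r \<odot> \<nu> \<odot> s1 i \<odot> s1 j)"
definition Q where "Q i j k l = eps (r \<odot> r \<odot> s1 i \<odot> s1 j \<odot> s1 k \<odot> s1 l)"
definition R where "R = eps (\<omega> \<odot> r \<odot> \<nu>)"
definition \<Gamma> where "\<Gamma> m l i = (\<Sum>b\<in>UNIV. ginv G m b * eps (s2 l i \<odot> s1 b))"

text \<open>Associativity enters here: \<open>Q\<close> is totally symmetric, and as the pairing of two products it splits
  into the square of \<open>C\<close> and terms with \<open>\<rho>\<close>.\<close>

lemma CC: "(\<Sum>a\<in>UNIV. \<Sum>b\<in>UNIV. ginv G a b * (C i l b * C j k a)) = Q i j k l - \<rho> i l * G $ j $ k - G $ i $ l * \<rho> j k"
proof -
  have 1: "eps ((r \<odot> s1 j \<odot> s1 k) \<odot> (r \<odot> s1 i \<odot> s1 l)) = Q i j k l"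
    by (simp add: Q_def mul_ac)
  have 2: "eps ((r \<odot> s1 j \<odot> s1 k) \<odot> \<nu>) = \<rho> j k" "eps (\<nu> \<odot> (r \<odot> s1 i \<odot> s1 l)) = \<rho> i l"
    by (simp_all add: \<rho>_def mul_ac)
  have 3: "eps (s \<odot> (r \<odot> s1 i \<odot> s1 l)) = G $ i $ l"
    by (simp add: mul_ass r_cancel s1s1)
  have 4: "eps ((r \<odot> s1 j \<odot> s1 k) \<odot> s) = G $ j $ k"
    by (simp add: mul_comm[of _ s]) (simp add: mul_ass r_cancel s1s1)
  have 5: "eps ((r \<odot> s1 j \<odot> s1 k) \<odot> s1 a) = C j k a" "eps (s1 b \<odot> (r \<odot> s1 i \<odot> s1 l)) = C i l b" for a b
    by (simp_all add: C_def mul_ac)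
  show ?thesis
    using pairing[of "r \<odot> s1 j \<odot> s1 k" "r \<odot> s1 i \<odot> s1 l"]
    unfolding 1 2 3 4 5 by (simp add: algebra_simps)
qed

lemma \<omega>_pair: "eps (\<omega> \<odot> r \<odot> z) = R * eps (s \<odot> z) + (real CARD('n) + 2) * eps (\<nu> \<odot> z)"
proof -
  have "eps ((\<omega> \<odot> r) \<odot> s) = real CARD('n) + 2"
    by (simp add: mul_ass rs unit_right eps_\<omega>)
  then show ?thesis
    using pairing[of "\<omega> \<odot> r" z] by (simp add: R_def \<omega>_tangent)
qed

lemma trace_Q: "(\<Sum>a\<in>UNIV. \<Sum>b\<in>UNIV. ginv G a b * Q a b k l) = real CARD('n) * \<rho> k l + R * G $ k $ l"
proof -
  have "(\<Sum>a\<in>UNIV. \<Sum>b\<in>UNIV. ginv G a b * Q a b k l)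
      = eps ((\<Sum>a\<in>UNIV. \<Sum>b\<in>UNIV. ginv G a b *\<^sub>R (s1 a \<odot> s1 b)) \<odot> (r \<odot> r \<odot> s1 k \<odot> s1 l))"
    by (simp only: Q_def mul.sum_left eps.sum mul.scaleR_left eps.scaleR real_scaleR_def)
      (simp add: mul_ac)
  also have "(\<Sum>a\<in>UNIV. \<Sum>b\<in>UNIV. ginv G a b *\<^sub>R (s1 a \<odot> s1 b)) = \<omega> - s \<odot> \<nu> - \<nu> \<odot> s"
    using omega by (simp add: casimir_def algebra_simps)
  also have "eps ((\<omega> - s \<odot> \<nu> - \<nu> \<odot> s) \<odot> (r \<odot> r \<odot> s1 k \<odot> s1 l))
      = eps (\<omega> \<odot> r \<odot> (r \<odot> s1 k \<odot> s1 l)) - 2 * eps (\<nu> \<odot> (s \<odot> (r \<odot> (r \<odot> s1 k \<odot> s1 l))))"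
    by (simp add: mul.diff_left eps.diff mul_ass mul_comm[of \<nu> s] mul_left_comm[of s \<nu>])
  also have "\<dots> = R * G $ k $ l + (real CARD('n) + 2) * \<rho> k l - 2 * \<rho> k l"
  proof -
    have "eps (\<nu> \<odot> (r \<odot> s1 k \<odot> s1 l)) = \<rho> k l" by (simp add: \<rho>_def mul_ac)
    moreover have "eps (s \<odot> (r \<odot> s1 k \<odot> s1 l)) = G $ k $ l" by (simp add: mul_ass r_cancel s1s1)
    ultimately show ?thesis unfolding \<omega>_pair r_cancel by simp
  qed
  finally show ?thesis by (simp add: algebra_simps)
qed

lemma trace_\<rho>: "(\<Sum>a\<in>UNIV. \<Sum>b\<in>UNIV. ginv G a b * \<rho> a b) = R"
proof -
  have "(\<Sum>a\<in>UNIV. \<Sum>b\<in>UNIV. ginv G a b * \<rho> a b)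
      = eps ((\<Sum>a\<in>UNIV. \<Sum>b\<in>UNIV. ginv G a b *\<^sub>R (s1 a \<odot> s1 b)) \<odot> (r \<odot> \<nu>))"
    by (simp only: \<rho>_def mul.sum_left eps.sum mul.scaleR_left eps.scaleR real_scaleR_def)
      (simp add: mul_ac)
  also have "(\<Sum>a\<in>UNIV. \<Sum>b\<in>UNIV. ginv G a b *\<^sub>R (s1 a \<odot> s1 b)) = \<omega> - s \<odot> \<nu> - \<nu> \<odot> s"
    using omega by (simp add: casimir_def algebra_simps)
  also have "eps ((\<omega> - s \<odot> \<nu> - \<nu> \<odot> s) \<odot> (r \<odot> \<nu>)) = R - 2 * eps (\<nu> \<odot> (s \<odot> (r \<odot> \<nu>)))"
    by (simp add: R_def mul.diff_left eps.diff mul_ass mul_comm[of \<nu> s] mul_left_comm[of s \<nu>])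
  finally show ?thesis by (simp add: r_cancel nn)
qed

lemma trace_C: "(\<Sum>a\<in>UNIV. \<Sum>b\<in>UNIV. ginv G a b * C a b k) = 0"
proof -
  have "(\<Sum>a\<in>UNIV. \<Sum>b\<in>UNIV. ginv G a b * C a b k)
      = eps ((\<Sum>a\<in>UNIV. \<Sum>b\<in>UNIV. ginv G a b *\<^sub>R (s1 a \<odot> s1 b)) \<odot> (r \<odot> s1 k))"
    by (simp only: C_def mul.sum_left eps.sum mul.scaleR_left eps.scaleR real_scaleR_def)
      (simp add: mul_ac)
  also have "(\<Sum>a\<in>UNIV. \<Sum>b\<in>UNIV. ginv G a b *\<^sub>R (s1 a \<odot> s1 b)) = \<omega> - s \<odot> \<nu> - \<nu> \<odot> s"
    using omega by (simp add: casimir_def algebra_simps)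
  also have "eps ((\<omega> - s \<odot> \<nu> - \<nu> \<odot> s) \<odot> (r \<odot> s1 k)) = eps (\<omega> \<odot> r \<odot> s1 k) - 2 * eps (\<nu> \<odot> (s \<odot> (r \<odot> s1 k)))"
    by (simp add: mul.diff_left eps.diff mul_ass mul_comm[of \<nu> s] mul_left_comm[of s \<nu>])
  finally show ?thesis by (simp add: r_cancel \<omega>_tangent mul_comm[of \<nu>] s1n)
qed

lemma Q_sym: "Q i j k l = Q j i k l" "Q i j k l = Q i k j l" "Q i j k l = Q i j l k"
  by (simp_all add: Q_def mul_ac)
lemma C_sym: "C i j k = C j i k" "C i j k = C i k j"
  by (simp_all add: C_def mul_ac)
lemma \<rho>_sym: "\<rho> i j = \<rho> j i"
  by (simp add: \<rho>_def mul_ac)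

text \<open>The square of \<open>C\<close> on the right-hand side of the theorem is the part \<open>\<rho>\<close> of the product up to a
  multiple of the metric; the factor \<open>n - 2\<close> is cancelled by the coefficient \<open>4 / (n - 2)\<close>.\<close>

lemma tau: "(\<Sum>a\<in>UNIV. \<Sum>b\<in>UNIV. \<Sum>c\<in>UNIV. \<Sum>d\<in>UNIV. ginv G a c * ginv G b d * C j c d * C k a b)
    = (real CARD('n) - 2) * \<rho> j k + R * G $ j $ k"
proof -
  have "(\<Sum>a\<in>UNIV. \<Sum>b\<in>UNIV. \<Sum>c\<in>UNIV. \<Sum>d\<in>UNIV. ginv G a c * ginv G b d * C j c d * C k a b)
    = (\<Sum>a\<in>UNIV. \<Sum>c\<in>UNIV. \<Sum>b\<in>UNIV. \<Sum>d\<in>UNIV. ginv G a c * ginv G b d * C j c d * C k a b)"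
    by (intro sum.cong refl sum.swap)
  also have "\<dots> = (\<Sum>a\<in>UNIV. \<Sum>c\<in>UNIV. ginv G a c * (\<Sum>b\<in>UNIV. \<Sum>d\<in>UNIV. ginv G b d * (C j c d * C k a b)))"
    by (simp add: sum_distrib_left mult_ac)
  also have "\<dots> = (\<Sum>a\<in>UNIV. \<Sum>c\<in>UNIV. ginv G a c * (Q a c j k - \<rho> j c * G $ k $ a - G $ j $ c * \<rho> k a))"
    unfolding CC using Q_sym by (intro sum.cong refl) metis
  also have "\<dots> = (\<Sum>a\<in>UNIV. \<Sum>c\<in>UNIV. ginv G a c * Q a c j k)
      - (\<Sum>a\<in>UNIV. \<Sum>c\<in>UNIV. ginv G a c * (G $ k $ a * \<rho> j c))
      - (\<Sum>a\<in>UNIV. \<Sum>c\<in>UNIV. ginv G a c * (\<rho> k a * G $ j $ c))"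
    by (simp add: sum_subtractf sum.distrib algebra_simps)
  also have "\<dots> = real CARD('n) * \<rho> j k + R * G $ j $ k - \<rho> j k - \<rho> k j"
    unfolding trace_Q contract ..
  finally show ?thesis by (simp add: \<rho>_sym[of k] algebra_simps)
qed

text \<open>The second fundamental form in the direction \<open>\<nu>\<close>, which is the Schouten tensor of \<open>G\<close> up to sign,
  is determined by the normalisation of the section.\<close>

lemma s2_\<nu>: "eps (s2 k l \<odot> \<nu>) = \<rho> k l + 2 * R / (real CARD('n) + 2) * G $ k $ l"
proof -
  have "eps (\<omega> \<odot> r \<odot> (r \<odot> s1 k \<odot> s1 l)) = eps (\<omega> \<odot> r \<odot> s2 k l)"
    using \<omega>_d by (simp add: mul_ass)
  moreover have "eps (\<nu> \<odot> (r \<odot> s1 k \<odot> s1 l)) = \<rho> k l" by (simp add: \<rho>_def mul_ac)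
  moreover have "eps (s \<odot> (r \<odot> s1 k \<odot> s1 l)) = G $ k $ l" by (simp add: mul_ass r_cancel s1s1)
  ultimately have "R * G $ k $ l + (real CARD('n) + 2) * \<rho> k l
      = - R * G $ k $ l + (real CARD('n) + 2) * eps (s2 k l \<odot> \<nu>)"
    unfolding \<omega>_pair s_s2 by (simp add: mul_comm)
  then show ?thesis by (simp add: field_simps add_nonneg_eq_0_iff)
qed

definition \<kappa> where "\<kappa> = 2 * R / (real CARD('n) + 2)"

text \<open>Expanding the second derivative in the frame; its tangential part gives the Christoffel terms.\<close>

lemma s2_C: "eps (r \<odot> s2 l i \<odot> s1 j \<odot> s1 k)
    = \<rho> l i * G $ j $ k + \<kappa> * G $ l $ i * G $ j $ k - G $ l $ i * \<rho> j k + (\<Sum>m\<in>UNIV. \<Gamma> m l i * C m j k)"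
proof -
  have "eps (r \<odot> s2 l i \<odot> s1 j \<odot> s1 k) = eps (s2 l i \<odot> (r \<odot> s1 j \<odot> s1 k))"
    by (simp add: mul_ac)
  moreover have "eps (\<nu> \<odot> (r \<odot> s1 j \<odot> s1 k)) = \<rho> j k" by (simp add: \<rho>_def mul_ac)
  moreover have "eps (s \<odot> (r \<odot> s1 j \<odot> s1 k)) = G $ j $ k" by (simp add: mul_ass r_cancel s1s1)
  moreover have "(\<Sum>a\<in>UNIV. \<Sum>b\<in>UNIV. ginv G a b * (eps (s2 l i \<odot> s1 a) * eps (s1 b \<odot> (r \<odot> s1 j \<odot> s1 k))))
      = (\<Sum>m\<in>UNIV. \<Gamma> m l i * C m j k)"
  proof -
    have "eps (s1 b \<odot> (r \<odot> s1 j \<odot> s1 k)) = C b j k" for b by (simp add: C_def mul_ac)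
    then have "(\<Sum>a\<in>UNIV. \<Sum>b\<in>UNIV. ginv G a b * (eps (s2 l i \<odot> s1 a) * eps (s1 b \<odot> (r \<odot> s1 j \<odot> s1 k))))
        = (\<Sum>b\<in>UNIV. \<Sum>a\<in>UNIV. ginv G a b * (eps (s2 l i \<odot> s1 a) * C b j k))"
      by (subst sum.swap) simp
    also have "\<dots> = (\<Sum>b\<in>UNIV. \<Sum>a\<in>UNIV. ginv G b a * (eps (s2 l i \<odot> s1 a) * C b j k))"
      by (intro sum.cong refl) (simp only: ginv_symmetric[OF invG symG])
    finally show ?thesis by (simp add: \<Gamma>_def sum_distrib_right sum_distrib_left mult_ac)
  qed
  moreover have "eps (s2 l i \<odot> s) = - G $ l $ i" using s_s2 mul_comm by simp
  ultimately show ?thesis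
    using pairing[of "s2 l i" "r \<odot> s1 j \<odot> s1 k"]
    by (simp add: s2_\<nu> \<kappa>_def[symmetric] algebra_simps)
qed

definition dC where
  "dC l i j k = - eps (r \<odot> r \<odot> s1 l \<odot> s1 i \<odot> s1 j \<odot> s1 k) + eps (r \<odot> s2 l i \<odot> s1 j \<odot> s1 k)
     + eps (r \<odot> s1 i \<odot> s2 l j \<odot> s1 k) + eps (r \<odot> s1 i \<odot> s1 j \<odot> s2 l k)"

definition nabla_C where
  "nabla_C l i j k = dC l i j k - (\<Sum>m\<in>UNIV. \<Gamma> m l i * C m j k + \<Gamma> m l j * C i m k + \<Gamma> m l k * C i j m)"

lemma nabla_C: "nabla_C l i j k = - Q i j k l
    + (\<rho> i l * G $ j $ k + \<rho> j l * G $ i $ k + \<rho> k l * G $ i $ j)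
    - (G $ i $ l * \<rho> j k + G $ j $ l * \<rho> i k + G $ k $ l * \<rho> i j)
    + \<kappa> * (G $ i $ l * G $ j $ k + G $ j $ l * G $ i $ k + G $ k $ l * G $ i $ j)"
proof -
  have "eps (r \<odot> s1 i \<odot> s2 l j \<odot> s1 k) = eps (r \<odot> s2 l j \<odot> s1 i \<odot> s1 k)"
    "eps (r \<odot> s1 i \<odot> s1 j \<odot> s2 l k) = eps (r \<odot> s2 l k \<odot> s1 i \<odot> s1 j)"
    "eps (r \<odot> r \<odot> s1 l \<odot> s1 i \<odot> s1 j \<odot> s1 k) = Q i j k l"
    by (simp_all add: Q_def mul_ac)
  moreover have "(\<Sum>m\<in>UNIV. \<Gamma> m l i * C m j k + \<Gamma> m l j * C i m k + \<Gamma> m l k * C i j m)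
      = (\<Sum>m\<in>UNIV. \<Gamma> m l i * C m j k) + (\<Sum>m\<in>UNIV. \<Gamma> m l j * C m i k) + (\<Sum>m\<in>UNIV. \<Gamma> m l k * C m i j)"
    unfolding sum.distrib[symmetric] by (intro sum.cong refl) (metis C_sym)
  ultimately show ?thesis
    unfolding nabla_C_def dC_def
    by (simp add: s2_C symG[of l] \<rho>_sym[of l] algebra_simps)
qed

lemma trace_nabla_C: "(\<Sum>a\<in>UNIV. \<Sum>b\<in>UNIV. ginv G a b * nabla_C l a b k) = 0"
proof -
  have "(\<Sum>a\<in>UNIV. \<Sum>b\<in>UNIV. ginv G a b * nabla_C l a b k)
    = (\<Sum>a\<in>UNIV. \<Sum>b\<in>UNIV. - (ginv G a b * Q a b k l)
      + (ginv G a b * (\<rho> a l * G $ b $ k) + ginv G a b * (G $ a $ k * \<rho> b l) + \<rho> k l * (ginv G a b * G $ a $ b))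
      - (ginv G a b * (G $ a $ l * \<rho> b k) + ginv G a b * (\<rho> a k * G $ b $ l) + G $ k $ l * (ginv G a b * \<rho> a b))
      + \<kappa> * (ginv G a b * (G $ a $ l * G $ b $ k) + ginv G a b * (G $ a $ k * G $ b $ l)
          + G $ k $ l * (ginv G a b * G $ a $ b)))"
    unfolding nabla_C by (intro sum.cong refl) (simp add: algebra_simps)
  also have "\<dots> = - (real CARD('n) * \<rho> k l + R * G $ k $ l) + (\<rho> k l + \<rho> k l + \<rho> k l * real CARD('n))
      - (\<rho> l k + \<rho> l k + G $ k $ l * R) + \<kappa> * (G $ k $ l + G $ l $ k + G $ k $ l * real CARD('n))"
    unfolding sum.distrib sum_subtractf sum_negf sum_distrib_left[symmetric] trace_Q trace_\<rho> contract ..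
  also have "\<dots> = (\<kappa> * (real CARD('n) + 2) - 2 * R) * G $ k $ l"
    by (simp add: \<rho>_sym[of l] symG[of l] algebra_simps)
  also have "\<dots> = 0" by (simp add: \<kappa>_def add_nonneg_eq_0_iff)
  finally show ?thesis .
qed

text \<open>Both sides are trace-free, so it is enough to compare them modulo \<open>G\<close> times covectors. There the
  terms \<open>Q\<close> and \<open>G\<^sub>i\<^sub>l \<rho>\<^sub>j\<^sub>k\<close> agree; the factor \<open>-3\<close> turns the coefficient \<open>-1\<close> of \<open>Q\<close> in \<open>nabla_C\<close> into the one
  prescribed by \<open>1 / 18\<close> times a sum over six permutations.\<close>

theorem structure_equation:
  "- 3 * nabla_C l i j k = (1 / 18) * Pi_ijk G (rhs4 G (\<lambda>i j k. - 3 * C i j k)) i j k l"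
proof -
  define \<kappa>' where "\<kappa>' = 4 * R / (real CARD('n) - 2)"
  have n2: "real CARD('n) - 2 \<noteq> 0" using card by simp
  have rhs: "rhs4 G (\<lambda>i j k. - 3 * C i j k) i j k l
      = 9 * (Q i j k l - \<rho> i l * G $ j $ k + 3 * (G $ i $ l * \<rho> j k) + \<kappa>' * (G $ j $ k * G $ i $ l))" for i j k
  proof -
    have 1: "(\<Sum>a\<in>UNIV. \<Sum>b\<in>UNIV. ginv G a b * (- 3 * C i l b) * (- 3 * C j k a))
        = 9 * (\<Sum>a\<in>UNIV. \<Sum>b\<in>UNIV. ginv G a b * (C i l b * C j k a))"
      by (simp add: sum_distrib_left mult_ac)
    have 2: "(\<Sum>a\<in>UNIV. \<Sum>b\<in>UNIV. \<Sum>c\<in>UNIV. \<Sum>d\<in>UNIV. ginv G a c * ginv G b d * (- 3 * C j c d) * (- 3 * C k a b))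
        = 9 * (\<Sum>a\<in>UNIV. \<Sum>b\<in>UNIV. \<Sum>c\<in>UNIV. \<Sum>d\<in>UNIV. ginv G a c * ginv G b d * C j c d * C k a b)"
      by (simp add: sum_distrib_left mult_ac)
    show ?thesis unfolding rhs4_def 1 2 CC tau \<kappa>'_def using n2 by (simp add: field_simps)
  qed
  \<comment> \<open>\<open>v\<close> collects the terms of the difference that contain the metric with two of the symmetrised indices.\<close>
  define v where "v i = - 36 * \<rho> i l - (54 * \<kappa> + 18 * \<kappa>') * G $ i $ l" for i
  have "trace_free_part_sym3 G (symmetrise3 (\<lambda>a b c. rhs4 G (\<lambda>i j k. - 3 * C i j k) a b c l))
      = (\<lambda>i j k. - 54 * nabla_C l i j k)"
  proof (rule trace_free_part_sym3_eqI[OF invG symG, where v = v])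
    fix k
    have "(\<Sum>a\<in>UNIV. \<Sum>b\<in>UNIV. ginv G a b * (- 54 * nabla_C l a b k))
        = - 54 * (\<Sum>a\<in>UNIV. \<Sum>b\<in>UNIV. ginv G a b * nabla_C l a b k)"
      by (simp add: sum_distrib_left mult_ac)
    then show "(\<Sum>a\<in>UNIV. \<Sum>b\<in>UNIV. ginv G a b * (- 54 * nabla_C l a b k)) = 0"
      by (simp add: trace_nabla_C)
  next
    fix i j k
    have q: "Q i k j l = Q i j k l" "Q j i k l = Q i j k l" "Q j k i l = Q i j k l"
      "Q k i j l = Q i j k l" "Q k j i l = Q i j k l"
      by (metis Q_sym)+
    show "- 54 * nabla_C l i j k = symmetrise3 (\<lambda>a b c. rhs4 G (\<lambda>i j k. - 3 * C i j k) a b c l) i j k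
        + (G $ i $ j * v k + G $ i $ k * v j + G $ j $ k * v i)"
      unfolding symmetrise3_def rhs nabla_C q v_def
      by (simp add: symG[of k j] symG[of k i] symG[of j i] \<rho>_sym[of k j] \<rho>_sym[of k i] \<rho>_sym[of j i] algebra_simps)
  qed
  then show ?thesis by (simp add: Pi_ijk_def)
qed

end

section \<open>The structure equation along a section of the null cone\<close>

abbreviation partial :: "'n \<Rightarrow> (real^'n::finite \<Rightarrow> 'b::real_normed_vector) \<Rightarrow> real^'n \<Rightarrow> 'b" where
  "partial i f x \<equiv> frechet_derivative f (at x) (axis i 1)"

lemma frechet_derivative_eq_on_open:
  assumes "open S" "x \<in> S" "\<And>y. y \<in> S \<Longrightarrow> f y = F y" "(F has_derivative F') (at x)"
  shows "frechet_derivative f (at x) = F'" "(f has_derivative F') (at x)"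
proof -
  show 1: "(f has_derivative F') (at x)"
    by (rule has_derivative_transform_within_open[OF assms(4,1,2)]) (simp add: assms(3))
  show "frechet_derivative f (at x) = F'"
    by (rule frechet_derivative_at[OF 1, symmetric])
qed

lemma smooth_partial: "smooth_on f S \<Longrightarrow> smooth_on (partial i f) S"
  by (rule smooth_on_frechet_derivative)

definition christoffel_coords :: "(real^'n \<Rightarrow> real^'n^'n) \<Rightarrow> real^'n \<Rightarrow> 'n::finite \<Rightarrow> 'n \<Rightarrow> 'n \<Rightarrow> real" where
  "christoffel_coords g x k i j = (1 / 2) * (\<Sum>l\<in>UNIV. ginv (g x) k l *
      (partial i (\<lambda>y. g y $ j $ l) x + partial j (\<lambda>y. g y $ i $ l) x - partial l (\<lambda>y. g y $ i $ j) x))"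

context comm_frobenius
begin

text \<open>The hypotheses of the pointwise identity are derivatives of the relations that say that \<open>\<sigma>\<close> is
  null, has Gram matrix \<open>g\<close> and is normalised by \<open>\<omega>\<close>. The coordinates are arbitrary, so the statement
  applies in every chart.\<close>

theorem cone_section_equation:
  fixes \<sigma> r :: "real^'n \<Rightarrow> 'w" and g :: "real^'n \<Rightarrow> real^'n^'n"
  assumes card: "CARD('n) \<ge> 3" and D: "open D" and \<sigma>: "smooth_on \<sigma> D"
    and r: "\<And>x. x \<in> D \<Longrightarrow> r x \<odot> \<sigma> x = unit"
    and frame: "\<And>x. x \<in> D \<Longrightarrow> \<exists>\<nu>. null_frame (g x) (\<sigma> x) (\<lambda>i. partial i \<sigma> x) \<nu> \<and>
      casimir (g x) (\<sigma> x) (\<lambda>i. partial i \<sigma> x) \<nu> (\<odot>) = \<omega> \<and>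
      (\<forall>w. casimir (g x) (\<sigma> x) (\<lambda>i. partial i \<sigma> x) \<nu> (\<lambda>u v. eps (w \<odot> u) *\<^sub>R v) = w)"
    and \<omega>: "\<And>x k. x \<in> D \<Longrightarrow> eps (\<omega> \<odot> r x \<odot> partial k \<sigma> x) = 0" "eps \<omega> = real CARD('n) + 2"
    and x: "x \<in> D"
  defines "S \<equiv> \<lambda>x i j k. - 3 * eps (r x \<odot> partial i \<sigma> x \<odot> partial j \<sigma> x \<odot> partial k \<sigma> x)"
  shows "smooth_on (\<lambda>x. S x i j k) D"
    and "totally_symmetric (S x)"
    and "trace_free3 (g x) (S x)"
    and "partial l (\<lambda>x. S x i j k) x
      - (\<Sum>m\<in>UNIV. christoffel_coords g x m l i * S x m j k + christoffel_coords g x m l j * S x i m k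
          + christoffel_coords g x m l k * S x i j m)
      = (1 / 18) * Pi_ijk (g x) (rhs4 (g x) (S x)) i j k l"
proof -
  have r': "\<sigma> y \<odot> r y = unit" if "y \<in> D" for y using r[OF that] by (simp add: mul_comm)
  note inv = smooth_on_inverse[where P = "(\<odot>)", OF mul mul_ass unit unit_right D \<sigma> r r']
  have r_sm: "smooth_on r D" by (rule inv(1))
  have sm1: "smooth_on (partial i \<sigma>) D" for i by (rule smooth_partial[OF \<sigma>])
  have S_sm: "smooth_on (\<lambda>x. S x i j k) D" for i j k
    unfolding S_def
    by (intro smooth_on_bounded_linear[OF bounded_linear_mult_right] smooth_on_bounded_linear[OF eps]
        smooth_on_bilinear[OF mul] D r_sm sm1)
  show "smooth_on (\<lambda>x. S x i j k) D" by (rule S_sm)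
  define s1 where "s1 i = partial i \<sigma> x" for i
  define s2 where "s2 i j = partial i (partial j \<sigma>) x" for i j
  have s2_sym: "s2 i j = s2 j i" for i j
    unfolding s2_def by (rule second_derivative_symmetric[OF D \<sigma> x])
  have d\<sigma>: "(\<sigma> has_derivative frechet_derivative \<sigma> (at x)) (at x)"
    by (rule smooth_on_has_derivative[OF \<sigma> x])
  have ds1: "(partial j \<sigma> has_derivative frechet_derivative (partial j \<sigma>) (at x)) (at x)" for j
    by (rule smooth_on_has_derivative[OF sm1 x])
  note dr = inv(2)[OF _ _ x]
  have gG: "g y $ i $ j = eps (partial i \<sigma> y \<odot> partial j \<sigma> y)" if "y \<in> D" for y i j
    using frame[OF that] unfolding null_frame_def by metis
  obtain \<nu> where fr: "null_frame (g x) (\<sigma> x) s1 \<nu>" "casimir (g x) (\<sigma> x) s1 \<nu> (\<odot>) = \<omega>"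
    "\<And>w. casimir (g x) (\<sigma> x) s1 \<nu> (\<lambda>u v. eps (w \<odot> u) *\<^sub>R v) = w"
    using frame[OF x] unfolding s1_def by blast
  have s_s2: "eps (\<sigma> x \<odot> s2 i j) = - g x $ i $ j" for i j
  proof -
    have z: "eps (\<sigma> y \<odot> partial j \<sigma> y) = 0" if "y \<in> D" for y
      using frame[OF that] unfolding null_frame_def by metis
    have "((\<lambda>y. eps (\<sigma> y \<odot> partial j \<sigma> y)) has_derivative
      (\<lambda>h. eps (\<sigma> x \<odot> frechet_derivative (partial j \<sigma>) (at x) h + frechet_derivative \<sigma> (at x) h \<odot> partial j \<sigma> x))) (at x)"
      by (rule bounded_linear.has_derivative[OF eps mul.FDERIV[OF d\<sigma> ds1]])
    from frechet_derivative_eq_on_open(1)[OF D x _ this, of "\<lambda>y. 0"] z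
    have "eps (\<sigma> x \<odot> s2 i j + partial i \<sigma> x \<odot> partial j \<sigma> x) = 0"
      by (simp add: s2_def fun_eq_iff frechet_derivative_const)
    then show ?thesis using gG[OF x] by (simp add: eps.add)
  qed
  have \<omega>_d: "eps (\<omega> \<odot> r x \<odot> r x \<odot> s1 k \<odot> s1 l) = eps (\<omega> \<odot> r x \<odot> s2 k l)" for k l
  proof -
    have 1: "((\<lambda>y. \<omega> \<odot> r y) has_derivative
        (\<lambda>h. \<omega> \<odot> - ((r x \<odot> frechet_derivative \<sigma> (at x) h) \<odot> r x))) (at x)"
      by (rule bounded_linear.has_derivative[OF mul.bounded_linear_right dr]) (simp_all add: r r')
    have "((\<lambda>y. eps (\<omega> \<odot> r y \<odot> partial k \<sigma> y)) has_derivative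
      (\<lambda>h. eps (\<omega> \<odot> r x \<odot> frechet_derivative (partial k \<sigma>) (at x) h
          + (\<omega> \<odot> - ((r x \<odot> frechet_derivative \<sigma> (at x) h) \<odot> r x)) \<odot> partial k \<sigma> x))) (at x)"
      by (rule bounded_linear.has_derivative[OF eps mul.FDERIV[OF 1 ds1]])
    from frechet_derivative_eq_on_open(1)[OF D x _ this, of "\<lambda>y. 0"] \<omega>(1)
    have "eps (\<omega> \<odot> r x \<odot> s2 l k + (\<omega> \<odot> - ((r x \<odot> s1 l) \<odot> r x)) \<odot> s1 k) = 0"
      by (simp add: s2_def s1_def fun_eq_iff frechet_derivative_const)
    then show ?thesis by (simp add: s2_sym[of l k] eps.add eps.diff mul.minus_left mul.minus_right eps.neg mul_ac)
  qed
  have \<omega>_s1: "eps (\<omega> \<odot> r x \<odot> s1 k) = 0" for k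
    unfolding s1_def by (rule \<omega>(1)[OF x])
  interpret cone_point "(\<odot>)" unit eps "g x" "\<sigma> x" "r x" \<nu> \<omega> s1 s2
    by unfold_locales (use card fr r[OF x] s_s2 \<omega>(2) \<omega>_s1 \<omega>_d in simp_all)
  have SC: "S x = (\<lambda>i j k. - 3 * C i j k)"
    by (simp add: S_def C_def s1_def)
  show "totally_symmetric (S x)"
    unfolding SC totally_symmetric_def using C_sym by simp
  have tr: "(\<Sum>a\<in>UNIV. \<Sum>b\<in>UNIV. ginv (g x) a b * (- 3 * C a b k)) = 0" for k
  proof -
    have "(\<Sum>a\<in>UNIV. \<Sum>b\<in>UNIV. ginv (g x) a b * (- 3 * C a b k))
        = - 3 * (\<Sum>a\<in>UNIV. \<Sum>b\<in>UNIV. ginv (g x) a b * C a b k)"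
      by (simp add: sum_distrib_left mult_ac)
    then show ?thesis by (simp add: trace_C)
  qed
  have "C a k b = C a b k" "C k a b = C a b k" for a b k by (metis C_sym)+
  then show "trace_free3 (g x) (S x)"
    unfolding SC trace_free3_def using tr by simp
  have dg: "partial i (\<lambda>y. g y $ j $ l) x = eps (s2 i j \<odot> s1 l) + eps (s2 i l \<odot> s1 j)" for i j l
  proof -
    have "((\<lambda>y. eps (partial j \<sigma> y \<odot> partial l \<sigma> y)) has_derivative
      (\<lambda>h. eps (partial j \<sigma> x \<odot> frechet_derivative (partial l \<sigma>) (at x) h
         + frechet_derivative (partial j \<sigma>) (at x) h \<odot> partial l \<sigma> x))) (at x)"
      by (rule bounded_linear.has_derivative[OF eps mul.FDERIV[OF ds1 ds1]])
    from frechet_derivative_eq_on_open(1)[OF D x _ this, of "\<lambda>y. g y $ j $ l"] gG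
    show ?thesis by (simp add: s1_def s2_def eps.add mul_comm)
  qed
  have Gam: "christoffel_coords g x k i j = \<Gamma> k i j" for k i j
    unfolding christoffel_coords_def \<Gamma>_def dg sum_distrib_left
    by (intro sum.cong refl) (simp add: s2_sym algebra_simps)
  have dS: "partial l (\<lambda>x. S x i j k) x = - 3 * dC l i j k" for l i j k
  proof -
    have dr': "(r has_derivative (\<lambda>h. - ((r x \<odot> frechet_derivative \<sigma> (at x) h) \<odot> r x))) (at x)"
      by (rule dr) (simp_all add: r r')
    have "((\<lambda>y. eps (r y \<odot> partial i \<sigma> y \<odot> partial j \<sigma> y \<odot> partial k \<sigma> y)) has_derivative
      (\<lambda>h. eps (r x \<odot> s1 i \<odot> s1 j \<odot> frechet_derivative (partial k \<sigma>) (at x) h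
         + (r x \<odot> s1 i \<odot> frechet_derivative (partial j \<sigma>) (at x) h
         + (r x \<odot> frechet_derivative (partial i \<sigma>) (at x) h
         + - ((r x \<odot> frechet_derivative \<sigma> (at x) h) \<odot> r x) \<odot> s1 i) \<odot> s1 j) \<odot> s1 k))) (at x)"
      unfolding s1_def
      by (rule bounded_linear.has_derivative[OF eps
            mul.FDERIV[OF mul.FDERIV[OF mul.FDERIV[OF dr' ds1] ds1] ds1]])
    from frechet_derivative_at[OF bounded_linear.has_derivative[OF bounded_linear_mult_right this, of "- 3"]]
    have "partial l (\<lambda>x. S x i j k) x = - 3 * eps (r x \<odot> s1 i \<odot> s1 j \<odot> s2 l k
         + (r x \<odot> s1 i \<odot> s2 l j + (r x \<odot> s2 l i + - ((r x \<odot> s1 l) \<odot> r x) \<odot> s1 i) \<odot> s1 j) \<odot> s1 k)"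
      unfolding S_def s2_def by (simp only: s1_def[of l]) (rule fun_cong, erule sym)
    also have "\<dots> = - 3 * dC l i j k"
      unfolding dC_def
      by (simp add: mul.add_left mul.add_right mul.minus_left mul.minus_right mul.diff_right
          eps.add eps.diff eps.neg mul_ac algebra_simps)
    finally show ?thesis .
  qed
  have "partial l (\<lambda>x. S x i j k) x
      - (\<Sum>m\<in>UNIV. christoffel_coords g x m l i * S x m j k + christoffel_coords g x m l j * S x i m k
          + christoffel_coords g x m l k * S x i j m) = - 3 * nabla_C l i j k"
    unfolding dS Gam SC nabla_C_def
    by (simp add: sum_distrib_left sum_negf[symmetric] algebra_simps)
  then show "partial l (\<lambda>x. S x i j k) x
      - (\<Sum>m\<in>UNIV. christoffel_coords g x m l i * S x m j k + christoffel_coords g x m l j * S x i m k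
          + christoffel_coords g x m l k * S x i j m)
      = (1 / 18) * Pi_ijk (g x) (rhs4 (g x) (S x)) i j k l"
    using structure_equation unfolding SC by simp
qed

text \<open>An inverse near the unit: multiplication by an element close to the unit is injective, hence
  bijective in finite dimension.\<close>

lemma inverse_near_unit: "\<exists>\<delta>>0. \<forall>y. norm (y - unit) < \<delta> \<longrightarrow> (\<exists>z. z \<odot> y = unit)"
proof -
  obtain K where K: "K > 0" "\<And>a b. norm (a \<odot> b) \<le> norm a * norm b * K"
    using mul.pos_bounded by blast
  have "\<exists>z. z \<odot> y = unit" if y: "norm (y - unit) < 1 / K" for y
  proof -
    have lin: "linear (\<lambda>z. z \<odot> y)"
      using mul.bounded_linear_left bounded_linear.linear by blast
    have "z = 0" if "z \<odot> y = 0" for z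
    proof (rule ccontr)
      assume "z \<noteq> 0"
      have "z \<odot> (y - unit) = - z" using that by (simp add: mul.diff_right unit_right)
      then have "norm z \<le> norm z * norm (y - unit) * K" using K(2)[of z "y - unit"] by simp
      also have "\<dots> < norm z * (1 / K) * K"
        using \<open>z \<noteq> 0\<close> y K by (intro mult_strict_right_mono mult_strict_left_mono) auto
      finally show False using K by simp
    qed
    then have "inj (\<lambda>z. z \<odot> y)" using linear_injective_0[OF lin] by blast
    then have "surj (\<lambda>z. z \<odot> y)" by (rule linear_injective_imp_surjective[OF lin]) (rule refl)
    then show ?thesis by (metis surjD)
  qed
  then show ?thesis using K by (intro exI[of _ "1 / K"]) simp
qed

end

section \<open>The null cone of the algebra of a cubic form\<close>

context weyl_free_cubic
begin

lemma mul_bilinear: "bounded_bilinear mul"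
  unfolding bilinear_conv_bounded_bilinear[symmetric] bilinear_def
  by (intro conjI allI linearI)
    (simp_all add: mul_def split_beta b_linear S.add_left S.add_right S.scaleR_left S.scaleR_right
      N.add N.scaleR ip.add_left ip.add_right ip.scaleR_left ip.scaleR_right algebra_simps)

lemma eps_linear: "bounded_linear eps"
  unfolding eps_def[abs_def] by (intro bounded_linear_compose[OF bounded_linear_snd] bounded_linear_snd)

sublocale frob: comm_frobenius mul one eps
  by (rule comm_frobenius.intro[OF mul_bilinear eps_linear mul_commute mul_assoc mul_one])

definition transversal :: "real \<times> 'a \<times> real" where "transversal = (0, 0, 1)"

definition base_casimir :: "(real \<times> 'a \<times> real \<Rightarrow> real \<times> 'a \<times> real \<Rightarrow> real \<times> 'a \<times> real) \<Rightarrow> real \<times> 'a \<times> real" where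
  "base_casimir T = (\<Sum>a\<in>UNIV. T (0, e a, 0) (0, d a, 0)) + T one transversal + T transversal one"

text \<open>The Casimir element; multiplying by it and applying \<open>eps\<close> is the trace of the multiplication map.\<close>

definition euler :: "real \<times> 'a \<times> real" where "euler = base_casimir mul"

text \<open>The section of the null cone over flat coordinates, on which the invariant form restricts to the
  flat metric \<open>ip\<close>.\<close>

definition paraboloid :: "'a \<Rightarrow> real \<times> 'a \<times> real" where
  "paraboloid f = (1, f, - ip f f / 2)"

definition paraboloid_tangent :: "'a \<Rightarrow> 'a \<Rightarrow> real \<times> 'a \<times> real" where
  "paraboloid_tangent f u = (0, u, - ip f u)"

lemma eps_mul: "eps (mul (a, u, p) (c, v, q)) = a * q + c * p + ip u v"
  by (simp add: mul_simp eps_def)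

lemma base_casimir_complete: "base_casimir (\<lambda>u v. eps (mul w u) *\<^sub>R v) = w"
proof -
  obtain \<alpha> u p where w: "w = (\<alpha>, u, p)" by (cases w)
  have "(\<Sum>a\<in>UNIV. ip u (e a) *\<^sub>R (0::real, d a, 0::real)) = (0, u, 0)"
    by (simp add: prod_eq_iff fst_sum snd_sum dual_frame)
  then show ?thesis
    by (simp add: w base_casimir_def eps_mul one_def transversal_def ip.zero_right)
qed

lemma eps_euler: "eps euler = real CARD('i) + 2"
  by (simp add: euler_def base_casimir_def frob.eps.add frob.eps.sum eps_mul one_def transversal_def
      ip.zero_left n_def[symmetric] n_eq)

text \<open>The normalisation holds at the base point to begin with, because \<open>S\<close> is trace-free.\<close>

lemma euler_tangent: "eps (mul euler (0, u, 0)) = 0"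
proof -
  have "fst (snd euler) = 0"
    by (simp add: euler_def base_casimir_def mul_simp one_def transversal_def fst_sum snd_sum S_trace
        N.zero S.zero_left S.zero_right)
  then show ?thesis by (cases euler) (simp add: eps_mul ip.zero_left)
qed

text \<open>The inverse form in the frame of the paraboloid is obtained from the one at the base point by
  moving the frame \<open>f1\<close> to \<open>e\<close>, \<open>d\<close> and cancelling the terms with \<open>transversal\<close>.\<close>

lemma paraboloid_frame:
  fixes g :: "real^'j^'j" and f1 :: "'j::finite \<Rightarrow> 'a"
  assumes g: "invertible g" "\<And>a b. g $ a $ b = ip (f1 a) (f1 b)"
    and span: "\<And>u. (\<Sum>a\<in>UNIV. \<Sum>b\<in>UNIV. (ginv g a b * ip u (f1 a)) *\<^sub>R f1 b) = u"
  shows "frob.null_frame g (paraboloid f) (\<lambda>i. paraboloid_tangent f (f1 i)) transversal"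
    and "bounded_bilinear T \<Longrightarrow>
      frob.casimir g (paraboloid f) (\<lambda>i. paraboloid_tangent f (f1 i)) transversal T = base_casimir T"
proof -
  show "frob.null_frame g (paraboloid f) (\<lambda>i. paraboloid_tangent f (f1 i)) transversal"
    by (simp add: frob.null_frame_def paraboloid_def paraboloid_tangent_def transversal_def eps_mul g
        ip.zero_left ip.zero_right)
  assume T: "bounded_bilinear T"
  interpret T: bounded_bilinear T by (rule T)
  define U where "U u v = T (0, u, - ip f u) (0, v, - ip f v)" for u v
  have tangent: "(0, u, - ip f u) = (0, u, 0) - ip f u *\<^sub>R transversal" for u
    by (simp add: transversal_def)
  have U: "bounded_bilinear U"
  proof -
    have l: "bounded_linear (\<lambda>u. (0::real, u, - ip f u))"
      by (intro bounded_linear_Pair bounded_linear_zero bounded_linear_ident bounded_linear_minus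
          ip.bounded_linear_right)
    show ?thesis unfolding U_def[abs_def] by (rule bounded_bilinear.comp[OF T l l])
  qed
  interpret U: bounded_bilinear U by (rule U)
  have "(\<Sum>a\<in>UNIV. U (e a) (d a)) = (\<Sum>c\<in>UNIV. \<Sum>a\<in>UNIV. \<Sum>b\<in>UNIV. (ginv g a b * ip (d c) (f1 a)) *\<^sub>R U (e c) (f1 b))"
    by (subst (1) span[symmetric]) (simp add: U.sum_right U.scaleR_right)
  also have "\<dots> = (\<Sum>a\<in>UNIV. \<Sum>c\<in>UNIV. \<Sum>b\<in>UNIV. (ginv g a b * ip (d c) (f1 a)) *\<^sub>R U (e c) (f1 b))"
    by (rule sum.swap)
  also have "\<dots> = (\<Sum>a\<in>UNIV. \<Sum>b\<in>UNIV. \<Sum>c\<in>UNIV. (ginv g a b * ip (d c) (f1 a)) *\<^sub>R U (e c) (f1 b))"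
    by (intro sum.cong refl sum.swap)
  also have "\<dots> = (\<Sum>a\<in>UNIV. \<Sum>b\<in>UNIV. ginv g a b *\<^sub>R U (\<Sum>c\<in>UNIV. ip (f1 a) (d c) *\<^sub>R e c) (f1 b))"
    by (simp add: U.sum_left U.scaleR_left scaleR_sum_right ip_comm[of "d _"])
  finally have 1: "(\<Sum>a\<in>UNIV. \<Sum>b\<in>UNIV. ginv g a b *\<^sub>R U (f1 a) (f1 b)) = (\<Sum>a\<in>UNIV. U (e a) (d a))"
    by (simp add: frame)
  have "(\<Sum>a\<in>UNIV. U (e a) (d a)) = (\<Sum>a\<in>UNIV. T (0, e a, 0) (0, d a, 0))
      - (\<Sum>a\<in>UNIV. ip f (e a) *\<^sub>R T transversal (0, d a, 0))
      - (\<Sum>a\<in>UNIV. ip f (d a) *\<^sub>R T (0, e a, 0) transversal)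
      + (\<Sum>a\<in>UNIV. (ip f (e a) * ip f (d a)) *\<^sub>R T transversal transversal)"
    unfolding U_def tangent
    by (simp add: T.diff_left T.diff_right T.scaleR_left T.scaleR_right sum.distrib sum_subtractf algebra_simps)
  also have "\<dots> = (\<Sum>a\<in>UNIV. T (0, e a, 0) (0, d a, 0)) - T transversal (0, f, 0)
      - T (0, f, 0) transversal + ip f f *\<^sub>R T transversal transversal"
  proof -
    have "(\<Sum>a\<in>UNIV. ip f (d a) *\<^sub>R (0::real, e a, 0::real)) = (0, f, 0)"
      "(\<Sum>a\<in>UNIV. ip f (e a) *\<^sub>R (0::real, d a, 0::real)) = (0, f, 0)"
      by (simp_all add: prod_eq_iff fst_sum snd_sum frame dual_frame)
    moreover have "T (\<Sum>a\<in>UNIV. ip f (d a) *\<^sub>R (0, e a, 0)) transversal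
        = (\<Sum>a\<in>UNIV. ip f (d a) *\<^sub>R T (0, e a, 0) transversal)"
      "T transversal (\<Sum>a\<in>UNIV. ip f (e a) *\<^sub>R (0, d a, 0))
        = (\<Sum>a\<in>UNIV. ip f (e a) *\<^sub>R T transversal (0, d a, 0))"
      by (simp_all only: T.sum_left T.sum_right T.scaleR_left T.scaleR_right)
    ultimately have "T (0, f, 0) transversal = (\<Sum>a\<in>UNIV. ip f (d a) *\<^sub>R T (0, e a, 0) transversal)"
      "T transversal (0, f, 0) = (\<Sum>a\<in>UNIV. ip f (e a) *\<^sub>R T transversal (0, d a, 0))"
      by (simp_all only:)
    then show ?thesis by (simp only: scaleR_sum_left[symmetric] parseval)
  qed
  finally have 2: "(\<Sum>a\<in>UNIV. U (e a) (d a)) = \<dots>" .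
  have p: "paraboloid f = one + (0, f, 0) - (ip f f / 2) *\<^sub>R transversal"
    by (simp add: paraboloid_def one_def transversal_def)
  have 3: "T (paraboloid f) transversal + T transversal (paraboloid f)
      = T one transversal + T transversal one + T (0, f, 0) transversal + T transversal (0, f, 0)
        - ip f f *\<^sub>R T transversal transversal"
  proof -
    have "ip f f *\<^sub>R T transversal transversal
        = (ip f f / 2) *\<^sub>R T transversal transversal + (ip f f / 2) *\<^sub>R T transversal transversal"
      by (simp add: scaleR_add_left[symmetric])
    then show ?thesis
      unfolding p T.add_left T.add_right T.diff_left T.diff_right T.scaleR_left T.scaleR_right by simp
  qed
  show "frob.casimir g (paraboloid f) (\<lambda>i. paraboloid_tangent f (f1 i)) transversal T = base_casimir T"
    unfolding frob.casimir_def base_casimir_def paraboloid_tangent_def U_def[symmetric]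
      add.assoc[of _ "T (paraboloid f) transversal"] 1 2 3
    by (simp add: algebra_simps)
qed

end

section \<open>Flat coordinates and the normalised section\<close>

lemma partial_bounded_linear:
  assumes "bounded_linear L" "smooth_on f D" "x \<in> D"
  shows "partial i (\<lambda>y. L (f y)) x = L (partial i f x)"
  using frechet_derivative_at[OF bounded_linear.has_derivative[OF assms(1) smooth_on_has_derivative[OF assms(2,3)]]]
  by (rule fun_cong[OF sym])

lemma partial_vec_nth:
  "smooth_on f D \<Longrightarrow> x \<in> D \<Longrightarrow> partial l (\<lambda>y. f y $ a) x = partial l f x $ a"
  by (rule partial_bounded_linear[OF bounded_linear_vec_nth])

lemma partial_bilinear:
  assumes "bounded_bilinear T" "smooth_on f D" "smooth_on h D" "x \<in> D"
  shows "partial i (\<lambda>y. T (f y) (h y)) x = T (f x) (partial i h x) + T (partial i f x) (h x)"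
  using frechet_derivative_at[OF bounded_bilinear.FDERIV[OF assms(1) smooth_on_has_derivative[OF assms(2,4)]
        smooth_on_has_derivative[OF assms(3,4)]]]
  by (rule fun_cong[OF sym])

lemma linear_eq_sum_axis:
  fixes h :: "real^'n"
  assumes "linear L"
  shows "L h = (\<Sum>a\<in>UNIV. h $ a *\<^sub>R L (axis a 1))"
proof -
  have "h = (\<Sum>a\<in>UNIV. h $ a *\<^sub>R axis a 1)"
    using basis_expansion[of h] by (simp add: scalar_mult_eq_scaleR)
  from arg_cong[OF this, of L] show ?thesis
    by (simp only: linear_sum[OF assms] linear_scale[OF assms])
qed

lemma partial_compose:
  fixes h :: "real^'n \<Rightarrow> 'b::real_normed_vector" and T :: "real^'m \<Rightarrow> real^'n"
  assumes h: "smooth_on h B" and T: "smooth_on T D" and x: "x \<in> D" "T x \<in> B"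
  shows "partial i (\<lambda>y. h (T y)) x = (\<Sum>a\<in>UNIV. partial i T x $ a *\<^sub>R partial a h (T x))"
proof -
  note dh = smooth_on_has_derivative[OF h x(2)]
  have "partial i (\<lambda>y. h (T y)) x = frechet_derivative h (at (T x)) (partial i T x)"
    using frechet_derivative_at[OF has_derivative_compose[OF smooth_on_has_derivative[OF T x(1)] dh]]
    by (rule fun_cong[OF sym])
  also have "\<dots> = (\<Sum>a\<in>UNIV. partial i T x $ a *\<^sub>R partial a h (T x))"
    by (rule linear_eq_sum_axis[OF has_derivative_linear[OF dh]])
  finally show ?thesis .
qed

lemma smooth_on_matrix_inv:
  fixes g :: "real^'n \<Rightarrow> real^'m^'m"
  assumes "open D" "smooth_on g D" "\<And>x. x \<in> D \<Longrightarrow> invertible (g x)"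
  shows "smooth_on (\<lambda>x. matrix_inv (g x)) D"
    and "x \<in> D \<Longrightarrow> partial i (\<lambda>x. matrix_inv (g x)) x
      = - (matrix_inv (g x) ** partial i g x ** matrix_inv (g x))"
proof -
  note inv = smooth_on_inverse[where P = "(**)" and one = "mat 1" and z = "\<lambda>x. matrix_inv (g x)",
      OF bounded_bilinear_matrix_matrix_mult matrix_mul_assoc[symmetric] matrix_mul_lid matrix_mul_rid
        assms(1,2) matrix_inv_mult(2) matrix_inv_mult(1)]
  show "smooth_on (\<lambda>x. matrix_inv (g x)) D" by (rule inv(1)) (rule assms(3), assumption)+
  show "partial i (\<lambda>x. matrix_inv (g x)) x = - (matrix_inv (g x) ** partial i g x ** matrix_inv (g x))"
    if "x \<in> D"
    using frechet_derivative_at[OF inv(2)[OF assms(3) assms(3) that]]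
    by (rule fun_cong[OF sym])
qed

lemma smooth_christoffel_coords:
  assumes D: "open D" and g: "smooth_on g D" "\<And>x. x \<in> D \<Longrightarrow> invertible (g x)"
  shows "smooth_on (\<lambda>x. christoffel_coords g x k i j) D"
  unfolding christoffel_coords_def
  by (intro smooth_on_bounded_linear[OF bounded_linear_mult_right] smooth_on_sum smooth_on_mult
      smooth_on_diff smooth_on_add smooth_partial smooth_on_vec_nth smooth_on_matrix_inv(1) D g)

lemma sum_UNIV_option: "(\<Sum>x\<in>UNIV. f x) = f None + (\<Sum>x\<in>UNIV. f (Some x))"
  for f :: "'n::finite option \<Rightarrow> 'b::comm_monoid_add"
  by (simp add: UNIV_option_conv sum.reindex)

text \<open>A flat metric has coordinates in which it is constant. The unknowns of the linear system are a
  coordinate \<open>f\<close>, at index \<open>None\<close>, and its partial derivatives \<open>w\<close>, which have to satisfy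
  \<open>df = w\<close> and \<open>\<nabla>w = 0\<close>; its curvature vanishes because the connection is symmetric and flat.
  The metric is constant in the frame of the differentials because the connection is metric.\<close>

theorem flat_coordinates:
  fixes g :: "real^'n \<Rightarrow> real^'n^'n"
  assumes D: "open D" "x0 \<in> D" and g: "smooth_on g D"
    and gsym: "\<And>x. x \<in> D \<Longrightarrow> transpose (g x) = g x" and ginv: "\<And>x. x \<in> D \<Longrightarrow> invertible (g x)"
    and flat: "\<And>x r s m v. x \<in> D \<Longrightarrow>
      partial m (\<lambda>y. christoffel_coords g y r v s) x - partial v (\<lambda>y. christoffel_coords g y r m s) x
      + (\<Sum>t\<in>UNIV. christoffel_coords g x r m t * christoffel_coords g x t v s
                  - christoffel_coords g x r v t * christoffel_coords g x t m s) = 0"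
  shows "\<exists>\<rho>>0. ball x0 \<rho> \<subseteq> D \<and> (\<exists>f. smooth_on f (ball x0 \<rho>) \<and> f x0 = 0 \<and>
    (\<forall>i. partial i f x0 = axis i 1) \<and>
    (\<forall>x\<in>ball x0 \<rho>. \<forall>i j. g x $ i $ j = partial i f x \<bullet> (g x0 *v partial j f x)))"
proof -
  let ?\<Gamma> = "christoffel_coords g"
  have gs: "g x $ i $ j = g x $ j $ i" if "x \<in> D" for x i j
    using arg_cong[OF gsym[OF that], of "\<lambda>M. M $ i $ j"] by (simp add: transpose_def)
  have \<Gamma>_sm: "smooth_on (\<lambda>x. ?\<Gamma> x k i j) D" for k i j
    by (rule smooth_christoffel_coords[OF D(1) g ginv])
  have \<Gamma>_sym: "?\<Gamma> x k i j = ?\<Gamma> x k j i" if x: "x \<in> D" for x k i j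
  proof -
    have "partial l (\<lambda>y. g y $ i $ j) x = partial l (\<lambda>y. g y $ j $ i) x" for l
      using frechet_derivative_eq_on_open(1)[OF D(1) x gs[of _ i j]
          smooth_on_has_derivative[OF smooth_on_vec_nth[OF D(1) smooth_on_vec_nth[OF D(1) g]] x]]
      by simp
    then show ?thesis unfolding christoffel_coords_def by (simp add: add.commute)
  qed
  define A :: "'n \<Rightarrow> real^'n \<Rightarrow> real^'n option^'n option" where
    "A l x = (\<chi> I K. case I of None \<Rightarrow> (case K of None \<Rightarrow> 0 | Some k \<Rightarrow> if k = l then 1 else 0)
       | Some i \<Rightarrow> (case K of None \<Rightarrow> 0 | Some k \<Rightarrow> ?\<Gamma> x k l i))" for l x
  have A_sm: "smooth_on (A l) D" for l
  proof -
    have "smooth_on (\<lambda>x. A l x $ I $ K) D" for I K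
      by (cases I; cases K) (use \<Gamma>_sm smooth_on_const[OF D(1)] in \<open>auto simp: A_def\<close>)
    then have "smooth_on (\<lambda>x. \<chi> I. \<chi> K. A l x $ I $ K) D"
      by (intro smooth_on_vec_lambda D(1))
    then show ?thesis by (simp add: vec_lambda_eta)
  qed
  have A_flat: "partial m (A l) x + A l x ** A m x = partial l (A m) x + A m x ** A l x"
    if x: "x \<in> D" for x l m
  proof -
    have pA: "partial m (A l) x $ I $ K = partial m (\<lambda>y. A l y $ I $ K) x" for l m I K
      by (simp add: partial_vec_nth[OF _ x] smooth_on_vec_nth D(1) A_sm)
    have "(partial m (A l) x + A l x ** A m x) $ I $ K = (partial l (A m) x + A m x ** A l x) $ I $ K" for I K
    proof (cases I)
      case None
      then show ?thesis
        by (cases K) (simp_all add: pA A_def matrix_matrix_mult_def sum_UNIV_option frechet_derivative_const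
            \<Gamma>_sym[OF x] if_distrib[of "\<lambda>z. z * _"] cong: if_cong)
    next
      case (Some i)
      show ?thesis
      proof (cases K)
        case None
        then show ?thesis using Some
          by (simp add: pA A_def matrix_matrix_mult_def sum_UNIV_option frechet_derivative_const)
      next
        case K: (Some k)
        have "partial m (\<lambda>y. ?\<Gamma> y k l i) x + (\<Sum>t\<in>UNIV. ?\<Gamma> x k m t * ?\<Gamma> x t l i)
            = partial l (\<lambda>y. ?\<Gamma> y k m i) x + (\<Sum>t\<in>UNIV. ?\<Gamma> x k l t * ?\<Gamma> x t m i)"
          using flat[OF x, where r = k and s = i and m = m and v = l] by (simp add: sum_subtractf)
        then show ?thesis using Some K
          by (simp add: pA A_def matrix_matrix_mult_def sum_UNIV_option mult.commute)
      qed
    qed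
    then show ?thesis by (simp add: vec_eq_iff)
  qed
  from flat_linear_system_solvable[OF D A_sm A_flat] obtain \<rho> where \<rho>: "\<rho> > 0" "ball x0 \<rho> \<subseteq> D"
    "\<forall>v. \<exists>F. F x0 = v \<and> smooth_on F (ball x0 \<rho>) \<and>
      (\<forall>x\<in>ball x0 \<rho>. (F has_derivative (\<lambda>h. \<Sum>l\<in>UNIV. h $ l *\<^sub>R (A l x *v F x))) (at x))"
    by blast
  let ?B = "ball x0 \<rho>"
  from choice[OF \<rho>(3)] obtain F where F0: "\<forall>v. F v x0 = v \<and> smooth_on (F v) ?B \<and>
      (\<forall>x\<in>?B. (F v has_derivative (\<lambda>h. \<Sum>l\<in>UNIV. h $ l *\<^sub>R (A l x *v F v x))) (at x))" ..
  have F: "F v x0 = v" "smooth_on (F v) ?B"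
    "x \<in> ?B \<Longrightarrow> (F v has_derivative (\<lambda>h. \<Sum>l\<in>UNIV. h $ l *\<^sub>R (A l x *v F v x))) (at x)" for v x
    using F0[THEN spec[of _ v]] by blast+
  have x0B: "x0 \<in> ?B" using \<rho>(1) by simp
  have pF: "partial l (F v) x = A l x *v F v x" if "x \<in> ?B" for l v x
  proof -
    have "partial l (F v) x = (\<Sum>l'\<in>UNIV. axis l 1 $ l' *\<^sub>R (A l' x *v F v x))"
      using frechet_derivative_at[OF F(3)[OF that]] by (rule fun_cong[OF sym])
    also have "\<dots> = A l x *v F v x"
      by (simp add: axis_def if_distrib[of "\<lambda>z. z *\<^sub>R _"] cong: if_cong)
    finally show ?thesis .
  qed
  define f where "f x = (\<chi> a. F (axis (Some a) 1) x $ None)" for x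
  define W where "W x = (\<chi> a i. F (axis (Some a) 1) x $ Some i)" for x
  define Gm where "Gm l x = (\<chi> i k. ?\<Gamma> x k l i)" for l x
  have f_sm: "smooth_on f ?B"
    unfolding f_def[abs_def] by (intro smooth_on_vec_lambda smooth_on_vec_nth open_ball F(2))
  have W_sm: "smooth_on W ?B"
    unfolding W_def[abs_def] by (intro smooth_on_vec_lambda smooth_on_vec_nth open_ball F(2))
  have pf: "partial l f x $ a = W x $ a $ l" if x: "x \<in> ?B" for l x a
  proof -
    have "partial l f x $ a = partial l (F (axis (Some a) 1)) x $ None"
      using partial_vec_nth[OF f_sm x, where l = l and a = a] partial_vec_nth[OF F(2) x, where l = l and a = None, of "axis (Some a) 1"]
      by (simp add: f_def)
    then show ?thesis
      by (simp add: pF[OF x] matrix_vector_mult_def A_def W_def sum_UNIV_option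
          if_distrib[of "\<lambda>z. z * _"] cong: if_cong)
  qed
  have pW: "partial l W x = W x ** transpose (Gm l x)" if x: "x \<in> ?B" for l x
  proof -
    have "partial l W x $ a $ i = (W x ** transpose (Gm l x)) $ a $ i" for a i
    proof -
      have "partial l W x $ a $ i = partial l (F (axis (Some a) 1)) x $ Some i"
        using partial_vec_nth[OF smooth_on_vec_nth[OF open_ball W_sm] x, where l = l and a = i, of a] partial_vec_nth[OF W_sm x, where l = l and a = a]
          partial_vec_nth[OF F(2) x, where l = l and a = "Some i", of "axis (Some a) 1"]
        by (simp add: W_def)
      then show ?thesis
        by (simp add: pF[OF x] matrix_vector_mult_def A_def W_def Gm_def sum_UNIV_option
            matrix_matrix_mult_def transpose_def mult.commute)
    qed
    then show ?thesis by (simp add: vec_eq_iff)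
  qed
  have pg: "partial l g x = Gm l x ** g x + g x ** transpose (Gm l x)" if x: "x \<in> D" for l x
  proof -
    let ?d = "\<lambda>l i j. partial l (\<lambda>y. g y $ i $ j) x"
    have d_sym: "?d l i j = ?d l j i" for l i j
      using frechet_derivative_eq_on_open(1)[OF D(1) x gs[of _ i j]
          smooth_on_has_derivative[OF smooth_on_vec_nth[OF D(1) smooth_on_vec_nth[OF D(1) g]] x]]
      by simp
    have low: "(\<Sum>k\<in>UNIV. ?\<Gamma> x k l i * g x $ k $ j) = (?d l i j + ?d i l j - ?d j l i) / 2" for l i j
    proof -
      let ?e = "\<lambda>m. ?d l i m + ?d i l m - ?d m l i"
      have "(\<Sum>k\<in>UNIV. ?\<Gamma> x k l i * g x $ k $ j)
          = (\<Sum>k\<in>UNIV. \<Sum>m\<in>UNIV. (1 / 2) * (g x $ j $ k * ginv (g x) k m * ?e m))"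
        unfolding christoffel_coords_def
        by (simp add: sum_distrib_left sum_distrib_right gs[OF x, of _ j] mult_ac)
      also have "\<dots> = (\<Sum>m\<in>UNIV. (1 / 2) * ((\<Sum>k\<in>UNIV. g x $ j $ k * ginv (g x) k m) * ?e m))"
        by (subst sum.swap) (simp add: sum_distrib_left sum_distrib_right mult_ac)
      also have "\<dots> = ?e j / 2"
        unfolding ginv_mult[OF ginv[OF x]] sum_distrib_left[symmetric] sum_delta_mult by simp
      finally show ?thesis .
    qed
    have "partial l g x $ i $ j = (Gm l x ** g x + g x ** transpose (Gm l x)) $ i $ j" for i j
    proof -
      have "partial l g x $ i $ j = ?d l i j"
        using partial_vec_nth[OF smooth_on_vec_nth[OF D(1) g] x, where l = l and a = j, of i] partial_vec_nth[OF g x, where l = l and a = i] by simp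
      also have "\<dots> = (\<Sum>k\<in>UNIV. ?\<Gamma> x k l i * g x $ k $ j) + (\<Sum>k\<in>UNIV. ?\<Gamma> x k l j * g x $ k $ i)"
        unfolding low using d_sym[where l = l and i = i and j = j] by argo
      finally show ?thesis
        by (simp add: Gm_def matrix_matrix_mult_def transpose_def gs[OF x, of i] mult.commute)
    qed
    then show ?thesis by (simp add: vec_eq_iff)
  qed
  \<comment> \<open>\<open>X\<close> is the inverse metric in the new coordinates.\<close>
  define X where "X x = W x ** matrix_inv (g x) ** transpose (W x)" for x
  note mm = bounded_bilinear_matrix_matrix_mult
  have tr: "bounded_linear (transpose :: real^'n^'n \<Rightarrow> real^'n^'n)"
    by (intro linear_conv_bounded_linear[THEN iffD1] linearI) (simp_all add: transpose_def vec_eq_iff)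
  interpret mm: bounded_bilinear "(**) :: real^'n^'n \<Rightarrow> real^'n^'n \<Rightarrow> real^'n^'n" by (rule mm)
  have gB: "smooth_on g ?B" by (rule smooth_on_subset[OF g \<rho>(2)])
  have gi_sm: "smooth_on (\<lambda>x. matrix_inv (g x)) ?B"
    using smooth_on_matrix_inv(1)[OF open_ball gB] ginv \<rho>(2) by blast
  have Wgi_sm: "smooth_on (\<lambda>x. W x ** matrix_inv (g x)) ?B"
    by (rule smooth_on_bilinear[OF mm open_ball W_sm gi_sm])
  have trW_sm: "smooth_on (\<lambda>x. transpose (W x)) ?B"
    by (rule smooth_on_bounded_linear[OF tr open_ball W_sm])
  have X_sm: "smooth_on X ?B"
    unfolding X_def[abs_def] by (rule smooth_on_bilinear[OF mm open_ball Wgi_sm trW_sm])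
  have pX: "partial l X x = 0" if x: "x \<in> ?B" for l x
  proof -
    have xD: "x \<in> D" using x \<rho>(2) by blast
    let ?i = "matrix_inv (g x)" and ?M = "Gm l x" and ?t = "transpose (Gm l x)"
    have 1: "partial l (\<lambda>x. matrix_inv (g x)) x = - (?i ** (?M ** g x + g x ** ?t) ** ?i)"
      using smooth_on_matrix_inv(2)[OF D(1) g ginv xD, of l] by (simp add: pg[OF xD])
    have 2: "?i ** (?M ** g x + g x ** ?t) ** ?i = ?i ** ?M + ?t ** ?i"
    proof -
      have "?i ** (?M ** g x + g x ** ?t) ** ?i = ?i ** ?M ** (g x ** ?i) + (?i ** g x) ** ?t ** ?i"
        by (simp add: mm.add_left mm.add_right matrix_mul_assoc)
      then show ?thesis by (simp add: matrix_inv_mult[OF ginv[OF xD]])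
    qed
    have 3: "partial l (\<lambda>x. transpose (W x)) x = ?M ** transpose (W x)"
      by (simp add: partial_bounded_linear[OF tr W_sm x] pW[OF x] matrix_transpose_mul)
    have 4: "partial l (\<lambda>x. W x ** matrix_inv (g x)) x = W x ** (- (?i ** ?M + ?t ** ?i)) + W x ** ?t ** ?i"
      using partial_bilinear[OF mm W_sm gi_sm x, of l] unfolding 1 2 pW[OF x] .
    have "partial l X x = W x ** ?i ** (?M ** transpose (W x))
        + (W x ** (- (?i ** ?M + ?t ** ?i)) + W x ** ?t ** ?i) ** transpose (W x)"
      using partial_bilinear[OF mm Wgi_sm trW_sm x, of l] unfolding 3 4 X_def[abs_def] .
    then show ?thesis
      by (simp add: mm.add_left mm.add_right mm.minus_left mm.minus_right mm.diff_left mm.diff_right matrix_mul_assoc)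
  qed
  have "(X has_derivative (\<lambda>h. 0)) (at x within ?B)" if x: "x \<in> ?B" for x
  proof -
    note dX = smooth_on_has_derivative[OF X_sm x]
    have "frechet_derivative X (at x) h = 0" for h
      unfolding linear_eq_sum_axis[OF has_derivative_linear[OF dX], of h] by (simp add: pX[OF x])
    then have "frechet_derivative X (at x) = (\<lambda>h. 0)" by (rule ext)
    with dX show ?thesis by (simp add: has_derivative_at_withinI)
  qed
  from has_derivative_zero_constant[OF convex_ball this] obtain c where c: "\<And>x. x \<in> ?B \<Longrightarrow> X x = c"
    by blast
  have W0: "W x0 = mat 1"
    by (simp add: W_def F(1) vec_eq_iff mat_def axis_def)
  have X0: "X x = matrix_inv (g x0)" if "x \<in> ?B" for x
    using c[OF that] c[OF x0B] by (simp add: X_def W0 transpose_mat)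
  have gW: "g x = transpose (W x) ** g x0 ** W x" if x: "x \<in> ?B" for x
  proof -
    have xD: "x \<in> D" using x \<rho>(2) by blast
    let ?Y = "matrix_inv (g x) ** transpose (W x) ** g x0"
    have "W x ** ?Y = X x ** g x0" by (simp add: X_def matrix_mul_assoc)
    also have "\<dots> = mat 1" by (simp add: X0[OF x] matrix_inv_mult ginv D)
    finally have "?Y ** W x = mat 1" using matrix_left_right_inverse by blast
    then have "g x ** (?Y ** W x) = g x" by simp
    moreover have "g x ** (?Y ** W x) = (g x ** matrix_inv (g x)) ** (transpose (W x) ** g x0 ** W x)"
      by (simp add: matrix_mul_assoc)
    ultimately show ?thesis by (simp add: matrix_inv_mult ginv xD)
  qed
  have "g x $ i $ j = partial i f x \<bullet> (g x0 *v partial j f x)" if x: "x \<in> ?B" for x i j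
  proof -
    have "partial i f x \<bullet> (g x0 *v partial j f x)
        = (\<Sum>a\<in>UNIV. \<Sum>b\<in>UNIV. W x $ a $ i * (g x0 $ a $ b * W x $ b $ j))"
      by (simp add: inner_vec_def matrix_vector_mult_def pf[OF x] sum_distrib_left)
    also have "\<dots> = (\<Sum>b\<in>UNIV. \<Sum>a\<in>UNIV. W x $ a $ i * (g x0 $ a $ b * W x $ b $ j))"
      by (rule sum.swap)
    also have "\<dots> = (transpose (W x) ** g x0 ** W x) $ i $ j"
      by (simp add: matrix_matrix_mult_def transpose_def sum_distrib_right mult.assoc)
    finally show ?thesis using gW[OF x] by simp
  qed
  moreover have "f x0 = 0" by (simp add: f_def F(1) vec_eq_iff axis_def)
  moreover have "partial i f x0 = axis i 1" for i
  proof -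
    have "partial i f x0 $ a = axis i 1 $ a" for a
      unfolding pf[OF x0B] W0 by (simp add: mat_def axis_def)
    then show ?thesis by (simp add: vec_eq_iff)
  qed
  ultimately show ?thesis using \<rho> f_sm by blast
qed

text \<open>A positive function with prescribed closed logarithmic differential.\<close>

lemma exponential_primitive:
  fixes \<theta> :: "'n::finite \<Rightarrow> real^'n \<Rightarrow> real"
  assumes D: "open D" "x0 \<in> D" and \<theta>: "\<And>l. smooth_on (\<theta> l) D"
    and closed: "\<And>x l m. x \<in> D \<Longrightarrow> partial m (\<theta> l) x = partial l (\<theta> m) x"
  shows "\<exists>\<rho>>0. ball x0 \<rho> \<subseteq> D \<and> (\<exists>u. u x0 = 1 \<and> smooth_on u (ball x0 \<rho>) \<and>
    (\<forall>x\<in>ball x0 \<rho>. u x > 0 \<and> (\<forall>l. partial l u x = \<theta> l x * u x)))"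
proof -
  define A :: "'n \<Rightarrow> real^'n \<Rightarrow> real^1^1" where "A l x = \<theta> l x *\<^sub>R mat 1" for l x
  have A_sm: "smooth_on (A l) D" for l
    unfolding A_def[abs_def] by (intro smooth_on_bounded_linear[OF bounded_linear_scaleR_left] D \<theta>)
  have pA: "partial m (A l) x = partial m (\<theta> l) x *\<^sub>R mat 1" if "x \<in> D" for m l x
    unfolding A_def[abs_def] by (rule partial_bounded_linear[OF bounded_linear_scaleR_left \<theta> that])
  have flat: "partial m (A l) x + A l x ** A m x = partial l (A m) x + A m x ** A l x" if "x \<in> D" for x l m
    unfolding pA[OF that] closed[OF that, of m l]
    by (simp add: A_def vec_eq_iff matrix_matrix_mult_def mat_def mult.commute)
  from flat_linear_system_solvable[OF D A_sm flat] obtain \<rho> where \<rho>: "\<rho> > 0" "ball x0 \<rho> \<subseteq> D"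
    "\<forall>v. \<exists>F. F x0 = v \<and> smooth_on F (ball x0 \<rho>) \<and>
      (\<forall>x\<in>ball x0 \<rho>. (F has_derivative (\<lambda>h. \<Sum>l\<in>UNIV. h $ l *\<^sub>R (A l x *v F x))) (at x))"
    by blast
  obtain F where F: "F x0 = (\<chi> i. 1)" "smooth_on F (ball x0 \<rho>)"
    "\<And>x. x \<in> ball x0 \<rho> \<Longrightarrow> (F has_derivative (\<lambda>h. \<Sum>l\<in>UNIV. h $ l *\<^sub>R (A l x *v F x))) (at x)"
    using \<rho>(3) by blast
  define u where "u x = F x $ 1" for x
  have u_sm: "smooth_on u (ball x0 \<rho>)"
    unfolding u_def[abs_def] by (rule smooth_on_vec_nth[OF open_ball F(2)])
  have pu: "partial l u x = \<theta> l x * u x" if x: "x \<in> ball x0 \<rho>" for l x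
  proof -
    have "partial l F x = (\<Sum>l'\<in>UNIV. axis l 1 $ l' *\<^sub>R (A l' x *v F x))"
      using frechet_derivative_at[OF F(3)[OF x]] by (rule fun_cong[OF sym])
    also have "\<dots> = A l x *v F x"
      by (simp add: axis_def if_distrib[of "\<lambda>z. z *\<^sub>R _"] cong: if_cong)
    finally show ?thesis
      using partial_vec_nth[OF F(2) x, where l = l and a = 1]
      by (simp add: u_def[abs_def] A_def scaleR_matrix_vector_assoc[symmetric])
  qed
  have "isCont u x0"
    using continuous_on_eq_continuous_at[OF open_ball, THEN iffD1, OF smooth_on_imp_continuous[OF u_sm]] \<rho>(1)
    by (meson centre_in_ball)
  moreover have u0: "u x0 = 1" by (simp add: u_def F(1))
  ultimately obtain d where d: "d > 0" "\<And>x. dist x x0 < d \<Longrightarrow> dist (u x) (u x0) < 1"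
    unfolding continuous_at_eps_delta by (metis zero_less_one)
  let ?r = "min \<rho> d"
  have "u x > 0" if "x \<in> ball x0 ?r" for x
    using d(2)[of x] that u0 by (simp add: dist_commute dist_real_def)
  moreover have sub: "ball x0 ?r \<subseteq> ball x0 \<rho>" by auto
  ultimately show ?thesis
    using \<rho>(1,2) d(1) u0 smooth_on_subset[OF u_sm sub] pu
    by (intro exI[of _ ?r] conjI exI[of _ u] ballI allI) auto
qed

context comm_frobenius
begin

text \<open>Rescaling by \<open>u\<close> adds \<open>eps \<omega>\<close> times the logarithmic differential of \<open>u\<close> to the closed form
  \<open>eps (\<omega> \<odot> i \<odot> dy)\<close>, where \<open>i\<close> is the inverse of \<open>y\<close>; it is closed because the algebra is
  commutative and associative, so \<open>u\<close> can be chosen to cancel it.\<close>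

lemma normalised_section:
  fixes y :: "real^'n \<Rightarrow> 'w"
  assumes D: "open D" "x0 \<in> D" and y: "smooth_on y D" "y x0 = unit" and \<omega>: "eps \<omega> \<noteq> 0"
  shows "\<exists>\<rho>>0. ball x0 \<rho> \<subseteq> D \<and> (\<exists>u r. u x0 = 1 \<and> smooth_on u (ball x0 \<rho>) \<and>
    (\<forall>k. partial k u x0 = - eps (\<omega> \<odot> partial k y x0) / eps \<omega>) \<and>
    (\<forall>x\<in>ball x0 \<rho>. u x > 0 \<and> r x \<odot> (u x *\<^sub>R y x) = unit \<and>
      (\<forall>k. eps (\<omega> \<odot> r x \<odot> partial k (\<lambda>x. u x *\<^sub>R y x) x) = 0)))"
proof -
  obtain \<delta> where \<delta>: "\<delta> > 0" "\<And>z. norm (z - unit) < \<delta> \<Longrightarrow> \<exists>i. i \<odot> z = unit"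
    using inverse_near_unit by blast
  define D' where "D' = D \<inter> y -` ball unit \<delta>"
  have D': "open D'" "x0 \<in> D'" "D' \<subseteq> D"
    unfolding D'_def using continuous_open_preimage[OF smooth_on_imp_continuous[OF y(1)] D(1) open_ball] D(2) y(2) \<delta>(1)
    by auto
  define i where "i x = (SOME i. i \<odot> y x = unit)" for x
  have iy: "i x \<odot> y x = unit" if "x \<in> D'" for x
  proof -
    have "\<exists>i. i \<odot> y x = unit"
      using that by (intro \<delta>(2)) (simp add: D'_def dist_norm norm_minus_commute)
    then show ?thesis unfolding i_def by (rule someI_ex)
  qed
  then have yi: "y x \<odot> i x = unit" if "x \<in> D'" for x using that mul_comm by simp
  have yD': "smooth_on y D'" by (rule smooth_on_subset[OF y(1) D'(3)])
  note inv = smooth_on_inverse[where P = "(\<odot>)", OF mul mul_ass unit unit_right D'(1) yD' iy yi]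
  have i_sm: "smooth_on i D'" by (rule inv(1))
  have di: "partial l i x = - (i x \<odot> partial l y x \<odot> i x)" if "x \<in> D'" for l x
    using frechet_derivative_at[OF inv(2)[OF _ _ that]] by (rule fun_cong[OF sym])
  have y1: "smooth_on (partial l y) D'" for l by (rule smooth_partial[OF yD'])
  define \<theta> where "\<theta> l x = - eps (\<omega> \<odot> (i x \<odot> partial l y x)) / eps \<omega>" for l x
  have L: "bounded_linear (\<lambda>z. - eps (\<omega> \<odot> z) / eps \<omega>)"
    by (intro bounded_linear_compose[OF bounded_linear_divide] bounded_linear_minus
        bounded_linear_compose[OF eps] mul.bounded_linear_right)
  have iy1: "smooth_on (\<lambda>x. i x \<odot> partial l y x) D'" for l
    by (rule smooth_on_bilinear[OF mul D'(1) i_sm y1])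
  have \<theta>_sm: "smooth_on (\<theta> l) D'" for l
    unfolding \<theta>_def[abs_def] by (rule smooth_on_bounded_linear[OF L D'(1) iy1])
  have closed: "partial m (\<theta> l) x = partial l (\<theta> m) x" if x: "x \<in> D'" for l m x
  proof -
    have "partial m (\<theta> l) x = - eps (\<omega> \<odot> partial m (\<lambda>x. i x \<odot> partial l y x) x) / eps \<omega>" for m l
      unfolding \<theta>_def[abs_def] by (rule partial_bounded_linear[OF L iy1 x])
    moreover have "partial m (\<lambda>x. i x \<odot> partial l y x) x = partial l (\<lambda>x. i x \<odot> partial m y x) x"
      unfolding partial_bilinear[OF mul i_sm y1 x] di[OF x]
      using second_derivative_symmetric[OF D'(1) yD' x, of "axis l 1" "axis m 1"]
      by (simp add: mul.minus_left mul.minus_right mul_ac)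
    ultimately show ?thesis by simp
  qed
  from exponential_primitive[OF D'(1,2) \<theta>_sm closed] obtain \<rho> u where
    \<rho>: "\<rho> > 0" "ball x0 \<rho> \<subseteq> D'" and u: "u x0 = 1" "smooth_on u (ball x0 \<rho>)"
    "\<And>x. x \<in> ball x0 \<rho> \<Longrightarrow> u x > 0" "\<And>x l. x \<in> ball x0 \<rho> \<Longrightarrow> partial l u x = \<theta> l x * u x"
    by blast
  have x0: "x0 \<in> ball x0 \<rho>" using \<rho>(1) by simp
  have i0: "i x0 = unit" using iy[OF D'(2)] by (simp add: y(2) unit_right)
  define r where "r x = (1 / u x) *\<^sub>R i x" for x
  have "r x \<odot> (u x *\<^sub>R y x) = unit \<and> (\<forall>k. eps (\<omega> \<odot> r x \<odot> partial k (\<lambda>x. u x *\<^sub>R y x) x) = 0)"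
    if x: "x \<in> ball x0 \<rho>" for x
  proof (intro conjI allI)
    have xD: "x \<in> D'" using x \<rho>(2) by blast
    have ux: "u x \<noteq> 0" using u(3)[OF x] by simp
    show "r x \<odot> (u x *\<^sub>R y x) = unit"
      using ux by (simp add: r_def mul.scaleR_left mul.scaleR_right iy[OF xD])
    fix k
    have "partial k (\<lambda>x. u x *\<^sub>R y x) x = u x *\<^sub>R partial k y x + partial k u x *\<^sub>R y x"
      by (rule partial_bilinear[OF bounded_bilinear_scaleR u(2) smooth_on_subset[OF yD' \<rho>(2)] x])
    then have "\<omega> \<odot> r x \<odot> partial k (\<lambda>x. u x *\<^sub>R y x) x = \<omega> \<odot> (i x \<odot> partial k y x) + \<theta> k x *\<^sub>R (\<omega> \<odot> (i x \<odot> y x))"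
      using ux by (simp add: r_def u(4)[OF x] mul.add_right mul.scaleR_left mul.scaleR_right mul_ass)
    then show "eps (\<omega> \<odot> r x \<odot> partial k (\<lambda>x. u x *\<^sub>R y x) x) = 0"
      using \<omega> by (simp add: eps.add eps.diff eps.scaleR iy[OF xD] unit_right \<theta>_def)
  qed
  moreover have "partial k u x0 = - eps (\<omega> \<odot> partial k y x0) / eps \<omega>" for k
    by (simp add: u(4)[OF x0] u(1) \<theta>_def i0 unit)
  ultimately show ?thesis
    using \<rho> D'(3) u by (intro exI[of _ \<rho>] conjI exI[of _ u] exI[of _ r]) auto
qed

end

section \<open>The algebra of a trace-free cubic form with the quadratic condition\<close>

text \<open>The quadratic expression is antisymmetric in \<open>j, k\<close> and in \<open>i, l\<close> and symmetric under exchange of the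
  pairs. Averaging the six pure trace terms over these symmetries leaves one symmetric tensor.\<close>

lemma pure_trace_quadratic_condition:
  fixes G :: "real^'n^'n"
  assumes G: "invertible G" "\<And>i j. G $ i $ j = G $ j $ i"
    and C: "totally_symmetric C" and pt: "pure_trace4 G (quadratic_condition4 G C)"
  shows "\<exists>N. (\<forall>i j. N i j = N j i) \<and> (\<forall>i j k l. quadratic_condition4 G C i j k l
    = - (G $ i $ j * N k l + G $ k $ l * N i j - G $ i $ k * N j l - G $ j $ l * N i k))"
proof -
  let ?Q = "quadratic_condition4 G C"
  have Cs: "C i j k = C j i k" "C i j k = C i k j" for i j k
    using C unfolding totally_symmetric_def by metis+
  define q where "q i j k l = (\<Sum>a\<in>UNIV. \<Sum>b\<in>UNIV. ginv G a b * (C b i j * C k l a))" for i j k l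
  have Qq: "?Q i j k l = q i j k l - q i k j l" for i j k l
    by (simp add: quadratic_condition4_def q_def sum_subtractf[symmetric] right_diff_distrib)
  have q1: "q i j k l = q j i k l" "q i j k l = q i j l k" for i j k l
    unfolding q_def by (intro sum.cong refl; metis Cs)+
  have q2: "q i j k l = q k l i j" for i j k l
    unfolding q_def
    by (subst sum.swap) (intro sum.cong refl, metis (no_types) Cs ginv_symmetric[OF G] mult.commute)
  have q3: "q l j k i = q i k j l" for i j k l
    using q2[of l j k i] q1(1)[of k i l j] q1(2)[of i k l j] by simp
  obtain H1 H2 H3 H4 H5 H6 where H: "\<And>i j k l. ?Q i j k l = G $ i $ j * H1 k l + G $ i $ k * H2 j l
      + G $ i $ l * H3 j k + G $ j $ k * H4 i l + G $ j $ l * H5 i k + G $ k $ l * H6 i j"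
    using pt unfolding pure_trace4_def by blast
  define M where "M k l = H1 k l - H2 k l - H5 l k + H6 l k" for k l
  define N where "N k l = - (M k l + M l k) / 8" for k l
  have "?Q i j k l = - (G $ i $ j * N k l + G $ k $ l * N i j - G $ i $ k * N j l - G $ j $ l * N i k)" for i j k l
  proof -
    have "4 * ?Q i j k l = G $ i $ j * M k l + G $ k $ l * M j i - G $ i $ k * M j l - G $ j $ l * M k i" for i j k l
    proof -
      have "?Q i k j l = - ?Q i j k l" by (simp add: Qq)
      moreover have "?Q l j k i = - ?Q i j k l"
        unfolding Qq q3[of l] by simp
      moreover have "?Q l k j i = ?Q i j k l"
        unfolding Qq q3[of l] by simp
      ultimately have "4 * ?Q i j k l = ?Q i j k l - ?Q i k j l - ?Q l j k i + ?Q l k j i" by simp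
      also have "\<dots> = G $ i $ j * M k l + G $ k $ l * M j i - G $ i $ k * M j l - G $ j $ l * M k i"
        unfolding H M_def
        by (simp add: G(2)[of l i] G(2)[of k j] G(2)[of l j] G(2)[of l k] G(2)[of j i] G(2)[of k i] algebra_simps)
      finally show ?thesis .
    qed
    note this[of i j k l] this[of j i l k]
    moreover have "?Q j i l k = ?Q i j k l"
      unfolding Qq using q1(1)[of j i l k] q1(2)[of i j l k] q2[of j l i k] q1 by simp
    ultimately show ?thesis
      unfolding N_def by (simp add: G(2)[of l k] G(2)[of j i] field_simps)
  qed
  moreover have "N i j = N j i" for i j by (simp add: N_def add.commute)
  ultimately show ?thesis by blast
qed

lemma linear_zero_if_zero_on_axis:
  "linear L \<Longrightarrow> (\<And>i. L (axis i 1) = 0) \<Longrightarrow> L u = 0" for u :: "real^'n"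
  by (subst linear_eq_sum_axis) simp_all

lemma sum_axis: "(\<Sum>i\<in>UNIV. axis a 1 $ i * f i) = (f a :: real)" for a :: "'n::finite"
  by (simp add: axis_def if_distrib[of "\<lambda>z. z * _"] cong: if_cong)

text \<open>The operators \<open>S\<close> and \<open>N\<close> are the given tensors with one index raised. The commutator relation is
  linear in four vectors, and on coordinate vectors it is the previous lemma.\<close>

lemma weyl_free_cubic_exists:
  fixes G :: "real^'n^'n" and C :: "'n \<Rightarrow> 'n \<Rightarrow> 'n \<Rightarrow> real"
  assumes card: "CARD('n) \<ge> 3" and inv: "invertible G" and sym: "\<And>i j. G $ i $ j = G $ j $ i"
    and C: "totally_symmetric C" and tf: "trace_free3 G C"
    and pt: "pure_trace4 G (quadratic_condition4 G C)"
  shows "\<exists>S N. weyl_free_cubic (\<lambda>u v. u \<bullet> (G *v v)) (\<lambda>a. axis a 1) (\<lambda>a. matrix_inv G *v axis a 1) S N \<and>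
    (\<forall>i j k. S (axis i 1) (axis j 1) \<bullet> (G *v axis k 1) = C i j k)"
proof -
  define ip where "ip u v = u \<bullet> (G *v v)" for u v :: "real^'n"
  define e :: "'n \<Rightarrow> real^'n" where "e a = axis a 1" for a
  define d where "d a = matrix_inv G *v axis a 1" for a
  have Cs: "C i j k = C j i k" "C i j k = C i k j" for i j k
    using C unfolding totally_symmetric_def by metis+
  have tG: "transpose G = G" using sym by (simp add: transpose_def vec_eq_iff)
  have ip_comm: "ip u v = ip v u" for u v
    unfolding ip_def using dot_lmul_matrix[of v G u] by (simp add: transpose_matrix_vector[symmetric] tG inner_commute)
  have ip_inv: "ip u (matrix_inv G *v z) = u \<bullet> z" for u z
    by (simp add: ip_def matrix_vector_mul_assoc matrix_inv_mult[OF inv])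
  have ip_e: "ip u (e a) = (G *v u) $ a" for u a
    unfolding ip_comm[of u] by (simp add: ip_def e_def inner_axis')
  have ip_ee: "ip (e a) (e b) = G $ a $ b" for a b
    unfolding ip_e unfolding e_def by (simp add: matrix_vector_mult_def axis_def sym[of b] if_distrib cong: if_cong)
  have exp: "v = (\<Sum>a\<in>UNIV. v $ a *\<^sub>R axis a 1)" for v :: "real^'n"
    using basis_expansion[of v] by (simp add: scalar_mult_eq_scaleR)
  have frame_d: "framed_space ip e d"
  proof (rule framed_space.intro)
    show "bounded_bilinear ip"
      unfolding ip_def[abs_def]
      by (rule bounded_bilinear.comp[OF bounded_bilinear_inner bounded_linear_ident matrix_vector_mul_bounded_linear])
    show "ip u v = ip v u" for u v by (rule ip_comm)
    show "(\<Sum>a\<in>UNIV. ip u (d a) *\<^sub>R e a) = u" for u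
      unfolding d_def ip_inv e_def by (simp add: inner_axis exp[symmetric])
    show "(\<Sum>a\<in>UNIV. ip u (e a) *\<^sub>R d a) = u" for u
    proof -
      have "(\<Sum>a\<in>UNIV. ip u (e a) *\<^sub>R d a) = matrix_inv G *v (\<Sum>a\<in>UNIV. (G *v u) $ a *\<^sub>R axis a 1)"
        by (simp add: ip_e d_def linear_sum[OF matrix_vector_mul_linear] matrix_vector_mult_scaleR)
      then show ?thesis
        by (simp add: exp[symmetric] matrix_vector_mul_assoc matrix_inv_mult[OF inv])
    qed
    show "ip (e a) (d b) = (if a = b then 1 else 0)" for a b
      unfolding d_def ip_inv by (simp add: e_def inner_axis_axis)
  qed
  interpret framed_space ip e d by (rule frame_d)
  have d_eq: "d a = (\<Sum>b\<in>UNIV. ginv G a b *\<^sub>R e b)" for a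
    unfolding d_def e_def
    by (subst exp) (simp add: matrix_vector_mult_def axis_def if_distrib ginv_symmetric[OF inv sym, of _ a] cong: if_cong)
  obtain Nc where Nc: "\<And>i j. Nc i j = Nc j i" "\<And>i j k l. quadratic_condition4 G C i j k l
    = - (G $ i $ j * Nc k l + G $ k $ l * Nc i j - G $ i $ k * Nc j l - G $ j $ l * Nc i k)"
    using pure_trace_quadratic_condition[OF inv sym C pt] by blast
  define S where "S u v = (\<Sum>i\<in>UNIV. \<Sum>j\<in>UNIV. \<Sum>k\<in>UNIV. (u $ i * v $ j * C i j k) *\<^sub>R d k)" for u v
  define N where "N u = (\<Sum>i\<in>UNIV. \<Sum>k\<in>UNIV. (u $ i * Nc i k) *\<^sub>R d k)" for u
  have ip_d: "ip (d k) w = w $ k" for k w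
    unfolding ip_comm[of _ w] d_def ip_inv by (simp add: inner_axis)
  have S_ip: "ip (S u v) w = (\<Sum>i\<in>UNIV. \<Sum>j\<in>UNIV. \<Sum>k\<in>UNIV. u $ i * v $ j * w $ k * C i j k)" for u v w
    by (simp add: S_def ip.sum_left ip.scaleR_left ip_d mult_ac)
  have N_ip: "ip (N u) w = (\<Sum>i\<in>UNIV. \<Sum>k\<in>UNIV. u $ i * w $ k * Nc i k)" for u w
    by (simp add: N_def ip.sum_left ip.scaleR_left ip_d mult_ac)
  have S_ax: "ip (S (e i) (e j)) (e k) = C i j k" for i j k
  proof -
    have "ip (S (e i) (e j)) (e k)
        = (\<Sum>i'\<in>UNIV. e i $ i' * (\<Sum>j'\<in>UNIV. e j $ j' * (\<Sum>k'\<in>UNIV. e k $ k' * C i' j' k')))"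
      by (simp add: S_ip sum_distrib_left mult.assoc)
    then show ?thesis by (simp only: e_def sum_axis)
  qed
  have N_ax: "ip (N (e i)) (e j) = Nc i j" for i j
  proof -
    have "ip (N (e i)) (e j) = (\<Sum>i'\<in>UNIV. e i $ i' * (\<Sum>j'\<in>UNIV. e j $ j' * Nc i' j'))"
      by (simp add: N_ip sum_distrib_left mult.assoc)
    then show ?thesis by (simp only: e_def sum_axis)
  qed
  have S_comm: "S u v = S v u" for u v
    unfolding S_def by (subst sum.swap) (intro sum.cong refl, simp add: Cs(1) mult.commute)
  have S_bb: "bounded_bilinear S"
    unfolding bilinear_conv_bounded_bilinear[symmetric] bilinear_def S_def
    by (intro conjI allI linearI) (simp_all add: sum.distrib scaleR_sum_right algebra_simps)
  interpret S: bounded_bilinear S by (rule S_bb)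
  have N_bl: "bounded_linear N"
    unfolding linear_conv_bounded_linear[symmetric] N_def
    by (intro linearI) (simp_all add: sum.distrib scaleR_sum_right algebra_simps)
  interpret N: bounded_linear N by (rule N_bl)
  have S_adj: "ip (S u v) w = ip v (S u w)" for u v w
    unfolding ip_comm[of v] S_ip
    by (rule sum.cong[OF refl], subst sum.swap) (intro sum.cong refl, simp add: Cs(2) mult_ac)
  have N_adj: "ip (N u) v = ip u (N v)" for u v
    unfolding ip_comm[of u] N_ip by (subst sum.swap) (intro sum.cong refl, simp add: Nc(1) mult_ac)
  have S_trace: "(\<Sum>a\<in>UNIV. S (e a) (d a)) = 0"
  proof (rule nondegenerate)
    fix w
    have ax: "ip (\<Sum>a\<in>UNIV. S (e a) (d a)) (e k) = 0" for k
    proof -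
      have "ip (\<Sum>a\<in>UNIV. S (e a) (d a)) (e k) = (\<Sum>a\<in>UNIV. \<Sum>b\<in>UNIV. ginv G a b * C a b k)"
        by (simp add: d_eq S.sum_right S.scaleR_right ip.sum_left ip.scaleR_left S_ax)
      then show ?thesis using tf unfolding trace_free3_def by simp
    qed
    have "linear (ip (\<Sum>a\<in>UNIV. S (e a) (d a)))"
      by (intro linearI) (simp_all add: ip.add_right ip.scaleR_right)
    from linear_zero_if_zero_on_axis[OF this, of w] ax
    show "ip (\<Sum>a\<in>UNIV. S (e a) (d a)) w = ip 0 w" by (simp add: e_def ip.zero_left)
  qed
  have SS: "ip (S (e j) (e i)) (S (e k) (e l)) = (\<Sum>a\<in>UNIV. \<Sum>b\<in>UNIV. ginv G a b * (C b i j * C k l a))" for i j k l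
  proof -
    have "ip (S (e j) (e i)) (S (e k) (e l)) = (\<Sum>a\<in>UNIV. ip (S (e k) (e l)) (e a) * ip (S (e j) (e i)) (d a))"
      unfolding parseval by (rule ip_comm)
    also have "\<dots> = (\<Sum>a\<in>UNIV. C k l a * (\<Sum>b\<in>UNIV. ginv G a b * C j i b))"
      by (simp add: S_ax d_eq ip.sum_right ip.scaleR_right)
    also have "\<dots> = (\<Sum>a\<in>UNIV. \<Sum>b\<in>UNIV. ginv G a b * (C b i j * C k l a))"
      unfolding sum_distrib_left
      by (intro sum.cong refl) (metis (no_types) Cs mult.commute mult.left_commute)
    finally show ?thesis .
  qed
  define P where "P u v w z = ip (S v w) (S u z) - ip (S u w) (S v z)
    - (ip u w * ip (N v) z - ip v w * ip (N u) z + ip (N u) w * ip v z - ip (N v) w * ip u z)" for u v w z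
  have P4: "P (e k) (e j) (e i) (e l) = 0" for i j k l
    using Nc(2)[of i j k l] unfolding P_def SS N_ax ip_ee
    by (simp add: quadratic_condition4_def sum_subtractf[symmetric] right_diff_distrib Nc(1) sym[of k i]
        sym[of j i] sym[of l] algebra_simps)
  have "linear (P u v w)" "linear (\<lambda>w. P u v w z)" "linear (\<lambda>v. P u v w z)" "linear (\<lambda>u. P u v w z)" for u v w z
    unfolding P_def
    by (intro linearI; simp add: ip.add_left ip.add_right ip.scaleR_left ip.scaleR_right S.add_left S.add_right
        S.scaleR_left S.scaleR_right N.add N.scaleR algebra_simps)+
  note lin = linear_zero_if_zero_on_axis[OF this(1)] linear_zero_if_zero_on_axis[OF this(2)]
    linear_zero_if_zero_on_axis[OF this(3)] linear_zero_if_zero_on_axis[OF this(4)]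
  have P0: "P u v w z = 0" for u v w z
    by (rule lin(4), rule lin(3), rule lin(2), rule lin(1)) (rule P4[unfolded e_def])
  have "weyl_free_cubic ip e d S N"
  proof (rule weyl_free_cubic.intro[OF frame_d weyl_free_cubic_axioms.intro])
    show "S u (S v w) - S v (S u w) = ip u w *\<^sub>R N v - ip v w *\<^sub>R N u + ip (N u) w *\<^sub>R v - ip (N v) w *\<^sub>R u"
      for u v w
    proof (rule nondegenerate)
      fix z
      show "ip (S u (S v w) - S v (S u w)) z
        = ip (ip u w *\<^sub>R N v - ip v w *\<^sub>R N u + ip (N u) w *\<^sub>R v - ip (N v) w *\<^sub>R u) z"
        using P0[of u v w z] unfolding P_def
        by (simp add: ip.add_left ip.diff_left ip.scaleR_left S_adj[of u "S v w"] S_adj[of v "S u w"])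
    qed
  qed (fact card S_comm S_adj S_trace N_adj S_bb N_bl)+
  moreover have "S (axis i 1) (axis j 1) \<bullet> (G *v axis k 1) = C i j k" for i j k
    using S_ax[of i j k] by (simp add: ip_def e_def)
  ultimately show ?thesis
    unfolding ip_def[abs_def] e_def[abs_def] d_def[abs_def] by blast
qed

section \<open>Charts\<close>

lemma pd_eq_partial: "pd \<phi> l f p = partial l (\<lambda>x. f (chart_inv \<phi> x)) (coord \<phi> p)"
  by (simp add: pd_def o_def)

lemma jacobian_eq_partial:
  assumes "smooth_on (\<lambda>x. coord \<phi> (chart_inv \<psi> x)) D" "coord \<psi> p \<in> D"
  shows "jacobian \<phi> \<psi> p a i = partial i (\<lambda>x. coord \<phi> (chart_inv \<psi> x)) (coord \<psi> p) $ a"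
  unfolding jacobian_def pd_eq_partial by (rule partial_vec_nth[OF assms])

context
  fixes A :: "('m::topological_space, 'n::finite) chart set"
  assumes atlas: "smooth_atlas A"
begin

lemma chart_inv_coord: "\<phi> \<in> A \<Longrightarrow> p \<in> dom_chart \<phi> \<Longrightarrow> chart_inv \<phi> (coord \<phi> p) = p"
  using atlas unfolding smooth_atlas_def by (metis homeomorphism_apply1)

lemma chart_imageD:
  assumes "\<phi> \<in> A" "x \<in> coord \<phi> ` (dom_chart \<phi> \<inter> U)"
  shows "chart_inv \<phi> x \<in> dom_chart \<phi>" "chart_inv \<phi> x \<in> U" "coord \<phi> (chart_inv \<phi> x) = x"
  using assms(2) chart_inv_coord[OF assms(1)] by auto

lemma open_chart_image:
  assumes "\<phi> \<in> A" "open U"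
  shows "open (coord \<phi> ` (dom_chart \<phi> \<inter> U))"
proof -
  have h: "homeomorphism (dom_chart \<phi>) (coord \<phi> ` dom_chart \<phi>) (coord \<phi>) (chart_inv \<phi>)"
    and o: "open (coord \<phi> ` dom_chart \<phi>)"
    using atlas assms(1) unfolding smooth_atlas_def by auto
  have "openin (top_of_set (dom_chart \<phi>)) (dom_chart \<phi> \<inter> U)"
    using assms(2) by (simp add: openin_open_Int)
  from homeomorphism_imp_open_map[OF h this] show ?thesis
    by (rule openin_open_trans[OF _ o])
qed

lemma smooth_transition:
  "\<phi> \<in> A \<Longrightarrow> \<psi> \<in> A \<Longrightarrow>
    smooth_on (\<lambda>x. coord \<phi> (chart_inv \<psi> x)) (coord \<psi> ` (dom_chart \<psi> \<inter> dom_chart \<phi>))"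
  using atlas unfolding smooth_atlas_def o_def by auto

lemma open_dom_chart: "\<phi> \<in> A \<Longrightarrow> open (dom_chart \<phi>)"
  using atlas unfolding smooth_atlas_def by auto

lemma partial_change_chart:
  fixes h :: "'m \<Rightarrow> 'b::real_normed_vector"
  assumes \<psi>: "\<psi> \<in> A" "\<psi>' \<in> A" and U: "open U"
    and h: "smooth_on (\<lambda>x. h (chart_inv \<psi> x)) (coord \<psi> ` (dom_chart \<psi> \<inter> U))"
    and p: "p \<in> U" "p \<in> dom_chart \<psi>" "p \<in> dom_chart \<psi>'"
  shows "partial i (\<lambda>x. h (chart_inv \<psi>' x)) (coord \<psi>' p)
    = (\<Sum>a\<in>UNIV. jacobian \<psi> \<psi>' p a i *\<^sub>R partial a (\<lambda>x. h (chart_inv \<psi> x)) (coord \<psi> p))"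
proof -
  let ?T = "\<lambda>x. coord \<psi> (chart_inv \<psi>' x)"
  let ?E = "coord \<psi>' ` (dom_chart \<psi>' \<inter> (dom_chart \<psi> \<inter> U))"
  have E: "open ?E" by (rule open_chart_image[OF \<psi>(2) open_Int[OF open_dom_chart[OF \<psi>(1)] U]])
  have pE: "coord \<psi>' p \<in> ?E" using p by blast
  have T: "smooth_on ?T ?E"
    by (rule smooth_on_subset[OF smooth_transition[OF \<psi>]]) blast
  have Tp: "?T (coord \<psi>' p) = coord \<psi> p" by (simp add: chart_inv_coord[OF \<psi>(2) p(3)])
  have TpU: "?T (coord \<psi>' p) \<in> coord \<psi> ` (dom_chart \<psi> \<inter> U)" unfolding Tp using p by blast
  have eq: "h (chart_inv \<psi>' x) = h (chart_inv \<psi> (?T x))" if "x \<in> ?E" for x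
    using chart_imageD[OF \<psi>(2) that] chart_inv_coord[OF \<psi>(1)] by simp
  have hT: "smooth_on (\<lambda>x. h (chart_inv \<psi> (?T x))) ?E"
  proof (rule smooth_on_compose[OF h T E open_chart_image[OF \<psi>(1) U]])
    show "?T ` ?E \<subseteq> coord \<psi> ` (dom_chart \<psi> \<inter> U)"
      using chart_imageD[OF \<psi>(2)] by blast
  qed
  have "partial i (\<lambda>x. h (chart_inv \<psi>' x)) (coord \<psi>' p)
      = partial i (\<lambda>x. h (chart_inv \<psi> (?T x))) (coord \<psi>' p)"
    using frechet_derivative_eq_on_open(1)[OF E pE eq smooth_on_has_derivative[OF hT pE]] by (rule fun_cong)
  also have "\<dots> = (\<Sum>a\<in>UNIV. partial i ?T (coord \<psi>' p) $ a *\<^sub>R partial a (\<lambda>x. h (chart_inv \<psi> x)) (?T (coord \<psi>' p)))"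
    by (rule partial_compose[OF h T pE TpU])
  finally show ?thesis
    by (simp only: Tp jacobian_eq_partial[OF T pE])
qed

lemma christoffel_eq_coords:
  assumes "\<phi> \<in> A" "p \<in> dom_chart \<phi>"
  shows "christoffel g \<phi> p k i j = christoffel_coords (\<lambda>x. g \<phi> (chart_inv \<phi> x)) (coord \<phi> p) k i j"
  unfolding christoffel_def christoffel_coords_def pd_eq_partial chart_inv_coord[OF assms] ..

lemma flat_metric_coords:
  assumes \<phi>: "\<phi> \<in> A" and U: "open U" and flat: "flat_metric A U g"
    and x: "x \<in> coord \<phi> ` (dom_chart \<phi> \<inter> U)"
  defines "g' \<equiv> \<lambda>x. g \<phi> (chart_inv \<phi> x)"
  shows "partial m (\<lambda>y. christoffel_coords g' y r v s) x - partial v (\<lambda>y. christoffel_coords g' y r m s) x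
      + (\<Sum>t\<in>UNIV. christoffel_coords g' x r m t * christoffel_coords g' x t v s
                  - christoffel_coords g' x r v t * christoffel_coords g' x t m s) = 0"
proof -
  let ?D = "coord \<phi> ` (dom_chart \<phi> \<inter> U)"
  note D = open_chart_image[OF \<phi> U]
  have met: "is_metric A U g" using flat unfolding flat_metric_def by blast
  have sm: "smooth_on g' ?D"
    using met \<phi> unfolding is_metric_def smooth_in_chart_def o_def g'_def by blast
  have inv: "invertible (g' y)" if "y \<in> ?D" for y
    using met \<phi> chart_imageD[OF \<phi> that] unfolding is_metric_def g'_def by blast
  have eq: "christoffel g \<phi> (chart_inv \<phi> y) k i j = christoffel_coords g' y k i j" if "y \<in> ?D" for y k i j
    using christoffel_eq_coords[OF \<phi> chart_imageD(1)[OF \<phi> that], of g k i j] chart_imageD(3)[OF \<phi> that]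
    by (simp add: g'_def)
  have p: "partial l (\<lambda>y. christoffel g \<phi> (chart_inv \<phi> y) k i j) x = partial l (\<lambda>y. christoffel_coords g' y k i j) x"
    for l k i j
    using frechet_derivative_eq_on_open(1)[OF D x eq
        smooth_on_has_derivative[OF smooth_christoffel_coords[OF D sm inv] x]]
    by (rule fun_cong)
  have "riemann g \<phi> (chart_inv \<phi> x) r s m v = 0"
    using flat \<phi> chart_imageD[OF \<phi> x] unfolding flat_metric_def by blast
  then show ?thesis
    unfolding riemann_def pd_eq_partial chart_imageD(3)[OF \<phi> x] p eq[OF x] .
qed

end

lemma local_member_scale:
  assumes c: "conformal_class A c" and g0: "g\<^sub>0 \<in> c" and g: "local_member A c U g" and p: "p \<in> U"
  shows "\<exists>s>0. \<forall>\<psi>\<in>A. p \<in> dom_chart \<psi> \<longrightarrow> g \<psi> p = s *\<^sub>R g\<^sub>0 \<psi> p"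
proof -
  obtain h where h: "h \<in> c" "conformal_on A U h g" using g unfolding local_member_def by blast
  obtain b where b: "c = {g'. is_metric A UNIV g' \<and> conformal_on A UNIV b g'}"
    using c unfolding conformal_class_def by blast
  have "conformal_on A UNIV b g\<^sub>0" using g0 unfolding b by blast
  then obtain \<Omega>0 where "\<forall>p\<in>UNIV. \<Omega>0 p > 0"
    "\<forall>\<psi>\<in>A. \<forall>p\<in>UNIV \<inter> dom_chart \<psi>. g\<^sub>0 \<psi> p = \<Omega>0 p *\<^sub>R b \<psi> p"
    unfolding conformal_on_def by blast
  then have 0: "\<Omega>0 p > 0" "\<And>\<psi>. \<psi> \<in> A \<Longrightarrow> p \<in> dom_chart \<psi> \<Longrightarrow> g\<^sub>0 \<psi> p = \<Omega>0 p *\<^sub>R b \<psi> p"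
    using p by blast+
  have "conformal_on A UNIV b h" using h(1) unfolding b by blast
  then obtain \<Omega>1 where "\<forall>p\<in>UNIV. \<Omega>1 p > 0"
    "\<forall>\<psi>\<in>A. \<forall>p\<in>UNIV \<inter> dom_chart \<psi>. h \<psi> p = \<Omega>1 p *\<^sub>R b \<psi> p"
    unfolding conformal_on_def by blast
  then have 1: "\<Omega>1 p > 0" "\<And>\<psi>. \<psi> \<in> A \<Longrightarrow> p \<in> dom_chart \<psi> \<Longrightarrow> h \<psi> p = \<Omega>1 p *\<^sub>R b \<psi> p"
    using p by blast+
  have "conformal_on A U h g" using h(2) .
  then obtain \<Omega>2 where "\<forall>p\<in>U. \<Omega>2 p > 0"
    "\<forall>\<psi>\<in>A. \<forall>p\<in>U \<inter> dom_chart \<psi>. g \<psi> p = \<Omega>2 p *\<^sub>R h \<psi> p"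
    unfolding conformal_on_def by blast
  then have 2: "\<Omega>2 p > 0" "\<And>\<psi>. \<psi> \<in> A \<Longrightarrow> p \<in> dom_chart \<psi> \<Longrightarrow> g \<psi> p = \<Omega>2 p *\<^sub>R h \<psi> p"
    using p by blast+
  show ?thesis
    using 0 1 2 by (intro exI[of _ "\<Omega>2 p * \<Omega>1 p / \<Omega>0 p"]) simp
qed

lemma trace_free3_scale:
  fixes G :: "real^'n^'n"
  assumes "invertible G" "s \<noteq> 0"
  shows "trace_free3 (s *\<^sub>R G) T \<longleftrightarrow> trace_free3 G T"
  using assms(2)
  by (simp add: trace_free3_def ginv_scale(2)[OF assms] sum_divide_distrib[symmetric])

lemma pure_trace_quadratic_scale:
  fixes G :: "real^'n^'n"
  assumes G: "invertible G" "s \<noteq> 0" and pt: "pure_trace4 G (quadratic_condition4 G P)"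
  shows "pure_trace4 (s *\<^sub>R G) (quadratic_condition4 (s *\<^sub>R G) (\<lambda>i j k. r * P i j k))"
proof -
  obtain H1 H2 H3 H4 H5 H6 where H: "\<And>i j k l. quadratic_condition4 G P i j k l
      = G $ i $ j * H1 k l + G $ i $ k * H2 j l + G $ i $ l * H3 j k + G $ j $ k * H4 i l
        + G $ j $ l * H5 i k + G $ k $ l * H6 i j"
    using pt unfolding pure_trace4_def by blast
  have "quadratic_condition4 (s *\<^sub>R G) (\<lambda>i j k. r * P i j k) i j k l
      = (r\<^sup>2 / s) * quadratic_condition4 G P i j k l" for i j k l
    by (simp add: quadratic_condition4_def ginv_scale(2)[OF G] sum_distrib_left power2_eq_square algebra_simps)
  then have "quadratic_condition4 (s *\<^sub>R G) (\<lambda>i j k. r * P i j k) i j k l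
      = (s *\<^sub>R G) $ i $ j * (r\<^sup>2 / s\<^sup>2 * H1 k l) + (s *\<^sub>R G) $ i $ k * (r\<^sup>2 / s\<^sup>2 * H2 j l)
        + (s *\<^sub>R G) $ i $ l * (r\<^sup>2 / s\<^sup>2 * H3 j k) + (s *\<^sub>R G) $ j $ k * (r\<^sup>2 / s\<^sup>2 * H4 i l)
        + (s *\<^sub>R G) $ j $ l * (r\<^sup>2 / s\<^sup>2 * H5 i k) + (s *\<^sub>R G) $ k $ l * (r\<^sup>2 / s\<^sup>2 * H6 i j)" for i j k l
    unfolding H using G(2) by (simp add: power2_eq_square field_simps)
  note eq = this
  show ?thesis unfolding pure_trace4_def
    by (rule exI[of _ "\<lambda>k l. r\<^sup>2 / s\<^sup>2 * H1 k l"], rule exI[of _ "\<lambda>k l. r\<^sup>2 / s\<^sup>2 * H2 k l"],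
        rule exI[of _ "\<lambda>k l. r\<^sup>2 / s\<^sup>2 * H3 k l"], rule exI[of _ "\<lambda>k l. r\<^sup>2 / s\<^sup>2 * H4 k l"],
        rule exI[of _ "\<lambda>k l. r\<^sup>2 / s\<^sup>2 * H5 k l"], rule exI[of _ "\<lambda>k l. r\<^sup>2 / s\<^sup>2 * H6 k l"])
      (intro allI eq)
qed

context weyl_free_cubic
begin

lemma smooth_on_paraboloid:
  assumes D: "open D" and f: "smooth_on f D"
  shows "smooth_on (\<lambda>x. paraboloid (f x)) D"
proof -
  have "bounded_linear (\<lambda>v. (0::real, v, 0::real))" for v :: 'a
    by (intro bounded_linear_Pair bounded_linear_zero bounded_linear_ident)
  then have "smooth_on (\<lambda>x. one + (0, f x, 0) + (- 1 / 2 * ip (f x) (f x)) *\<^sub>R transversal) D"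
    by (intro smooth_on_add smooth_on_const D smooth_on_bounded_linear[OF bounded_linear_scaleR_left]
        smooth_on_bounded_linear[OF bounded_linear_mult_right] smooth_on_bilinear[OF ip] f
        smooth_on_bounded_linear[of "\<lambda>v. (0::real, v, 0::real)"])
  moreover have "one + (0, f x, 0) + (- 1 / 2 * ip (f x) (f x)) *\<^sub>R transversal = paraboloid (f x)" for x
    by (simp add: one_def transversal_def paraboloid_def)
  ultimately show ?thesis by simp
qed

lemma partial_paraboloid:
  assumes "smooth_on f D" "x \<in> D"
  shows "partial i (\<lambda>x. paraboloid (f x)) x = paraboloid_tangent (f x) (partial i f x)"
proof -
  note df = smooth_on_has_derivative[OF assms]
  have "((\<lambda>x. - ip (f x) (f x) / 2) has_derivative
      (\<lambda>h. - ip (f x) (frechet_derivative f (at x) h))) (at x)"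
  proof -
    have "((\<lambda>x. (- 1 / 2) * ip (f x) (f x)) has_derivative (\<lambda>h. (- 1 / 2) *
        (ip (f x) (frechet_derivative f (at x) h) + ip (frechet_derivative f (at x) h) (f x)))) (at x)"
      by (rule bounded_linear.has_derivative[OF bounded_linear_mult_right ip.FDERIV[OF df df]])
    then show ?thesis by (simp add: ip_comm[of _ "f x"])
  qed
  from has_derivative_Pair[OF has_derivative_const has_derivative_Pair[OF df this], of 1]
  have "((\<lambda>x. paraboloid (f x)) has_derivative
      (\<lambda>h. (0, frechet_derivative f (at x) h, - ip (f x) (frechet_derivative f (at x) h)))) (at x)"
    by (simp add: paraboloid_def)
  from fun_cong[OF frechet_derivative_at[OF this]] show ?thesis
    by (simp add: paraboloid_tangent_def)
qed

end

text \<open>Vectors with Gram matrix \<open>F\<^sup>T G F\<close> invertible form a basis, written here as completeness.\<close>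

lemma gram_basis_complete:
  fixes G g :: "real^'n^'n" and f1 :: "'n \<Rightarrow> real^'n"
  assumes G: "\<And>i j. G $ i $ j = G $ j $ i" and g: "invertible g" "\<And>a b. g $ a $ b = f1 a \<bullet> (G *v f1 b)"
  shows "(\<Sum>a\<in>UNIV. \<Sum>b\<in>UNIV. (ginv g a b * (u \<bullet> (G *v f1 a))) *\<^sub>R f1 b) = u"
proof -
  define F :: "real^'n^'n" where "F = (\<chi> c a. f1 a $ c)"
  have col: "F *v axis a 1 = f1 a" for a
    by (simp add: F_def vec_eq_iff matrix_vector_mult_def mult.commute[of _ "axis _ _ $ _"] sum_axis)
  have "g = transpose F ** G ** F"
  proof -
    have "(transpose F ** G ** F) $ a $ b = f1 a \<bullet> (G *v f1 b)" for a b
    proof -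
      have "f1 a \<bullet> (G *v f1 b) = (\<Sum>c\<in>UNIV. \<Sum>d\<in>UNIV. F $ c $ a * (G $ c $ d * F $ d $ b))"
        by (simp add: inner_vec_def matrix_vector_mult_def F_def sum_distrib_left)
      also have "\<dots> = (\<Sum>d\<in>UNIV. \<Sum>c\<in>UNIV. F $ c $ a * (G $ c $ d * F $ d $ b))"
        by (rule sum.swap)
      also have "\<dots> = (transpose F ** G ** F) $ a $ b"
        by (simp add: matrix_matrix_mult_def transpose_def sum_distrib_right mult.assoc)
      finally show ?thesis by simp
    qed
    then show ?thesis by (simp add: vec_eq_iff g(2))
  qed
  then have "(matrix_inv g ** transpose F ** G) ** F = mat 1"
    using matrix_inv_mult(2)[OF g(1)] by (simp add: matrix_mul_assoc)
  then have "F ** (matrix_inv g ** transpose F ** G) = mat 1"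
    using matrix_left_right_inverse by blast
  then have "u = F *v (matrix_inv g *v (transpose F *v (G *v u)))"
    by (simp add: matrix_vector_mul_assoc matrix_mul_assoc)
  also have "transpose F *v (G *v u) = (\<chi> a. u \<bullet> (G *v f1 a))"
  proof -
    have "(transpose F *v (G *v u)) $ a = f1 a \<bullet> (G *v u)" for a
      by (simp add: matrix_vector_mult_def transpose_def F_def inner_vec_def)
    moreover have "f1 a \<bullet> (G *v u) = u \<bullet> (G *v f1 a)" for a
    proof -
      have "transpose G = G" using G by (simp add: transpose_def vec_eq_iff)
      then show ?thesis using dot_lmul_matrix[of u G "f1 a"]
        by (metis inner_commute transpose_matrix_vector)
    qed
    ultimately show ?thesis by (simp add: vec_eq_iff)
  qed
  also have "F *v (matrix_inv g *v (\<chi> a. u \<bullet> (G *v f1 a)))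
      = (\<Sum>b\<in>UNIV. \<Sum>a\<in>UNIV. (ginv g b a * (u \<bullet> (G *v f1 a))) *\<^sub>R f1 b)"
    by (subst linear_eq_sum_axis[OF matrix_vector_mul_linear])
      (simp add: col matrix_vector_mult_def[of "matrix_inv g"] scaleR_sum_left)
  also have "\<dots> = (\<Sum>a\<in>UNIV. \<Sum>b\<in>UNIV. (ginv g a b * (u \<bullet> (G *v f1 a))) *\<^sub>R f1 b)"
  proof -
    have gs: "g $ a $ b = g $ b $ a" for a b
    proof -
      have "transpose G = G" using G by (simp add: transpose_def vec_eq_iff)
      then show ?thesis unfolding g(2) using dot_lmul_matrix[of "f1 b" G "f1 a"]
        by (metis inner_commute transpose_matrix_vector)
    qed
    show ?thesis
      by (subst sum.swap) (simp only: ginv_symmetric[OF g(1) gs, of _ "_"])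
  qed
  finally show ?thesis by simp
qed

section \<open>Extension of the tensor\<close>

theorem corollary6p2:
  fixes A :: "('m::{t2_space, second_countable_topology}, 'n::finite) chart set"
    and c :: "('m, 'n) metric_field set"
    and g\<^sub>0 :: "('m, 'n) metric_field"
    and x\<^sub>0 :: 'm
    and \<Psi> :: "('m, 'n) tensor3"
  assumes "CARD('n) \<ge> 3"
    and "smooth_atlas A"
    and "conformal_class A c"
    and "conformally_flat A c"
    and "g\<^sub>0 \<in> c"
    and "is_tensor3_at A x\<^sub>0 \<Psi>"
    and "\<And>\<phi>. \<phi> \<in> A \<Longrightarrow> x\<^sub>0 \<in> dom_chart \<phi> \<Longrightarrow>
           totally_symmetric (\<Psi> \<phi>) \<and> trace_free3 (g\<^sub>0 \<phi> x\<^sub>0) (\<Psi> \<phi>)"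
    and "\<And>\<phi>. \<phi> \<in> A \<Longrightarrow> x\<^sub>0 \<in> dom_chart \<phi> \<Longrightarrow>
           is_trace_free_part4 (g\<^sub>0 \<phi> x\<^sub>0) (quadratic_condition4 (g\<^sub>0 \<phi> x\<^sub>0) (\<Psi> \<phi>)) (\<lambda>i j k l. 0)"
  shows "\<exists>U S. open U \<and> x\<^sub>0 \<in> U \<and> is_tensor_field3 A U S \<and>
     (\<forall>\<phi>\<in>A. \<forall>p\<in>U \<inter> dom_chart \<phi>.
        totally_symmetric (S \<phi> p) \<and> trace_free3 (g\<^sub>0 \<phi> p) (S \<phi> p)) \<and>
     (\<forall>\<phi>\<in>A. x\<^sub>0 \<in> dom_chart \<phi> \<longrightarrow> S \<phi> x\<^sub>0 = \<Psi> \<phi>) \<and>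
     (\<exists>g. local_member A c U g \<and>
        (\<forall>\<phi>\<in>A. \<forall>p\<in>U \<inter> dom_chart \<phi>. \<forall>i j k l.
           cov_deriv3 g S \<phi> p l i j k = (1/18) * Pi_ijk (g \<phi> p) (rhs4 (g \<phi> p) (S \<phi> p)) i j k l))"
proof -
  have card: "CARD('n) \<ge> 3" and atlas: "smooth_atlas A" and cc: "conformal_class A c"
    by (fact assms)+
  obtain \<phi> where \<phi>: "\<phi> \<in> A" "x\<^sub>0 \<in> dom_chart \<phi>"
    using atlas unfolding smooth_atlas_def by blast
  obtain U1 g' where U1: "open U1" "x\<^sub>0 \<in> U1" and lm: "local_member A c U1 g'" and flat: "flat_metric A U1 g'"
    using assms(4) unfolding conformally_flat_def by blast
  note img_open = open_chart_image[OF atlas] and img = chart_imageD[OF atlas]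
    and inv_coord = chart_inv_coord[OF atlas]
  have met: "is_metric A U1 g'" using lm unfolding local_member_def by blast
  have met_sym: "transpose (g' \<psi> p) = g' \<psi> p" and met_inv: "invertible (g' \<psi> p)"
    if "\<psi> \<in> A" "p \<in> U1" "p \<in> dom_chart \<psi>" for \<psi> p
    using met that unfolding is_metric_def by blast+

  define D where "D = coord \<phi> ` (dom_chart \<phi> \<inter> U1)"
  define gc where "gc x = g' \<phi> (chart_inv \<phi> x)" for x
  let ?x = "coord \<phi> x\<^sub>0"
  have D: "open D" "?x \<in> D" unfolding D_def using img_open[OF \<phi>(1) U1(1)] \<phi> U1 by auto
  have Dp: "chart_inv \<phi> x \<in> dom_chart \<phi>" "chart_inv \<phi> x \<in> U1" "coord \<phi> (chart_inv \<phi> x) = x" if "x \<in> D" for x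
    using img[OF \<phi>(1)] that unfolding D_def by blast+
  have gc_sm: "smooth_on gc D"
    using met \<phi>(1) unfolding is_metric_def smooth_in_chart_def o_def gc_def[abs_def] D_def by blast
  have gc_sym: "transpose (gc x) = gc x" and gc_inv: "invertible (gc x)" if "x \<in> D" for x
    unfolding gc_def using met_sym[OF \<phi>(1)] met_inv[OF \<phi>(1)] Dp[OF that] by blast+
  have gc_flat: "partial m (\<lambda>y. christoffel_coords gc y r v s) x - partial v (\<lambda>y. christoffel_coords gc y r m s) x
      + (\<Sum>t\<in>UNIV. christoffel_coords gc x r m t * christoffel_coords gc x t v s
                  - christoffel_coords gc x r v t * christoffel_coords gc x t m s) = 0" if "x \<in> D" for x r s m v
    using flat_metric_coords[OF atlas \<phi>(1) U1(1) flat that[unfolded D_def]] unfolding gc_def[abs_def] .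
  obtain \<rho>1 f where \<rho>1: "\<rho>1 > 0" "ball ?x \<rho>1 \<subseteq> D" and f: "smooth_on f (ball ?x \<rho>1)" "f ?x = 0"
    "\<And>i. partial i f ?x = axis i 1"
    "\<And>x i j. x \<in> ball ?x \<rho>1 \<Longrightarrow> gc x $ i $ j = partial i f x \<bullet> (gc ?x *v partial j f x)"
    using flat_coordinates[OF D gc_sm gc_sym gc_inv gc_flat] by blast

  \<comment> \<open>The factor \<open>- 1 / 3\<close> is undone by the factor \<open>- 3\<close> in the definition of \<open>S\<close> below. Passing from \<open>g\<^sub>0\<close>
    to the flat metric \<open>g'\<close> rescales \<open>G\<close>, under which the conditions on \<open>\<Psi>\<close> are invariant.\<close>
  define G where "G = g' \<phi> x\<^sub>0"
  have G_gc: "gc ?x = G" by (simp add: gc_def G_def inv_coord[OF \<phi>])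
  have G_inv: "invertible G" unfolding G_def by (rule met_inv[OF \<phi>(1) U1(2) \<phi>(2)])
  have G_sym: "G $ i $ j = G $ j $ i" for i j
    using arg_cong[OF met_sym[OF \<phi>(1) U1(2) \<phi>(2)], of "\<lambda>M. M $ i $ j"] by (simp add: transpose_def G_def)
  define C where "C i j k = (- 1 / 3) * \<Psi> \<phi> i j k" for i j k
  obtain s where s: "s > 0" "G = s *\<^sub>R g\<^sub>0 \<phi> x\<^sub>0"
    using local_member_scale[OF cc assms(5) lm U1(2)] \<phi> unfolding G_def by blast
  have g0_inv: "invertible (g\<^sub>0 \<phi> x\<^sub>0)"
  proof -
    have "g\<^sub>0 \<phi> x\<^sub>0 = (1 / s) *\<^sub>R G" using s by simp
    then show ?thesis using ginv_scale(1)[OF G_inv, of "1 / s"] s(1) by simp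
  qed
  have s0: "s \<noteq> 0" using s(1) by simp
  have C_sym: "totally_symmetric C"
    using assms(7)[OF \<phi>] unfolding totally_symmetric_def C_def by metis
  have C_tf: "trace_free3 G C"
  proof -
    have "trace_free3 G (\<Psi> \<phi>)"
      using assms(7)[OF \<phi>] unfolding s(2) trace_free3_scale[OF g0_inv s0] by blast
    then show ?thesis
      unfolding trace_free3_def C_def by (simp add: sum_divide_distrib[symmetric] sum_negf)
  qed
  have C_pt: "pure_trace4 G (quadratic_condition4 G C)"
  proof -
    have "pure_trace4 (g\<^sub>0 \<phi> x\<^sub>0) (quadratic_condition4 (g\<^sub>0 \<phi> x\<^sub>0) (\<Psi> \<phi>))"
      using assms(8)[OF \<phi>] unfolding is_trace_free_part4_def by simp
    from pure_trace_quadratic_scale[OF g0_inv s0 this, of "- 1 / 3"]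
    show ?thesis unfolding s(2)[symmetric] C_def[abs_def] .
  qed
  define ip where "ip u v = u \<bullet> (G *v v)" for u v
  define e :: "'n \<Rightarrow> real^'n" where "e a = axis a 1" for a
  define d where "d a = matrix_inv G *v axis a 1" for a
  obtain S0 N where wfc: "weyl_free_cubic ip e d S0 N" and S0: "\<And>i j k. ip (S0 (e i) (e j)) (e k) = C i j k"
    using weyl_free_cubic_exists[OF card G_inv G_sym C_sym C_tf C_pt]
    unfolding ip_def[abs_def] e_def[abs_def] d_def[abs_def] by blast
  interpret V: weyl_free_cubic ip e d S0 N by (rule wfc)

  define y where "y x = V.paraboloid (f x)" for x
  let ?B1 = "ball ?x \<rho>1"
  have y_sm: "smooth_on y ?B1"
    unfolding y_def[abs_def] by (rule V.smooth_on_paraboloid[OF open_ball f(1)])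
  have y0: "y ?x = V.one"
    by (simp add: y_def f(2) V.paraboloid_def V.one_def V.ip.zero_right)
  have eul: "V.eps V.euler \<noteq> 0" unfolding V.eps_euler by (simp add: add_nonneg_eq_0_iff)
  have xB1: "?x \<in> ?B1" using \<rho>1(1) by simp
  obtain \<rho> u r where \<rho>: "\<rho> > 0" "ball ?x \<rho> \<subseteq> ?B1" and u: "u ?x = 1" "smooth_on u (ball ?x \<rho>)"
    "\<And>k. partial k u ?x = - V.eps (V.mul V.euler (partial k y ?x)) / V.eps V.euler"
    "\<And>x. x \<in> ball ?x \<rho> \<Longrightarrow> u x > 0"
    and r: "\<And>x. x \<in> ball ?x \<rho> \<Longrightarrow> V.mul (r x) (u x *\<^sub>R y x) = V.one"
    "\<And>x k. x \<in> ball ?x \<rho> \<Longrightarrow> V.eps (V.mul (V.mul V.euler (r x)) (partial k (\<lambda>x. u x *\<^sub>R y x) x)) = 0"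
    using V.frob.normalised_section[OF open_ball xB1 y_sm y0 eul] by blast
  let ?B = "ball ?x \<rho>"
  have xB: "?x \<in> ?B" using \<rho>(1) by simp
  define \<sigma> where "\<sigma> x = u x *\<^sub>R y x" for x
  have f_B: "smooth_on f ?B" and y_B: "smooth_on y ?B"
    by (rule smooth_on_subset[OF _ \<rho>(2)]; fact)+
  have \<sigma>_B: "smooth_on \<sigma> ?B"
    unfolding \<sigma>_def[abs_def] by (rule smooth_on_scaleR[OF open_ball u(2) y_B])

  define U where "U = dom_chart \<phi> \<inter> coord \<phi> -` ?B"
  have U: "open U" "x\<^sub>0 \<in> U" "U \<subseteq> U1" "U \<subseteq> dom_chart \<phi>"
  proof -
    have "homeomorphism (dom_chart \<phi>) (coord \<phi> ` dom_chart \<phi>) (coord \<phi>) (chart_inv \<phi>)"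
      using atlas \<phi>(1) unfolding smooth_atlas_def by blast
    then have "continuous_on (dom_chart \<phi>) (coord \<phi>)" by (rule homeomorphism_cont1)
    then show "open U"
      unfolding U_def using continuous_open_preimage open_dom_chart[OF atlas \<phi>(1)] open_ball by blast
    show "x\<^sub>0 \<in> U" using \<phi>(2) xB by (simp add: U_def)
    show "U \<subseteq> U1"
    proof
      fix p assume p: "p \<in> U"
      then have "coord \<phi> p \<in> D" using \<rho>(2) \<rho>1(2) by (auto simp: U_def)
      then show "p \<in> U1" using Dp(2) inv_coord[OF \<phi>(1)] p by (force simp: U_def)
    qed
    show "U \<subseteq> dom_chart \<phi>" by (auto simp: U_def)
  qed

  \<comment> \<open>The section is a map on \<open>U\<close>, so in another chart \<open>\<psi>\<close> it is \<open>\<sigma>\<close> composed with the transition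
    map \<open>T \<psi>\<close>. The tensor is defined in each chart from the partial derivatives of this composition, and
    its transformation law is the chain rule.\<close>
  define I where "I \<psi> = coord \<psi> ` (dom_chart \<psi> \<inter> U)" for \<psi> :: "('m, 'n) chart"
  define T where "T \<psi> x = coord \<phi> (chart_inv \<psi> x)" for \<psi> :: "('m, 'n) chart" and x
  have I_open: "open (I \<psi>)" if "\<psi> \<in> A" for \<psi>
    unfolding I_def by (rule img_open[OF that U(1)])
  have I: "chart_inv \<psi> x \<in> dom_chart \<psi>" "chart_inv \<psi> x \<in> U" "coord \<psi> (chart_inv \<psi> x) = x"
    "T \<psi> x \<in> ?B" if "\<psi> \<in> A" "x \<in> I \<psi>" for \<psi> x
    using img[OF that(1) that(2)[unfolded I_def]] by (auto simp: T_def U_def)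
  have T_sm: "smooth_on (T \<psi>) (I \<psi>)" if "\<psi> \<in> A" for \<psi>
    unfolding T_def[abs_def] I_def
    by (rule smooth_on_subset[OF smooth_transition[OF atlas \<phi>(1) that]]) (use U(4) in blast)
  have TB: "T \<psi> ` I \<psi> \<subseteq> ?B" if "\<psi> \<in> A" for \<psi> using I(4)[OF that] by blast
  have comp_sm: "smooth_on (\<lambda>x. h (T \<psi> x)) (I \<psi>)" if "\<psi> \<in> A" "smooth_on h ?B"
    for \<psi> and h :: "real^'n \<Rightarrow> 'z::real_normed_vector"
    by (rule smooth_on_compose[OF that(2) T_sm[OF that(1)] I_open[OF that(1)] open_ball TB[OF that(1)]])
  have comp_pd: "partial i (\<lambda>x. h (T \<psi> x)) x = (\<Sum>a\<in>UNIV. partial i (T \<psi>) x $ a *\<^sub>R partial a h (T \<psi> x))"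
    if "\<psi> \<in> A" "smooth_on h ?B" "x \<in> I \<psi>" for \<psi> i x and h :: "real^'n \<Rightarrow> 'z::real_normed_vector"
    by (rule partial_compose[OF that(2) T_sm[OF that(1)] that(3) I(4)[OF that(1,3)]])

  have g'_eq: "g' \<psi> (chart_inv \<psi> x) $ i $ j
      = ip (partial i (\<lambda>x. f (T \<psi> x)) x) (partial j (\<lambda>x. f (T \<psi> x)) x)"
    if \<psi>: "\<psi> \<in> A" and x: "x \<in> I \<psi>" for \<psi> x i j
  proof -
    let ?p = "chart_inv \<psi> x"
    have p: "?p \<in> U1 \<inter> dom_chart \<phi> \<inter> dom_chart \<psi>" using I[OF \<psi> x] U by blast
    have J: "jacobian \<phi> \<psi> ?p a i = partial i (T \<psi>) x $ a" for a i
      using jacobian_eq_partial[of \<phi> \<psi> "I \<psi>" ?p a i] T_sm[OF \<psi>] x I(3)[OF \<psi> x] by (simp add: T_def[abs_def])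
    have gT: "g' \<phi> ?p $ a $ b = ip (partial a f (T \<psi> x)) (partial b f (T \<psi> x))" for a b
    proof -
      have "gc (T \<psi> x) = g' \<phi> ?p" using p by (simp add: gc_def T_def inv_coord[OF \<phi>(1)])
      then show ?thesis using f(4)[of "T \<psi> x" a b] I(4)[OF \<psi> x] \<rho>(2) by (auto simp: G_gc ip_def)
    qed
    have "g' \<psi> ?p $ i $ j = (\<Sum>a\<in>UNIV. \<Sum>b\<in>UNIV. jacobian \<phi> \<psi> ?p a i * jacobian \<phi> \<psi> ?p b j * g' \<phi> ?p $ a $ b)"
      using met \<phi>(1) \<psi> p unfolding is_metric_def by blast
    also have "\<dots> = ip (\<Sum>a\<in>UNIV. partial i (T \<psi>) x $ a *\<^sub>R partial a f (T \<psi> x))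
        (\<Sum>b\<in>UNIV. partial j (T \<psi>) x $ b *\<^sub>R partial b f (T \<psi> x))"
      unfolding J gT V.ip.sum_left V.ip.scaleR_left unfolding V.ip.sum_right V.ip.scaleR_right
      by (simp add: mult.assoc sum_distrib_left)
    finally show ?thesis by (simp only: comp_pd[OF \<psi> f_B x])
  qed

  define gn where "gn \<psi> p = (u (coord \<phi> p))\<^sup>2 *\<^sub>R g' \<psi> p" for \<psi> p
  define S where "S \<psi> p i j k = - 3 * V.eps (V.mul (V.mul (V.mul (r (coord \<phi> p))
      (partial i (\<lambda>x. \<sigma> (T \<psi> x)) (coord \<psi> p))) (partial j (\<lambda>x. \<sigma> (T \<psi> x)) (coord \<psi> p)))
      (partial k (\<lambda>x. \<sigma> (T \<psi> x)) (coord \<psi> p)))" for \<psi> p i j k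

  have frame: "\<exists>\<nu>. V.frob.null_frame (gn \<psi> (chart_inv \<psi> x)) (\<sigma> (T \<psi> x)) (\<lambda>i. partial i (\<lambda>x. \<sigma> (T \<psi> x)) x) \<nu> \<and>
      V.frob.casimir (gn \<psi> (chart_inv \<psi> x)) (\<sigma> (T \<psi> x)) (\<lambda>i. partial i (\<lambda>x. \<sigma> (T \<psi> x)) x) \<nu> V.mul = V.euler \<and>
      (\<forall>w. V.frob.casimir (gn \<psi> (chart_inv \<psi> x)) (\<sigma> (T \<psi> x)) (\<lambda>i. partial i (\<lambda>x. \<sigma> (T \<psi> x)) x) \<nu>
        (\<lambda>u v. V.eps (V.mul w u) *\<^sub>R v) = w)"
    if \<psi>: "\<psi> \<in> A" and x: "x \<in> I \<psi>" for \<psi> x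
  proof -
    let ?g = "g' \<psi> (chart_inv \<psi> x)" and ?f = "\<lambda>x. f (T \<psi> x)" and ?u = "\<lambda>x. u (T \<psi> x)"
    have inv: "invertible ?g" using met_inv[OF \<psi>] I[OF \<psi> x] U(3) by blast
    have span: "(\<Sum>a\<in>UNIV. \<Sum>b\<in>UNIV. (ginv ?g a b * ip w (partial a ?f x)) *\<^sub>R partial b ?f x) = w" for w
      unfolding ip_def
      by (rule gram_basis_complete[OF G_sym inv]) (simp only: g'_eq[OF \<psi> x] ip_def)
    note fr = V.paraboloid_frame[OF inv g'_eq[OF \<psi> x] span, where f = "?f x"]
    have py: "partial i (\<lambda>x. y (T \<psi> x)) x = V.paraboloid_tangent (?f x) (partial i ?f x)" for i
      unfolding y_def by (rule V.partial_paraboloid[OF comp_sm[OF \<psi> f_B] x])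
    have ux: "?u x \<noteq> 0" using u(4)[OF I(4)[OF \<psi> x]] by simp
    have p\<sigma>: "partial i (\<lambda>x. \<sigma> (T \<psi> x)) x
        = partial i ?u x *\<^sub>R V.paraboloid (?f x) + ?u x *\<^sub>R V.paraboloid_tangent (?f x) (partial i ?f x)" for i
      using partial_bilinear[OF bounded_bilinear_scaleR comp_sm[OF \<psi> u(2)] comp_sm[OF \<psi> y_B] x, of i]
      by (simp add: \<sigma>_def py add.commute) (simp add: y_def)
    have gn: "gn \<psi> (chart_inv \<psi> x) = (?u x)\<^sup>2 *\<^sub>R ?g" by (simp add: gn_def T_def)
    have sx: "\<sigma> (T \<psi> x) = ?u x *\<^sub>R V.paraboloid (?f x)" by (simp add: \<sigma>_def y_def)
    note re = V.frob.null_frame_rescale[OF fr(1) ux, where ?l1.0 = "\<lambda>i. partial i ?u x"]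
    have bb: "bounded_bilinear (\<lambda>a b. V.eps (V.mul w a) *\<^sub>R b)" for w
      by (rule bounded_bilinear.comp[OF bounded_bilinear_scaleR
            bounded_linear_compose[OF V.eps_linear V.frob.mul.bounded_linear_right] bounded_linear_ident])
    show ?thesis
      unfolding gn sx p\<sigma>
      by (rule exI, rule conjI[OF re(1)], rule conjI,
          rule trans[OF re(2)[OF V.mul_bilinear] fr(2)[OF V.mul_bilinear, folded V.euler_def]],
          rule allI, rule trans[OF re(2)[OF bb] trans[OF fr(2)[OF bb] V.base_casimir_complete]])
  qed
  have inv_r: "V.mul (r (T \<psi> x)) (\<sigma> (T \<psi> x)) = V.one" if "\<psi> \<in> A" "x \<in> I \<psi>" for \<psi> x
    unfolding \<sigma>_def by (rule r(1)[OF I(4)[OF that]])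
  have normal: "V.eps (V.mul (V.mul V.euler (r (T \<psi> x))) (partial k (\<lambda>x. \<sigma> (T \<psi> x)) x)) = 0"
    if "\<psi> \<in> A" "x \<in> I \<psi>" for \<psi> x k
    unfolding comp_pd[OF that(1) \<sigma>_B that(2)]
    by (simp add: V.frob.mul.sum_right V.frob.mul.scaleR_right V.frob.eps.sum V.frob.eps.scaleR
        r(2)[OF I(4)[OF that], folded \<sigma>_def])
  define Sc where "Sc \<psi> x i j k = - 3 * V.eps (V.mul (V.mul (V.mul (r (T \<psi> x))
      (partial i (\<lambda>x. \<sigma> (T \<psi> x)) x)) (partial j (\<lambda>x. \<sigma> (T \<psi> x)) x)) (partial k (\<lambda>x. \<sigma> (T \<psi> x)) x))"
    for \<psi> x i j k
  have eqn: "smooth_on (\<lambda>x. Sc \<psi> x i j k) (I \<psi>)" "totally_symmetric (Sc \<psi> x)"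
    "trace_free3 (gn \<psi> (chart_inv \<psi> x)) (Sc \<psi> x)"
    "partial l (\<lambda>x. Sc \<psi> x i j k) x
      - (\<Sum>m\<in>UNIV. christoffel_coords (\<lambda>x. gn \<psi> (chart_inv \<psi> x)) x m l i * Sc \<psi> x m j k
          + christoffel_coords (\<lambda>x. gn \<psi> (chart_inv \<psi> x)) x m l j * Sc \<psi> x i m k
          + christoffel_coords (\<lambda>x. gn \<psi> (chart_inv \<psi> x)) x m l k * Sc \<psi> x i j m)
      = (1 / 18) * Pi_ijk (gn \<psi> (chart_inv \<psi> x)) (rhs4 (gn \<psi> (chart_inv \<psi> x)) (Sc \<psi> x)) i j k l"
    if \<psi>: "\<psi> \<in> A" and x: "x \<in> I \<psi>" for \<psi> x l i j k
    using V.frob.cone_section_equation[where g = "\<lambda>x. gn \<psi> (chart_inv \<psi> x)" and r = "\<lambda>x. r (T \<psi> x)"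
        and \<sigma> = "\<lambda>x. \<sigma> (T \<psi> x)" and D = "I \<psi>" and \<omega> = V.euler,
        OF card I_open[OF \<psi>] comp_sm[OF \<psi> \<sigma>_B] inv_r[OF \<psi>] frame[OF \<psi>] normal[OF \<psi>] V.eps_euler x]
    unfolding Sc_def[abs_def] by blast+
  have S_coords: "S \<psi> (chart_inv \<psi> x) = Sc \<psi> x" if "\<psi> \<in> A" "x \<in> I \<psi>" for \<psi> x
    unfolding S_def[abs_def] Sc_def[abs_def] I(3)[OF that] T_def ..
  have S_coords_nth: "S \<psi> (chart_inv \<psi> x) i j k = Sc \<psi> x i j k" if "\<psi> \<in> A" "x \<in> I \<psi>" for \<psi> x i j k
    unfolding S_coords[OF that] ..
  have pI: "coord \<psi> p \<in> I \<psi>" "chart_inv \<psi> (coord \<psi> p) = p" if "\<psi> \<in> A" "p \<in> U" "p \<in> dom_chart \<psi>" for \<psi> p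
    using that inv_coord by (auto simp: I_def)
  have S_sm: "smooth_on (\<lambda>x. S \<psi> (chart_inv \<psi> x) i j k) (I \<psi>)" if \<psi>: "\<psi> \<in> A" for \<psi> i j k
  proof (cases "I \<psi> = {}")
    case True
    then show ?thesis
      using smooth_on_const[of "{}" "0 :: real"]
        smooth_on_cong[of "{}" "\<lambda>x. S \<psi> (chart_inv \<psi> x) i j k" "\<lambda>x. 0"] by simp
  next
    case False
    then obtain x where "x \<in> I \<psi>" by blast
    from eqn(1)[OF \<psi> this] show ?thesis
      using smooth_on_cong[of "I \<psi>" "\<lambda>x. S \<psi> (chart_inv \<psi> x) i j k" "\<lambda>x. Sc \<psi> x i j k",
          OF I_open[OF \<psi>] S_coords_nth[OF \<psi>]] by blast
  qed
  have tensor: "is_tensor3_at A p (\<lambda>\<psi>. S \<psi> p)" if p: "p \<in> U" for p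
    unfolding is_tensor3_at_def
  proof (intro ballI impI allI)
    fix \<psi> \<psi>' i j k
    assume \<psi>: "\<psi> \<in> A" "\<psi>' \<in> A" and pp: "p \<in> dom_chart \<psi> \<inter> dom_chart \<psi>'"
    let ?J = "jacobian \<psi> \<psi>' p" and ?t = "\<lambda>a. partial a (\<lambda>x. \<sigma> (T \<psi> x)) (coord \<psi> p)" and ?r = "r (coord \<phi> p)"
    have t: "partial i (\<lambda>x. \<sigma> (T \<psi>' x)) (coord \<psi>' p) = (\<Sum>a\<in>UNIV. ?J a i *\<^sub>R ?t a)" for i
      using partial_change_chart[OF atlas \<psi> U(1), of "\<lambda>p. \<sigma> (coord \<phi> p)" p i] comp_sm[OF \<psi>(1) \<sigma>_B] p pp
      unfolding T_def I_def by blast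
    have 1: "V.mul ?r (\<Sum>a\<in>UNIV. ?J a i *\<^sub>R ?t a) = (\<Sum>a\<in>UNIV. ?J a i *\<^sub>R V.mul ?r (?t a))"
      by (simp only: V.frob.mul.sum_right V.frob.mul.scaleR_right)
    have 2: "V.mul (\<Sum>a\<in>UNIV. ?J a i *\<^sub>R V.mul ?r (?t a)) (\<Sum>b\<in>UNIV. ?J b j *\<^sub>R ?t b)
        = (\<Sum>a\<in>UNIV. ?J a i *\<^sub>R (\<Sum>b\<in>UNIV. ?J b j *\<^sub>R V.mul (V.mul ?r (?t a)) (?t b)))"
      unfolding V.frob.mul.sum_left V.frob.mul.scaleR_left
      unfolding V.frob.mul.sum_right V.frob.mul.scaleR_right ..
    have 3: "V.mul (\<Sum>a\<in>UNIV. ?J a i *\<^sub>R (\<Sum>b\<in>UNIV. ?J b j *\<^sub>R V.mul (V.mul ?r (?t a)) (?t b))) (\<Sum>c\<in>UNIV. ?J c k *\<^sub>R ?t c)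
        = (\<Sum>a\<in>UNIV. ?J a i *\<^sub>R (\<Sum>b\<in>UNIV. ?J b j *\<^sub>R (\<Sum>c\<in>UNIV. ?J c k *\<^sub>R
            V.mul (V.mul (V.mul ?r (?t a)) (?t b)) (?t c))))"
      unfolding V.frob.mul.sum_left V.frob.mul.scaleR_left
      unfolding V.frob.mul.sum_right V.frob.mul.scaleR_right ..
    show "S \<psi>' p i j k = (\<Sum>a\<in>UNIV. \<Sum>b\<in>UNIV. \<Sum>c\<in>UNIV. ?J a i * ?J b j * ?J c k * S \<psi> p a b c)"
      unfolding S_def t 1 2 3 V.frob.eps.sum V.frob.eps.scaleR real_scaleR_def
      by (simp add: sum_distrib_left mult_ac)
  qed

  \<comment> \<open>At \<open>x\<^sub>0\<close> the section is the unit and the differential of \<open>u\<close> vanishes, so \<open>S\<close> is the cubic form of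
    the algebra, up to the factor.\<close>
  have S_\<phi>: "S \<phi> x\<^sub>0 = \<Psi> \<phi>"
  proof (intro ext)
    fix i j k
    note x0 = pI[OF \<phi>(1) U(2) \<phi>(2)]
    have "partial i (\<lambda>x. \<sigma> (T \<phi> x)) ?x = partial i \<sigma> ?x" for i
    proof -
      have "\<sigma> (T \<phi> x) = \<sigma> x" if "x \<in> I \<phi>" for x using I(3)[OF \<phi>(1) that] by (simp add: T_def)
      from frechet_derivative_eq_on_open(1)[OF I_open[OF \<phi>(1)] x0(1) this smooth_on_has_derivative[OF \<sigma>_B xB]]
      show ?thesis by (rule fun_cong)
    qed
    moreover have "partial i \<sigma> ?x = (0, e i, 0)" for i
    proof -
      have py: "partial i y ?x = (0, e i, 0)"
        unfolding y_def[abs_def] V.partial_paraboloid[OF f(1) xB1] f(2,3)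
        by (simp add: V.paraboloid_tangent_def V.ip.zero_left e_def)
      have "partial i u ?x = 0" unfolding u(3) py V.euler_tangent by simp
      then show ?thesis
        using partial_bilinear[OF bounded_bilinear_scaleR u(2) y_B xB, of i]
        by (simp add: \<sigma>_def[abs_def] py u(1))
    qed
    moreover have "r ?x = V.one"
      using r(1)[OF xB] by (simp add: u(1) y0 V.frob.unit_right)
    ultimately have "S \<phi> x\<^sub>0 i j k = - 3 * V.eps (V.mul (V.mul (0, e i, 0) (0, e j, 0)) (0, e k, 0))"
      by (simp add: S_def V.frob.unit)
    also have "\<dots> = - 3 * C i j k"
      unfolding S0[symmetric] V.mul_simp[of 0 "e i" 0 0 "e j" 0] V.eps_mul by simp
    finally show "S \<phi> x\<^sub>0 i j k = \<Psi> \<phi> i j k" by (simp add: C_def)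
  qed
  have S_x0: "S \<psi> x\<^sub>0 = \<Psi> \<psi>" if \<psi>: "\<psi> \<in> A" "x\<^sub>0 \<in> dom_chart \<psi>" for \<psi>
  proof (intro ext)
    fix i j k
    show "S \<psi> x\<^sub>0 i j k = \<Psi> \<psi> i j k"
      using tensor[OF U(2)] assms(6) \<phi> \<psi> S_\<phi> unfolding is_tensor3_at_def by simp
  qed

  obtain h where h: "h \<in> c" "conformal_on A U1 h g'" using lm unfolding local_member_def by blast
  have u_sq: "smooth_on (\<lambda>x. (u (T \<psi> x))\<^sup>2) (I \<psi>)" if "\<psi> \<in> A" for \<psi>
    unfolding power2_eq_square
    by (intro smooth_on_mult I_open that comp_sm u(2))
  have u_pos: "u (coord \<phi> p) > 0" if "p \<in> U" for p
    using that u(4) by (simp add: U_def)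
  have gn_metric: "is_metric A U gn"
    unfolding is_metric_def
  proof (intro conjI ballI allI)
    fix \<psi> assume \<psi>: "\<psi> \<in> A"
    have "smooth_on (\<lambda>x. g' \<psi> (chart_inv \<psi> x)) (I \<psi>)"
    proof (rule smooth_on_subset)
      show "smooth_on (\<lambda>x. g' \<psi> (chart_inv \<psi> x)) (coord \<psi> ` (dom_chart \<psi> \<inter> U1))"
        using met \<psi> unfolding is_metric_def smooth_in_chart_def o_def by blast
      show "I \<psi> \<subseteq> coord \<psi> ` (dom_chart \<psi> \<inter> U1)" using U(3) by (auto simp: I_def)
    qed
    from smooth_on_scaleR[OF I_open[OF \<psi>] u_sq[OF \<psi>] this]
    show "smooth_in_chart \<psi> U (gn \<psi>)"
      by (simp add: smooth_in_chart_def o_def gn_def T_def I_def)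
    fix p assume p: "p \<in> U \<inter> dom_chart \<psi>"
    then have "p \<in> U1" "p \<in> dom_chart \<psi>" "u (coord \<phi> p) \<noteq> 0" using U(3) u_pos[of p] by auto
    then show "transpose (gn \<psi> p) = gn \<psi> p" "invertible (gn \<psi> p)"
      using met_sym[OF \<psi>, of p] ginv_scale(1)[OF met_inv[OF \<psi>, of p]]
      by (simp_all add: gn_def transpose_scalar)
  next
    fix \<psi> \<psi>' p i j
    assume \<psi>: "\<psi> \<in> A" "\<psi>' \<in> A" and p: "p \<in> U \<inter> dom_chart \<psi> \<inter> dom_chart \<psi>'"
    then have "g' \<psi>' p $ i $ j = (\<Sum>a\<in>UNIV. \<Sum>b\<in>UNIV. jacobian \<psi> \<psi>' p a i * jacobian \<psi> \<psi>' p b j * g' \<psi> p $ a $ b)"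
      using met U(3) unfolding is_metric_def by blast
    then show "gn \<psi>' p $ i $ j = (\<Sum>a\<in>UNIV. \<Sum>b\<in>UNIV. jacobian \<psi> \<psi>' p a i * jacobian \<psi> \<psi>' p b j * gn \<psi> p $ a $ b)"
      by (simp add: gn_def sum_distrib_left mult_ac)
  qed
  have gn_member: "local_member A c U gn"
  proof -
    obtain \<Omega> where \<Omega>: "\<And>\<psi>. \<psi> \<in> A \<Longrightarrow> smooth_in_chart \<psi> U1 \<Omega>" "\<And>p. p \<in> U1 \<Longrightarrow> \<Omega> p > 0"
      "\<And>\<psi> p. \<psi> \<in> A \<Longrightarrow> p \<in> U1 \<Longrightarrow> p \<in> dom_chart \<psi> \<Longrightarrow> g' \<psi> p = \<Omega> p *\<^sub>R h \<psi> p"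
      using h(2) unfolding conformal_on_def by blast
    have "conformal_on A U h gn"
      unfolding conformal_on_def
    proof (intro exI[of _ "\<lambda>p. (u (coord \<phi> p))\<^sup>2 * \<Omega> p"] conjI ballI)
      fix \<psi> assume \<psi>: "\<psi> \<in> A"
      have "smooth_on (\<lambda>x. \<Omega> (chart_inv \<psi> x)) (I \<psi>)"
      proof (rule smooth_on_subset)
        show "smooth_on (\<lambda>x. \<Omega> (chart_inv \<psi> x)) (coord \<psi> ` (dom_chart \<psi> \<inter> U1))"
          using \<Omega>(1)[OF \<psi>] unfolding smooth_in_chart_def o_def .
        show "I \<psi> \<subseteq> coord \<psi> ` (dom_chart \<psi> \<inter> U1)" using U(3) by (auto simp: I_def)
      qed
      from smooth_on_mult[OF I_open[OF \<psi>] u_sq[OF \<psi>] this]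
      show "smooth_in_chart \<psi> U (\<lambda>p. (u (coord \<phi> p))\<^sup>2 * \<Omega> p)"
        by (simp add: smooth_in_chart_def o_def T_def I_def)
      fix p assume "p \<in> U \<inter> dom_chart \<psi>"
      then show "gn \<psi> p = ((u (coord \<phi> p))\<^sup>2 * \<Omega> p) *\<^sub>R h \<psi> p"
        using \<Omega>(3)[OF \<psi>, of p] U(3) by (auto simp: gn_def)
    next
      fix p assume "p \<in> U"
      then show "(u (coord \<phi> p))\<^sup>2 * \<Omega> p > 0" using u_pos[of p] \<Omega>(2)[of p] U(3) by auto
    qed
    with gn_metric h(1) show ?thesis unfolding local_member_def by blast
  qed

  have sym_tf: "totally_symmetric (S \<psi> p) \<and> trace_free3 (g\<^sub>0 \<psi> p) (S \<psi> p)"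
    if \<psi>: "\<psi> \<in> A" and p: "p \<in> U" "p \<in> dom_chart \<psi>" for \<psi> p
  proof
    note x = pI[OF \<psi> p]
    note E = eqn(2,3)[OF \<psi> x(1), folded S_coords[OF \<psi> x(1)], unfolded x(2)]
    show "totally_symmetric (S \<psi> p)" by (rule E(1))
    obtain s' where s': "s' > 0" "g' \<psi> p = s' *\<^sub>R g\<^sub>0 \<psi> p"
      using local_member_scale[OF cc assms(5) lm, of p] p \<psi> U(3) by blast
    have "trace_free3 (((u (coord \<phi> p))\<^sup>2 * s') *\<^sub>R g\<^sub>0 \<psi> p) (S \<psi> p)"
      using E(2) by (simp add: gn_def s'(2))
    moreover have "invertible (g\<^sub>0 \<psi> p)"
      using ginv_scale(1)[OF met_inv[OF \<psi> _ p(2)], of "1 / s'"] s' p U(3) by auto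
    ultimately show "trace_free3 (g\<^sub>0 \<psi> p) (S \<psi> p)"
      using trace_free3_scale[of "g\<^sub>0 \<psi> p" "(u (coord \<phi> p))\<^sup>2 * s'"] s'(1) u_pos[OF p(1)] by simp
  qed
  have equation: "cov_deriv3 gn S \<psi> p l i j k = (1/18) * Pi_ijk (gn \<psi> p) (rhs4 (gn \<psi> p) (S \<psi> p)) i j k l"
    if \<psi>: "\<psi> \<in> A" and p: "p \<in> U" "p \<in> dom_chart \<psi>" for \<psi> p i j k l
  proof -
    note x = pI[OF \<psi> p]
    let ?x = "coord \<psi> p"
    have Sx: "Sc \<psi> ?x = S \<psi> p" using S_coords[OF \<psi> x(1)] x(2) by simp
    from frechet_derivative_eq_on_open(1)[OF I_open[OF \<psi>] x(1)
        S_coords_nth[OF \<psi>] smooth_on_has_derivative[OF eqn(1)[OF \<psi> x(1)] x(1)]]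
    have pS: "pd \<psi> l (\<lambda>q. S \<psi> q i j k) p = partial l (\<lambda>x. Sc \<psi> x i j k) ?x"
      unfolding pd_eq_partial by (rule fun_cong)
    show ?thesis
      unfolding cov_deriv3_def pS christoffel_eq_coords[OF atlas \<psi> p(2)]
      by (rule eqn(4)[OF \<psi> x(1), unfolded Sx x(2)])
  qed
  show ?thesis
  proof (intro exI[of _ U] exI[of _ S] conjI)
    show "is_tensor_field3 A U S"
      unfolding is_tensor_field3_def smooth_in_chart_def o_def
      using tensor S_sm unfolding I_def by blast
    show "\<exists>g. local_member A c U g \<and> (\<forall>\<phi>\<in>A. \<forall>p\<in>U \<inter> dom_chart \<phi>. \<forall>i j k l.
        cov_deriv3 g S \<phi> p l i j k = (1/18) * Pi_ijk (g \<phi> p) (rhs4 (g \<phi> p) (S \<phi> p)) i j k l)"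
      using gn_member equation by blast
  qed (use U S_x0 sym_tf in blast)+
qed

end
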